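(* Let $G$ be a locally compact, compactly generated group with Property $H_{FD}$. If $G$ has a Hilbert length function with linear growth, then $G$ has a proper, cocompact (isometric) action on a Euclidean space. In particular, if $G$ is moreover discrete, then it is virtually abelian.
   Context: Let $G$ be a locally compact group and $\pi$ a continuous unitary or orthogonal representation on a Hilbert space $\mathcal{H}$. $Z^1(G,\pi)$ is the space of continuous maps $b:G\to\mathcal{H}$ (1-cocycles) with $b(gh)=\pi(g)b(h)+b(g)$, with the topology of uniform convergence on compact subsets; $B^1(G,\pi)$ is the subspace of coboundaries $g\mapsto v-\pi(g)v$, $v\in\mathcal{H}$; the first reduced cohomology is $\overline{H^1}(G,\pi)=Z^1(G,\pi)/\overline{B^1(G,\pi)}$. $G$ has Property $H_{FD}$ if every unitary representation $\pi$ of $G$ with $\overline{H^1}(G,\pi)\ne0$ has a nonzero finite-dimensional subrepresentation. A Hilbert length function on $G$ is a function $g\mapsto\|b(g)\|$ with $b$ a 1-cocycle. It has linear growth if there are $M>0$ and a compact $K\subset G$ such that $|g|_S\le M\|b(g)\|$ for all $g\notin K$, where $|\cdot|_S$ is the word length with respect to a compact generating subset $S$. A Euclidean space is a finite-dimensional real Hilbert space. *)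

theory Defs
  imports "HOL-Analysis.Analysis" "HOL-Algebra.Algebra"
begin

section \<open>Hilbert spaces\<close>

text \<open>
  Property \<open>H\<^sub>F\<^sub>D\<close> quantifies over Hilbert spaces inside a formula, so Hilbert spaces are structures
  on a carrier set and not a type class. Real and complex Hilbert spaces are treated together: the
  field of scalars is a set \<open>K\<close> of complex numbers, either \<open>\<real>\<close> or \<open>UNIV\<close>, and the inner product
  takes values in \<open>K\<close>. A record of type \<open>inner_module\<close> extends the records for modules,
  whose fields \<open>mult\<close> and \<open>one\<close> play no role.
\<close>

record 'v inner_module = "(complex, 'v) module" +
  ip :: "'v \<Rightarrow> 'v \<Rightarrow> complex"

definition scalar_field :: "complex set \<Rightarrow> complex ring" where
  "scalar_field K = \<lparr>carrier = K, mult = (*), one = 1, ring.zero = 0, add = (+)\<rparr>"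

definition hnorm :: "'v inner_module \<Rightarrow> 'v \<Rightarrow> real" where
  "hnorm H x = sqrt (Re (ip H x x))"

text \<open>The value off the carrier is irrelevant; it is chosen so that \<open>Metric_space\<close>, which
  constrains the distance function on the whole type, applies.\<close>

definition hdist :: "'v inner_module \<Rightarrow> 'v \<Rightarrow> 'v \<Rightarrow> real" where
  "hdist H x y = (if x \<in> carrier H \<and> y \<in> carrier H then hnorm H (x \<ominus>\<^bsub>H\<^esub> y) else 0)"

definition htop :: "'v inner_module \<Rightarrow> 'v topology" where
  "htop H = Metric_space.mtopology (carrier H) (hdist H)"

locale inner_product_space = Module.module "scalar_field K" H
  for K :: "complex set" and H :: "'v inner_module" +
  assumes scalars: "K = \<real> \<or> K = UNIV"
    and ip_closed: "\<lbrakk>x \<in> carrier H; y \<in> carrier H\<rbrakk> \<Longrightarrow> ip H x y \<in> K"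
    and ip_commute: "\<lbrakk>x \<in> carrier H; y \<in> carrier H\<rbrakk> \<Longrightarrow> ip H y x = cnj (ip H x y)"
    and ip_add_left: "\<lbrakk>x \<in> carrier H; y \<in> carrier H; z \<in> carrier H\<rbrakk>
          \<Longrightarrow> ip H (x \<oplus>\<^bsub>H\<^esub> y) z = ip H x z + ip H y z"
    and ip_smult_left: "\<lbrakk>a \<in> K; x \<in> carrier H; y \<in> carrier H\<rbrakk>
          \<Longrightarrow> ip H (a \<odot>\<^bsub>H\<^esub> x) y = a * ip H x y"
    and ip_pos: "\<lbrakk>x \<in> carrier H; x \<noteq> \<zero>\<^bsub>H\<^esub>\<rbrakk> \<Longrightarrow> 0 < Re (ip H x x)"

locale hilbert_space = inner_product_space +
  assumes complete: "Metric_space.mcomplete (carrier H) (hdist H)"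

definition finite_dimensional :: "complex set \<Rightarrow> 'v inner_module \<Rightarrow> 'v set \<Rightarrow> bool" where
  "finite_dimensional K H W \<longleftrightarrow>
     (\<exists>B. finite B \<and> B \<subseteq> W \<and>
        (\<forall>w\<in>W. \<exists>c\<in>B \<rightarrow> K. w = (\<Oplus>\<^bsub>H\<^esub>x\<in>B. c x \<odot>\<^bsub>H\<^esub> x)))"

definition euclidean_space_on :: "'v inner_module \<Rightarrow> bool" where
  "euclidean_space_on E \<longleftrightarrow> hilbert_space \<real> E \<and> finite_dimensional \<real> E (carrier E)"


section \<open>Locally compact groups\<close>

locale topological_group = group G
  for G :: "('g, 'm) monoid_scheme" (structure) and T :: "'g topology" +
  assumes topspace_eq: "topspace T = carrier G"
    and continuous_mult: "continuous_map (prod_topology T T) T (\<lambda>(x, y). x \<otimes> y)"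
    and continuous_inv: "continuous_map T T (\<lambda>x. inv x)"

locale locally_compact_group = topological_group +
  assumes hausdorff: "Hausdorff_space T"
    and locally_compact: "locally_compact_space T"

definition compact_generating_set ::
    "('g, 'm) monoid_scheme \<Rightarrow> 'g topology \<Rightarrow> 'g set \<Rightarrow> bool" where
  "compact_generating_set G T S \<longleftrightarrow> compactin T S \<and> generate G S = carrier G"

definition compactly_generated :: "('g, 'm) monoid_scheme \<Rightarrow> 'g topology \<Rightarrow> bool" where
  "compactly_generated G T \<longleftrightarrow> (\<exists>S. compact_generating_set G T S)"

definition word_length :: "('g, 'm) monoid_scheme \<Rightarrow> 'g set \<Rightarrow> 'g \<Rightarrow> nat" where
  "word_length G S g =
     (LEAST n. \<exists>xs. length xs = n \<and> set xs \<subseteq> S \<union> m_inv G ` S \<and> g = foldr (\<otimes>\<^bsub>G\<^esub>) xs \<one>\<^bsub>G\<^esub>)"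

definition virtually_abelian :: "('g, 'm) monoid_scheme \<Rightarrow> bool" where
  "virtually_abelian G \<longleftrightarrow>
     (\<exists>A. subgroup A G \<and> comm_group (G\<lparr>carrier := A\<rparr>) \<and> finite (rcosets\<^bsub>G\<^esub> A))"


section \<open>Representations and reduced cohomology\<close>

text \<open>A continuous unitary (\<open>K = UNIV\<close>) or orthogonal (\<open>K = \<real>\<close>) representation; continuity is
  continuity for the strong operator topology.\<close>

locale hilbert_rep = group_action G "carrier H" \<pi> + hilbert_space K H
  for G :: "('g, 'm) monoid_scheme" (structure) and T :: "'g topology"
    and K and H :: "'v inner_module" and \<pi> +
  assumes rep_add: "\<lbrakk>g \<in> carrier G; x \<in> carrier H; y \<in> carrier H\<rbrakk>
          \<Longrightarrow> \<pi> g (x \<oplus>\<^bsub>H\<^esub> y) = \<pi> g x \<oplus>\<^bsub>H\<^esub> \<pi> g y"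
    and rep_smult: "\<lbrakk>g \<in> carrier G; a \<in> K; x \<in> carrier H\<rbrakk>
          \<Longrightarrow> \<pi> g (a \<odot>\<^bsub>H\<^esub> x) = a \<odot>\<^bsub>H\<^esub> \<pi> g x"
    and rep_ip: "\<lbrakk>g \<in> carrier G; x \<in> carrier H; y \<in> carrier H\<rbrakk>
          \<Longrightarrow> ip H (\<pi> g x) (\<pi> g y) = ip H x y"
    and rep_continuous: "x \<in> carrier H \<Longrightarrow> continuous_map T (htop H) (\<lambda>g. \<pi> g x)"

abbreviation unitary_rep where "unitary_rep G T H \<pi> \<equiv> hilbert_rep G T UNIV H \<pi>"
abbreviation orthogonal_rep where "orthogonal_rep G T H \<pi> \<equiv> hilbert_rep G T \<real> H \<pi>"

text \<open>Cocycles and coboundaries are extensional functions, so that equality of functions is equality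
  on the group.\<close>

definition cocycles ::
    "('g, 'm) monoid_scheme \<Rightarrow> 'g topology \<Rightarrow> 'v inner_module \<Rightarrow> ('g \<Rightarrow> 'v \<Rightarrow> 'v) \<Rightarrow> ('g \<Rightarrow> 'v) set"
  where
  "cocycles G T H \<pi> =
     {b \<in> carrier G \<rightarrow>\<^sub>E carrier H. continuous_map T (htop H) b \<and>
        (\<forall>g\<in>carrier G. \<forall>h\<in>carrier G. b (g \<otimes>\<^bsub>G\<^esub> h) = \<pi> g (b h) \<oplus>\<^bsub>H\<^esub> b g)}"

definition coboundaries ::
    "('g, 'm) monoid_scheme \<Rightarrow> 'v inner_module \<Rightarrow> ('g \<Rightarrow> 'v \<Rightarrow> 'v) \<Rightarrow> ('g \<Rightarrow> 'v) set" where
  "coboundaries G H \<pi> = (\<lambda>v. \<lambda>g\<in>carrier G. v \<ominus>\<^bsub>H\<^esub> \<pi> g v) ` carrier H"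

definition cocycle_nbhd where
  "cocycle_nbhd G T H \<pi> b Q \<epsilon> = {c \<in> cocycles G T H \<pi>. \<forall>g\<in>Q. hdist H (b g) (c g) < \<epsilon>}"

text \<open>The topology of uniform convergence on compact subsets.\<close>

definition cocycle_topology where
  "cocycle_topology G T H \<pi> = topology (\<lambda>U. U \<subseteq> cocycles G T H \<pi> \<and>
     (\<forall>b\<in>U. \<exists>Q \<epsilon>. compactin T Q \<and> \<epsilon> > 0 \<and> cocycle_nbhd G T H \<pi> b Q \<epsilon> \<subseteq> U))"

definition cocycle_group ::
    "('g, 'm) monoid_scheme \<Rightarrow> 'g topology \<Rightarrow> 'v inner_module \<Rightarrow> ('g \<Rightarrow> 'v \<Rightarrow> 'v) \<Rightarrow> ('g \<Rightarrow> 'v) monoid"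
  where
  "cocycle_group G T H \<pi> =
     \<lparr>carrier = cocycles G T H \<pi>,
      mult = (\<lambda>b c. \<lambda>g\<in>carrier G. b g \<oplus>\<^bsub>H\<^esub> c g),
      one = (\<lambda>g\<in>carrier G. \<zero>\<^bsub>H\<^esub>)\<rparr>"

definition reduced_H1 where
  "reduced_H1 G T H \<pi> =
     cocycle_group G T H \<pi> Mod (cocycle_topology G T H \<pi> closure_of coboundaries G H \<pi>)"


section \<open>Property \<open>H\<^sub>F\<^sub>D\<close>\<close>

definition has_finite_dimensional_subrep ::
    "('g, 'm) monoid_scheme \<Rightarrow> complex set \<Rightarrow> 'v inner_module \<Rightarrow> ('g \<Rightarrow> 'v \<Rightarrow> 'v) \<Rightarrow> bool" where
  "has_finite_dimensional_subrep G K H \<pi> \<longleftrightarrow>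
     (\<exists>W. submodule W (scalar_field K) H \<and> (\<forall>g\<in>carrier G. \<pi> g ` W \<subseteq> W) \<and>
          finite_dimensional K H W \<and> W \<noteq> {\<zero>\<^bsub>H\<^esub>})"

text \<open>
  A formula cannot quantify over all types, so the Hilbert spaces range over those carried by subsets
  of the type \<open>'g \<Rightarrow> complex\<close>. This loses nothing: theorem \<open>property_HFD_any_space\<close> below derives
  the property for unitary representations on Hilbert spaces carried by any type. (If \<open>V\<close> is the closed
  span of the values of a cocycle \<open>b\<close>, then \<open>V\<close> is invariant, and \<open>x \<mapsto> (g \<mapsto> \<langle>x, b(g)\<rangle>)\<close> is injective
  on \<open>V\<close>.)
\<close>

definition property_HFD :: "('g, 'm) monoid_scheme \<Rightarrow> 'g topology \<Rightarrow> bool" where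
  "property_HFD G T \<longleftrightarrow>
     (\<forall>(H :: ('g \<Rightarrow> complex) inner_module) \<pi>.
        unitary_rep G T H \<pi> \<and> \<not> trivial_group (reduced_H1 G T H \<pi>)
        \<longrightarrow> has_finite_dimensional_subrep G UNIV H \<pi>)"


section \<open>Hilbert length functions and isometric actions\<close>

text \<open>The values of \<open>l\<close> off the group are irrelevant.\<close>

definition hilbert_length_function ::
    "('g, 'm) monoid_scheme \<Rightarrow> 'g topology \<Rightarrow> 'v inner_module \<Rightarrow> ('g \<Rightarrow> real) \<Rightarrow> bool" where
  "hilbert_length_function G T H l \<longleftrightarrow>
     (\<exists>\<pi> b. (unitary_rep G T H \<pi> \<or> orthogonal_rep G T H \<pi>) \<and> b \<in> cocycles G T H \<pi> \<and>
        (\<forall>g\<in>carrier G. l g = hnorm H (b g)))"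

definition linear_growth :: "('g, 'm) monoid_scheme \<Rightarrow> 'g topology \<Rightarrow> ('g \<Rightarrow> real) \<Rightarrow> bool" where
  "linear_growth G T l \<longleftrightarrow>
     (\<exists>S. compact_generating_set G T S \<and>
        (\<exists>M>0. \<exists>Q. compactin T Q \<and>
           (\<forall>g\<in>carrier G - Q. real (word_length G S g) \<le> M * l g)))"

locale isometric_action = group_action G "carrier E" \<alpha>
  for G :: "('g, 'm) monoid_scheme" (structure) and T :: "'g topology"
    and E :: "'v inner_module" and \<alpha> +
  assumes isometric: "\<lbrakk>g \<in> carrier G; x \<in> carrier E; y \<in> carrier E\<rbrakk>
          \<Longrightarrow> hdist E (\<alpha> g x) (\<alpha> g y) = hdist E x y"
    and action_continuous:
      "continuous_map (prod_topology T (htop E)) (htop E) (\<lambda>(g, x). \<alpha> g x)"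

definition proper_action where
  "proper_action G T E \<alpha> \<longleftrightarrow>
     (\<forall>L. compactin (htop E) L \<longrightarrow>
        compactin T (T closure_of {g \<in> carrier G. \<alpha> g ` L \<inter> L \<noteq> {}}))"

definition cocompact_action where
  "cocompact_action G E \<alpha> \<longleftrightarrow>
     (\<exists>L. compactin (htop E) L \<and> (\<Union>g\<in>carrier G. \<alpha> g ` L) = carrier E)"

section \<open>Basic facts\<close>

lemma scalar_field_simps [simp]:
  "carrier (scalar_field K) = K" "x \<otimes>\<^bsub>scalar_field K\<^esub> y = x * y" "\<one>\<^bsub>scalar_field K\<^esub> = 1"
  "\<zero>\<^bsub>scalar_field K\<^esub> = 0" "x \<oplus>\<^bsub>scalar_field K\<^esub> y = x + y"
  by (simp_all add: scalar_field_def)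

context inner_product_space
begin

lemma real_in_scalars: "of_real t \<in> K"
  using scalars by auto

lemma minus_eq_smult: "x \<in> carrier H \<Longrightarrow> \<ominus>\<^bsub>H\<^esub> x = (of_real (- 1)) \<odot>\<^bsub>H\<^esub> x"
proof -
  assume x: "x \<in> carrier H"
  have m: "(of_real (-1) :: complex) \<in> K" and o: "(1::complex) \<in> K"
    using real_in_scalars[of "-1"] real_in_scalars[of 1] by auto
  have "x \<oplus>\<^bsub>H\<^esub> (of_real (- 1)) \<odot>\<^bsub>H\<^esub> x = (1 \<odot>\<^bsub>H\<^esub> x) \<oplus>\<^bsub>H\<^esub> (of_real (- 1)) \<odot>\<^bsub>H\<^esub> x"
    using x smult_one by simp
  also have "\<dots> = (1 + of_real (-1)) \<odot>\<^bsub>H\<^esub> x"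
    using smult_l_distr[of 1 "of_real (-1)" x] x m o by simp
  also have "\<dots> = \<zero>\<^bsub>H\<^esub>" using x smult_l_null[of x] by simp
  finally have "x \<oplus>\<^bsub>H\<^esub> (of_real (- 1)) \<odot>\<^bsub>H\<^esub> x = \<zero>\<^bsub>H\<^esub>" .
  moreover have "(of_real (- 1)) \<odot>\<^bsub>H\<^esub> x \<in> carrier H" using smult_closed[of "of_real (-1)" x] m x by simp
  ultimately show ?thesis using x M.minus_equality M.a_comm by metis
qed

lemma ip_minus_left: "x \<in> carrier H \<Longrightarrow> y \<in> carrier H \<Longrightarrow> ip H (\<ominus>\<^bsub>H\<^esub> x) y = - ip H x y"
  using minus_eq_smult ip_smult_left[of "of_real (-1)" x y] real_in_scalars[of "-1"] by simp

lemma ip_diff_left: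
  "\<lbrakk>x \<in> carrier H; y \<in> carrier H; z \<in> carrier H\<rbrakk> \<Longrightarrow> ip H (x \<ominus>\<^bsub>H\<^esub> y) z = ip H x z - ip H y z"
  by (simp add: a_minus_def ip_add_left ip_minus_left)

lemma ip_add_right:
  "\<lbrakk>x \<in> carrier H; y \<in> carrier H; z \<in> carrier H\<rbrakk> \<Longrightarrow> ip H z (x \<oplus>\<^bsub>H\<^esub> y) = ip H z x + ip H z y"
  using ip_commute[of _ z] ip_add_left by simp

lemma ip_diff_right:
  "\<lbrakk>x \<in> carrier H; y \<in> carrier H; z \<in> carrier H\<rbrakk> \<Longrightarrow> ip H z (x \<ominus>\<^bsub>H\<^esub> y) = ip H z x - ip H z y"
  using ip_commute[of _ z] ip_diff_left by simp

lemma ip_smult_right: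
  "\<lbrakk>a \<in> K; x \<in> carrier H; y \<in> carrier H\<rbrakk> \<Longrightarrow> ip H x (a \<odot>\<^bsub>H\<^esub> y) = cnj a * ip H x y"
  using ip_commute[of "a \<odot>\<^bsub>H\<^esub> y" x] ip_commute[of y x] ip_smult_left smult_closed[of a y] by simp

lemma ip_zero_left [simp]: "x \<in> carrier H \<Longrightarrow> ip H \<zero>\<^bsub>H\<^esub> x = 0"
  using ip_diff_left[of x x x] by (simp add: M.r_neg a_minus_def)

lemma ip_nonneg: "x \<in> carrier H \<Longrightarrow> 0 \<le> Re (ip H x x)"
  using ip_pos[of x] ip_zero_left[of x] by (cases "x = \<zero>\<^bsub>H\<^esub>") auto

lemma hnorm_nonneg: "x \<in> carrier H \<Longrightarrow> 0 \<le> hnorm H x"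
  using ip_nonneg by (simp add: hnorm_def)

lemma hnorm_sq: "x \<in> carrier H \<Longrightarrow> (hnorm H x)\<^sup>2 = Re (ip H x x)"
  using ip_nonneg by (simp add: hnorm_def)

lemma hnorm_eq_0: "x \<in> carrier H \<Longrightarrow> hnorm H x = 0 \<longleftrightarrow> x = \<zero>\<^bsub>H\<^esub>"
  using ip_pos[of x] ip_zero_left[of x] by (cases "x = \<zero>\<^bsub>H\<^esub>") (auto simp: hnorm_def)

lemma Re_ip_le:
  assumes x: "x \<in> carrier H" and y: "y \<in> carrier H"
  shows "\<bar>Re (ip H x y)\<bar> \<le> hnorm H x * hnorm H y"
proof (cases "y = \<zero>\<^bsub>H\<^esub>")
  case True
  then show ?thesis using x y ip_commute[of y x] by (simp add: hnorm_def)
next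
  case False
  let ?a = "Re (ip H x x)" and ?b = "Re (ip H x y)" and ?c = "Re (ip H y y)"
  have c: "?c > 0" using False y ip_pos by simp
  let ?t = "of_real (?b / ?c) :: complex"
  have tK: "?t \<in> K" by (rule real_in_scalars)
  have ty: "?t \<odot>\<^bsub>H\<^esub> y \<in> carrier H" using tK y smult_closed[of ?t y] by simp
  have "0 \<le> Re (ip H (x \<ominus>\<^bsub>H\<^esub> ?t \<odot>\<^bsub>H\<^esub> y) (x \<ominus>\<^bsub>H\<^esub> ?t \<odot>\<^bsub>H\<^esub> y))"
    using x ty by (intro ip_nonneg) simp
  also have "\<dots> = ?a - 2 * (?b / ?c) * ?b + (?b / ?c)\<^sup>2 * ?c"
    using x y ty tK ip_commute[of x y]
    by (simp add: ip_diff_left ip_diff_right ip_smult_left ip_smult_right power2_eq_square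
        algebra_simps del: of_real_divide)
  also have "\<dots> = ?a - ?b\<^sup>2 / ?c" using c by (simp add: field_simps power2_eq_square)
  finally have "?b\<^sup>2 \<le> ?a * ?c" using c by (simp add: field_simps)
  then have "\<bar>?b\<bar> \<le> sqrt (?a * ?c)" by (metis real_sqrt_abs real_sqrt_le_mono)
  then show ?thesis by (simp add: hnorm_def real_sqrt_mult)
qed

lemma hnorm_triangle:
  assumes x: "x \<in> carrier H" and y: "y \<in> carrier H"
  shows "hnorm H (x \<oplus>\<^bsub>H\<^esub> y) \<le> hnorm H x + hnorm H y"
proof (rule power2_le_imp_le)
  have "(hnorm H (x \<oplus>\<^bsub>H\<^esub> y))\<^sup>2 = Re (ip H x x) + 2 * Re (ip H x y) + Re (ip H y y)"
    using x y ip_commute[of x y] by (simp add: hnorm_sq ip_add_left ip_add_right)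
  also have "\<dots> \<le> (hnorm H x + hnorm H y)\<^sup>2"
    using Re_ip_le[OF x y] x y by (simp add: power2_sum hnorm_sq)
  finally show "(hnorm H (x \<oplus>\<^bsub>H\<^esub> y))\<^sup>2 \<le> (hnorm H x + hnorm H y)\<^sup>2" .
qed (use x y hnorm_nonneg in auto)

lemma hnorm_minus: "x \<in> carrier H \<Longrightarrow> hnorm H (\<ominus>\<^bsub>H\<^esub> x) = hnorm H x"
  using ip_commute[of "\<ominus>\<^bsub>H\<^esub> x" x] by (simp add: hnorm_def ip_minus_left)

lemma minus_swap: "\<lbrakk>x \<in> carrier H; y \<in> carrier H\<rbrakk> \<Longrightarrow> \<ominus>\<^bsub>H\<^esub> (x \<ominus>\<^bsub>H\<^esub> y) = y \<ominus>\<^bsub>H\<^esub> x"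
  by (simp add: a_minus_def M.minus_add M.a_comm)

lemma diff_diff:
  assumes "x \<in> carrier H" "y \<in> carrier H" "z \<in> carrier H"
  shows "(x \<ominus>\<^bsub>H\<^esub> y) \<oplus>\<^bsub>H\<^esub> (y \<ominus>\<^bsub>H\<^esub> z) = x \<ominus>\<^bsub>H\<^esub> z"
  using assms by (simp add: a_minus_def M.a_assoc M.r_neg1)

lemma diff_eq_zero: "\<lbrakk>x \<in> carrier H; y \<in> carrier H\<rbrakk> \<Longrightarrow> x \<ominus>\<^bsub>H\<^esub> y = \<zero>\<^bsub>H\<^esub> \<longleftrightarrow> x = y"
  by (metis M.a_inv_closed M.minus_equality M.minus_minus M.r_neg a_minus_def)

lemma metric: "Metric_space (carrier H) (hdist H)"
proof
  fix x y z
  show "0 \<le> hdist H x y" by (simp add: hdist_def hnorm_nonneg)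
  show "hdist H x y = hdist H y x"
    using minus_swap[of x y] hnorm_minus[of "x \<ominus>\<^bsub>H\<^esub> y"] by (auto simp: hdist_def)
  assume x: "x \<in> carrier H" and y: "y \<in> carrier H"
  then show "hdist H x y = 0 \<longleftrightarrow> x = y" by (simp add: hdist_def hnorm_eq_0 diff_eq_zero)
  assume z: "z \<in> carrier H"
  show "hdist H x z \<le> hdist H x y + hdist H y z"
    using hnorm_triangle[of "x \<ominus>\<^bsub>H\<^esub> y" "y \<ominus>\<^bsub>H\<^esub> z"] diff_diff[OF x y z] x y z
    by (simp add: hdist_def)
qed

sublocale Metric: Metric_space "carrier H" "hdist H"
  by (rule metric)

lemma htop_eq: "htop H = Metric.mtopology" by (simp add: htop_def)

end

lemma openin_cocycle_topology:
  "openin (cocycle_topology G T H \<pi>) U \<longleftrightarrow> U \<subseteq> cocycles G T H \<pi> \<and>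
     (\<forall>b\<in>U. \<exists>Q \<epsilon>. compactin T Q \<and> \<epsilon> > 0 \<and> cocycle_nbhd G T H \<pi> b Q \<epsilon> \<subseteq> U)"
proof -
  have "istopology (\<lambda>U. U \<subseteq> cocycles G T H \<pi> \<and>
     (\<forall>b\<in>U. \<exists>Q \<epsilon>. compactin T Q \<and> \<epsilon> > 0 \<and> cocycle_nbhd G T H \<pi> b Q \<epsilon> \<subseteq> U))" (is "istopology ?P")
    unfolding istopology_def
  proof (intro conjI allI impI)
    fix U V assume U: "?P U" and V: "?P V"
    show "U \<inter> V \<subseteq> cocycles G T H \<pi>" using U by auto
    show "\<forall>b\<in>U \<inter> V. \<exists>Q \<epsilon>. compactin T Q \<and> \<epsilon> > 0 \<and> cocycle_nbhd G T H \<pi> b Q \<epsilon> \<subseteq> U \<inter> V"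
    proof
      fix b assume b: "b \<in> U \<inter> V"
      obtain P \<delta> where P: "compactin T P" "\<delta> > 0" "cocycle_nbhd G T H \<pi> b P \<delta> \<subseteq> U"
        using U b by blast
      obtain Q \<epsilon> where Q: "compactin T Q" "\<epsilon> > 0" "cocycle_nbhd G T H \<pi> b Q \<epsilon> \<subseteq> V"
        using V b by blast
      have "cocycle_nbhd G T H \<pi> b (P \<union> Q) (min \<delta> \<epsilon>) \<subseteq> U \<inter> V"
        using P(3) Q(3) unfolding cocycle_nbhd_def by auto
      then show "\<exists>Q \<epsilon>. compactin T Q \<and> \<epsilon> > 0 \<and> cocycle_nbhd G T H \<pi> b Q \<epsilon> \<subseteq> U \<inter> V"
        using P Q by (meson compactin_Un min_less_iff_conj)
    qed
  next
    fix \<K> assume K: "\<forall>U\<in>\<K>. ?P U"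
    show "\<Union>\<K> \<subseteq> cocycles G T H \<pi>" using K by blast
    show "\<forall>b\<in>\<Union>\<K>. \<exists>Q \<epsilon>. compactin T Q \<and> \<epsilon> > 0 \<and> cocycle_nbhd G T H \<pi> b Q \<epsilon> \<subseteq> \<Union>\<K>"
      using K by (meson UnionE Union_upper subset_trans)
  qed
  then show ?thesis unfolding cocycle_topology_def by simp
qed

context inner_product_space
begin

lemma hdist_add:
  assumes "x \<in> carrier H" "y \<in> carrier H" "x' \<in> carrier H" "y' \<in> carrier H"
  shows "hdist H (x \<oplus>\<^bsub>H\<^esub> y) (x' \<oplus>\<^bsub>H\<^esub> y') \<le> hdist H x x' + hdist H y y'"
proof -
  have "(x \<oplus>\<^bsub>H\<^esub> y) \<ominus>\<^bsub>H\<^esub> (x' \<oplus>\<^bsub>H\<^esub> y') = (x \<ominus>\<^bsub>H\<^esub> x') \<oplus>\<^bsub>H\<^esub> (y \<ominus>\<^bsub>H\<^esub> y')"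
    using assms by (simp add: a_minus_def M.minus_add M.a_ac)
  then show ?thesis
    using assms hnorm_triangle[of "x \<ominus>\<^bsub>H\<^esub> x'" "y \<ominus>\<^bsub>H\<^esub> y'"] by (simp add: hdist_def)
qed

lemma hdist_minus:
  assumes "x \<in> carrier H" "y \<in> carrier H"
  shows "hdist H (\<ominus>\<^bsub>H\<^esub> x) (\<ominus>\<^bsub>H\<^esub> y) = hdist H x y"
proof -
  have "(\<ominus>\<^bsub>H\<^esub> x) \<ominus>\<^bsub>H\<^esub> (\<ominus>\<^bsub>H\<^esub> y) = \<ominus>\<^bsub>H\<^esub> (x \<ominus>\<^bsub>H\<^esub> y)"
    using assms by (simp add: a_minus_def M.minus_add)
  then show ?thesis
    using assms hnorm_minus[of "x \<ominus>\<^bsub>H\<^esub> y"] by (simp add: hdist_def)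
qed

lemma continuous_map_htop:
  "continuous_map Y (htop H) f \<longleftrightarrow> (\<forall>x\<in>topspace Y. f x \<in> carrier H) \<and>
     (\<forall>x\<in>topspace Y. \<forall>\<epsilon>>0. \<exists>U. openin Y U \<and> x \<in> U \<and> (\<forall>y\<in>U. hdist H (f x) (f y) < \<epsilon>))"
  (is "?L = (?A \<and> ?B)")
proof
  assume L: ?L
  have "f ` topspace Y \<subseteq> carrier H"
    using continuous_map_image_subset_topspace[OF L] by (simp add: htop_eq)
  then have A: ?A by blast
  have B: ?B
  proof (intro ballI allI impI)
    fix x and \<epsilon> :: real assume "x \<in> topspace Y" "\<epsilon> > 0"
    then obtain U where "openin Y U" "x \<in> U" "\<forall>y\<in>U. f y \<in> Metric.mball (f x) \<epsilon>"
      using L unfolding htop_eq Metric.continuous_map_to_metric by meson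
    then show "\<exists>U. openin Y U \<and> x \<in> U \<and> (\<forall>y\<in>U. hdist H (f x) (f y) < \<epsilon>)"
      by (intro exI[of _ U]) simp
  qed
  show "?A \<and> ?B" using A B by (rule conjI)
next
  assume AB: "?A \<and> ?B"
  show ?L unfolding htop_eq Metric.continuous_map_to_metric
  proof (intro ballI allI impI)
    fix x and \<epsilon> :: real assume x: "x \<in> topspace Y" and "\<epsilon> > 0"
    then obtain U where U: "openin Y U" "x \<in> U" "\<forall>y\<in>U. hdist H (f x) (f y) < \<epsilon>"
      using AB by meson
    then have "\<forall>y\<in>U. f y \<in> Metric.mball (f x) \<epsilon>"
      using x AB openin_subset[OF U(1)] by auto
    then show "\<exists>U. openin Y U \<and> x \<in> U \<and> (\<forall>y\<in>U. f y \<in> Metric.mball (f x) \<epsilon>)"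
      using U by blast
  qed
qed

lemma continuous_map_htop_closed:
  "continuous_map Y (htop H) f \<Longrightarrow> x \<in> topspace Y \<Longrightarrow> f x \<in> carrier H"
  by (simp add: continuous_map_htop)

lemma continuous_map_htop_add:
  assumes f: "continuous_map Y (htop H) f" and g: "continuous_map Y (htop H) g"
  shows "continuous_map Y (htop H) (\<lambda>x. f x \<oplus>\<^bsub>H\<^esub> g x)"
  unfolding continuous_map_htop
proof (intro conjI ballI allI impI)
  have cf: "\<And>x. x \<in> topspace Y \<Longrightarrow> f x \<in> carrier H" and cg: "\<And>x. x \<in> topspace Y \<Longrightarrow> g x \<in> carrier H"
    by (rule continuous_map_htop_closed[OF f], assumption, rule continuous_map_htop_closed[OF g], assumption)
  then show "\<And>x. x \<in> topspace Y \<Longrightarrow> f x \<oplus>\<^bsub>H\<^esub> g x \<in> carrier H" by simp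
  fix x and \<epsilon> :: real assume x: "x \<in> topspace Y" and e: "\<epsilon> > 0"
  obtain U where U: "openin Y U" "x \<in> U" "\<forall>y\<in>U. hdist H (f x) (f y) < \<epsilon>/2"
    using f x e unfolding continuous_map_htop by (meson half_gt_zero)
  obtain V where V: "openin Y V" "x \<in> V" "\<forall>y\<in>V. hdist H (g x) (g y) < \<epsilon>/2"
    using g x e unfolding continuous_map_htop by (meson half_gt_zero)
  have "hdist H (f x \<oplus>\<^bsub>H\<^esub> g x) (f y \<oplus>\<^bsub>H\<^esub> g y) < \<epsilon>" if y: "y \<in> U \<inter> V" for y
  proof -
    have "y \<in> topspace Y" using y U(1) openin_subset by fastforce
    then have "hdist H (f x \<oplus>\<^bsub>H\<^esub> g x) (f y \<oplus>\<^bsub>H\<^esub> g y) \<le> hdist H (f x) (f y) + hdist H (g x) (g y)"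
      using hdist_add cf cg x by simp
    then show ?thesis using U(3) V(3) y by fastforce
  qed
  then show "\<exists>U. openin Y U \<and> x \<in> U \<and> (\<forall>y\<in>U. hdist H (f x \<oplus>\<^bsub>H\<^esub> g x) (f y \<oplus>\<^bsub>H\<^esub> g y) < \<epsilon>)"
    using U V by (meson openin_Int IntI)
qed

lemma continuous_map_htop_minus:
  assumes f: "continuous_map Y (htop H) f"
  shows "continuous_map Y (htop H) (\<lambda>x. \<ominus>\<^bsub>H\<^esub> f x)"
proof -
  have cf: "\<And>x. x \<in> topspace Y \<Longrightarrow> f x \<in> carrier H"
    by (rule continuous_map_htop_closed[OF f])
  have d: "hdist H (\<ominus>\<^bsub>H\<^esub> f x) (\<ominus>\<^bsub>H\<^esub> f y) = hdist H (f x) (f y)" if "openin Y U" "x \<in> U" "y \<in> U" for U x y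
    using that openin_subset[of Y U] cf by (intro hdist_minus) auto
  show ?thesis unfolding continuous_map_htop
  proof (intro conjI ballI allI impI)
    fix x and \<epsilon> :: real assume x: "x \<in> topspace Y" and "\<epsilon> > 0"
    then obtain U where U: "openin Y U" "x \<in> U" "\<forall>y\<in>U. hdist H (f x) (f y) < \<epsilon>"
      using f unfolding continuous_map_htop by meson
    then show "\<exists>U. openin Y U \<and> x \<in> U \<and> (\<forall>y\<in>U. hdist H (\<ominus>\<^bsub>H\<^esub> f x) (\<ominus>\<^bsub>H\<^esub> f y) < \<epsilon>)"
      using d by (intro exI[of _ U]) simp
  qed (use cf in simp)
qed

end

lemma topspace_cocycle_topology: "topspace (cocycle_topology G T H \<pi>) = cocycles G T H \<pi>"
proof
  show "topspace (cocycle_topology G T H \<pi>) \<subseteq> cocycles G T H \<pi>"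
    by (metis openin_topspace openin_cocycle_topology)
  have "openin (cocycle_topology G T H \<pi>) (cocycles G T H \<pi>)" unfolding openin_cocycle_topology
    by (force simp: cocycle_nbhd_def intro: exI[of _ "{}"] exI[of _ "1::real"])
  then show "cocycles G T H \<pi> \<subseteq> topspace (cocycle_topology G T H \<pi>)" by (rule openin_subset)
qed

context hilbert_rep
begin

lemma rep_closed: "\<lbrakk>g \<in> carrier G; x \<in> carrier H\<rbrakk> \<Longrightarrow> \<pi> g x \<in> carrier H"
  using element_image by blast

lemma rep_zero: "g \<in> carrier G \<Longrightarrow> \<pi> g \<zero>\<^bsub>H\<^esub> = \<zero>\<^bsub>H\<^esub>"
proof -
  assume g: "g \<in> carrier G"
  have "\<pi> g \<zero>\<^bsub>H\<^esub> \<oplus>\<^bsub>H\<^esub> \<pi> g \<zero>\<^bsub>H\<^esub> = \<pi> g \<zero>\<^bsub>H\<^esub>" using rep_add[OF g, of "\<zero>\<^bsub>H\<^esub>" "\<zero>\<^bsub>H\<^esub>"] by simp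
  then show ?thesis using rep_closed[OF g M.zero_closed] M.add.r_cancel_one by simp
qed

lemma rep_minus:
  assumes g: "g \<in> carrier G" and x: "x \<in> carrier H"
  shows "\<pi> g (\<ominus>\<^bsub>H\<^esub> x) = \<ominus>\<^bsub>H\<^esub> \<pi> g x"
proof -
  have "\<pi> g (\<ominus>\<^bsub>H\<^esub> x) \<oplus>\<^bsub>H\<^esub> \<pi> g x = \<zero>\<^bsub>H\<^esub>"
    using rep_add[OF g, of "\<ominus>\<^bsub>H\<^esub> x" x] x rep_zero[OF g] by (simp add: M.l_neg)
  then show ?thesis using M.minus_equality rep_closed[OF g] x by (metis M.a_inv_closed)
qed

lemma rep_diff:
  "\<lbrakk>g \<in> carrier G; x \<in> carrier H; y \<in> carrier H\<rbrakk> \<Longrightarrow> \<pi> g (x \<ominus>\<^bsub>H\<^esub> y) = \<pi> g x \<ominus>\<^bsub>H\<^esub> \<pi> g y"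
  by (simp add: a_minus_def rep_add rep_minus)

lemma groupG: "group G" using group_hom group_hom.axioms(1) by blast

lemma cocycle_closed: "\<lbrakk>b \<in> cocycles G T H \<pi>; g \<in> carrier G\<rbrakk> \<Longrightarrow> b g \<in> carrier H"
  by (auto simp: cocycles_def PiE_def Pi_def)

lemma cocycle_mult:
  "\<lbrakk>b \<in> cocycles G T H \<pi>; g \<in> carrier G; h \<in> carrier G\<rbrakk> \<Longrightarrow> b (g \<otimes> h) = \<pi> g (b h) \<oplus>\<^bsub>H\<^esub> b g"
  by (simp add: cocycles_def)

lemma cocyclesI:
  assumes "topspace T = carrier G" and "continuous_map T (htop H) f"
    and "\<And>g h. \<lbrakk>g \<in> carrier G; h \<in> carrier G\<rbrakk> \<Longrightarrow> f (g \<otimes> h) = \<pi> g (f h) \<oplus>\<^bsub>H\<^esub> f g"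
  shows "(\<lambda>g\<in>carrier G. f g) \<in> cocycles G T H \<pi>"
proof -
  interpret G: group G by (rule groupG)
  have "\<And>x. x \<in> carrier G \<Longrightarrow> f x \<in> carrier H"
    using assms(1) continuous_map_htop_closed[OF assms(2)] by simp
  then show ?thesis
    using assms continuous_map_eq[OF assms(2), of "\<lambda>g\<in>carrier G. f g"] by (auto simp: cocycles_def)
qed

lemma cocycle_continuous: "b \<in> cocycles G T H \<pi> \<Longrightarrow> continuous_map T (htop H) b"
  by (simp add: cocycles_def)

lemma cocycle_extensional: "b \<in> cocycles G T H \<pi> \<Longrightarrow> b \<in> extensional (carrier G)"
  by (simp add: cocycles_def PiE_def)

lemma cocycles_add:
  assumes T: "topspace T = carrier G" and b: "b \<in> cocycles G T H \<pi>" and c: "c \<in> cocycles G T H \<pi>"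
  shows "(\<lambda>g\<in>carrier G. b g \<oplus>\<^bsub>H\<^esub> c g) \<in> cocycles G T H \<pi>"
proof (rule cocyclesI[OF T])
  show "continuous_map T (htop H) (\<lambda>g. b g \<oplus>\<^bsub>H\<^esub> c g)"
    using b c cocycle_continuous continuous_map_htop_add by blast
  fix g h assume g: "g \<in> carrier G" and h: "h \<in> carrier G"
  then show "b (g \<otimes> h) \<oplus>\<^bsub>H\<^esub> c (g \<otimes> h) = \<pi> g (b h \<oplus>\<^bsub>H\<^esub> c h) \<oplus>\<^bsub>H\<^esub> (b g \<oplus>\<^bsub>H\<^esub> c g)"
    using b c by (simp add: cocycle_mult rep_add cocycle_closed rep_closed M.a_ac)
qed

lemma cocycles_minus:
  assumes T: "topspace T = carrier G" and b: "b \<in> cocycles G T H \<pi>"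
  shows "(\<lambda>g\<in>carrier G. \<ominus>\<^bsub>H\<^esub> b g) \<in> cocycles G T H \<pi>"
proof (rule cocyclesI[OF T])
  show "continuous_map T (htop H) (\<lambda>g. \<ominus>\<^bsub>H\<^esub> b g)"
    using b cocycle_continuous continuous_map_htop_minus by blast
  fix g h assume g: "g \<in> carrier G" and h: "h \<in> carrier G"
  then show "\<ominus>\<^bsub>H\<^esub> b (g \<otimes> h) = \<pi> g (\<ominus>\<^bsub>H\<^esub> b h) \<oplus>\<^bsub>H\<^esub> (\<ominus>\<^bsub>H\<^esub> b g)"
    using b by (simp add: cocycle_mult rep_minus cocycle_closed rep_closed M.minus_add)
qed

lemma coboundaries_subset:
  assumes T: "topspace T = carrier G"
  shows "coboundaries G H \<pi> \<subseteq> cocycles G T H \<pi>"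
proof -
  have "(\<lambda>g\<in>carrier G. v \<ominus>\<^bsub>H\<^esub> \<pi> g v) \<in> cocycles G T H \<pi>" if v: "v \<in> carrier H" for v
  proof (rule cocyclesI[OF T])
    have "continuous_map T (htop H) (\<lambda>g. v)" using v by (simp add: htop_eq)
    then show "continuous_map T (htop H) (\<lambda>g. v \<ominus>\<^bsub>H\<^esub> \<pi> g v)"
      using continuous_map_htop_add[OF _ continuous_map_htop_minus[OF rep_continuous[OF v]]]
      by (simp add: a_minus_def)
    fix g h assume g: "g \<in> carrier G" and h: "h \<in> carrier G"
    have "\<pi> g (v \<ominus>\<^bsub>H\<^esub> \<pi> h v) \<oplus>\<^bsub>H\<^esub> (v \<ominus>\<^bsub>H\<^esub> \<pi> g v) = (v \<ominus>\<^bsub>H\<^esub> \<pi> g v) \<oplus>\<^bsub>H\<^esub> (\<pi> g v \<ominus>\<^bsub>H\<^esub> \<pi> g (\<pi> h v))"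
      using g h v by (simp add: rep_diff rep_closed M.a_comm)
    then show "v \<ominus>\<^bsub>H\<^esub> \<pi> (g \<otimes> h) v = \<pi> g (v \<ominus>\<^bsub>H\<^esub> \<pi> h v) \<oplus>\<^bsub>H\<^esub> (v \<ominus>\<^bsub>H\<^esub> \<pi> g v)"
      using g h v by (simp add: diff_diff rep_closed composition_rule)
  qed
  then show ?thesis by (auto simp: coboundaries_def)
qed

lemma cocycle_closure_iff:
  assumes T: "topspace T = carrier G"
  shows "b \<in> cocycle_topology G T H \<pi> closure_of coboundaries G H \<pi> \<longleftrightarrow> b \<in> cocycles G T H \<pi> \<and>
    (\<forall>Q \<epsilon>. compactin T Q \<and> \<epsilon> > 0 \<longrightarrow>
       (\<exists>v\<in>carrier H. \<forall>g\<in>Q. hdist H (b g) (v \<ominus>\<^bsub>H\<^esub> \<pi> g v) < \<epsilon>))"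
proof -
  let ?Y = "cocycle_topology G T H \<pi>"
  note top = topspace_cocycle_topology
  have cob: "(\<exists>c\<in>coboundaries G H \<pi>. c \<in> cocycle_nbhd G T H \<pi> b Q \<epsilon>) \<longleftrightarrow>
     (\<exists>v\<in>carrier H. \<forall>g\<in>Q. hdist H (b g) (v \<ominus>\<^bsub>H\<^esub> \<pi> g v) < \<epsilon>)" if Q: "compactin T Q" for Q \<epsilon>
  proof -
    have "Q \<subseteq> carrier G" using Q T compactin_subset_topspace by blast
    then show ?thesis using coboundaries_subset[OF T]
      unfolding coboundaries_def cocycle_nbhd_def by (fastforce simp: subset_iff)
  qed
  show ?thesis
  proof
    assume b: "b \<in> ?Y closure_of coboundaries G H \<pi>"
    then have bZ: "b \<in> cocycles G T H \<pi>" by (simp add: in_closure_of top)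
    have "\<exists>c\<in>coboundaries G H \<pi>. c \<in> cocycle_nbhd G T H \<pi> b Q \<epsilon>" if Q: "compactin T Q" "\<epsilon> > 0" for Q \<epsilon>
    proof -
      have QG: "Q \<subseteq> carrier G" using Q T compactin_subset_topspace by blast
      let ?U = "{c \<in> cocycles G T H \<pi>. \<exists>\<delta>>0. cocycle_nbhd G T H \<pi> c Q \<delta> \<subseteq> cocycle_nbhd G T H \<pi> b Q \<epsilon>}"
      have "openin ?Y ?U" unfolding openin_cocycle_topology
      proof (intro conjI ballI)
        fix c assume "c \<in> ?U"
        then obtain \<delta> where c: "c \<in> cocycles G T H \<pi>" and d: "\<delta> > 0"
          and sub: "cocycle_nbhd G T H \<pi> c Q \<delta> \<subseteq> cocycle_nbhd G T H \<pi> b Q \<epsilon>" by auto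
        have "cocycle_nbhd G T H \<pi> c' Q (\<delta>/2) \<subseteq> cocycle_nbhd G T H \<pi> c Q \<delta>"
          if c': "c' \<in> cocycle_nbhd G T H \<pi> c Q (\<delta>/2)" for c'
        proof
          fix a assume a: "a \<in> cocycle_nbhd G T H \<pi> c' Q (\<delta>/2)"
          have "hdist H (c g) (a g) < \<delta>" if g: "g \<in> Q" for g
          proof -
            have "hdist H (c g) (a g) \<le> hdist H (c g) (c' g) + hdist H (c' g) (a g)"
              using a c c' g QG by (intro Metric.triangle) (auto simp: cocycle_nbhd_def intro: cocycle_closed)
            then show ?thesis using a c' g by (fastforce simp: cocycle_nbhd_def)
          qed
          then show "a \<in> cocycle_nbhd G T H \<pi> c Q \<delta>" using a by (auto simp: cocycle_nbhd_def)
        qed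
        then have "cocycle_nbhd G T H \<pi> c Q (\<delta>/2) \<subseteq> ?U"
          using sub d by (smt (verit, best) cocycle_nbhd_def half_gt_zero mem_Collect_eq subsetI subset_trans)
        then show "\<exists>Q \<epsilon>. compactin T Q \<and> \<epsilon> > 0 \<and> cocycle_nbhd G T H \<pi> c Q \<epsilon> \<subseteq> ?U"
          using Q d half_gt_zero by blast
      qed auto
      moreover have "b \<in> ?U" using bZ Q by auto
      moreover have "\<forall>U. b \<in> U \<and> openin ?Y U \<longrightarrow> (\<exists>y. y \<in> coboundaries G H \<pi> \<and> y \<in> U)"
        using b unfolding in_closure_of by (rule conjunct2)
      ultimately have "\<exists>y. y \<in> coboundaries G H \<pi> \<and> y \<in> ?U" by (elim allE[of _ ?U]) (rule mp, assumption, rule conjI)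
      then obtain c where c: "c \<in> coboundaries G H \<pi>" "c \<in> ?U" by (elim exE conjE)
      then obtain \<delta> where "\<delta> > 0" and sub: "cocycle_nbhd G T H \<pi> c Q \<delta> \<subseteq> cocycle_nbhd G T H \<pi> b Q \<epsilon>"
        by auto
      moreover have "c \<in> cocycle_nbhd G T H \<pi> c Q \<delta>"
        using c(2) \<open>\<delta> > 0\<close> QG by (auto simp: cocycle_nbhd_def cocycle_closed subset_iff)
      ultimately show ?thesis using c(1) by blast
    qed
    then show "b \<in> cocycles G T H \<pi> \<and> (\<forall>Q \<epsilon>. compactin T Q \<and> \<epsilon> > 0 \<longrightarrow>
       (\<exists>v\<in>carrier H. \<forall>g\<in>Q. hdist H (b g) (v \<ominus>\<^bsub>H\<^esub> \<pi> g v) < \<epsilon>))"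
      using bZ cob by auto
  next
    assume b: "b \<in> cocycles G T H \<pi> \<and> (\<forall>Q \<epsilon>. compactin T Q \<and> \<epsilon> > 0 \<longrightarrow>
       (\<exists>v\<in>carrier H. \<forall>g\<in>Q. hdist H (b g) (v \<ominus>\<^bsub>H\<^esub> \<pi> g v) < \<epsilon>))"
    show "b \<in> ?Y closure_of coboundaries G H \<pi>"
      unfolding in_closure_of top
    proof (intro conjI allI impI)
      show "b \<in> cocycles G T H \<pi>" using b by simp
      fix U assume "b \<in> U \<and> openin ?Y U"
      then obtain Q \<epsilon> where "compactin T Q" "\<epsilon> > 0" "cocycle_nbhd G T H \<pi> b Q \<epsilon> \<subseteq> U"
        unfolding openin_cocycle_topology by blast
      then show "\<exists>y. y \<in> coboundaries G H \<pi> \<and> y \<in> U" using b cob by blast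
    qed
  qed
qed

lemma comm_group_cocycle_group:
  assumes T: "topspace T = carrier G"
  shows "comm_group (cocycle_group G T H \<pi>)"
proof (rule comm_groupI)
  have z: "(\<lambda>g\<in>carrier G. \<zero>\<^bsub>H\<^esub>) \<in> cocycles G T H \<pi>"
    by (rule cocyclesI[OF T]) (auto simp: htop_eq rep_zero)
  show "\<one>\<^bsub>cocycle_group G T H \<pi>\<^esub> \<in> carrier (cocycle_group G T H \<pi>)"
    using z by (simp add: cocycle_group_def)
  fix a b assume "a \<in> carrier (cocycle_group G T H \<pi>)" and "b \<in> carrier (cocycle_group G T H \<pi>)"
  then have a: "a \<in> cocycles G T H \<pi>" and b: "b \<in> cocycles G T H \<pi>" by (simp_all add: cocycle_group_def)
  show "a \<otimes>\<^bsub>cocycle_group G T H \<pi>\<^esub> b \<in> carrier (cocycle_group G T H \<pi>)"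
    using cocycles_add[OF T a b] by (simp add: cocycle_group_def)
  show "a \<otimes>\<^bsub>cocycle_group G T H \<pi>\<^esub> b = b \<otimes>\<^bsub>cocycle_group G T H \<pi>\<^esub> a"
    using a b by (auto simp: cocycle_group_def cocycle_closed M.a_comm intro!: restrict_ext)
  show "\<one>\<^bsub>cocycle_group G T H \<pi>\<^esub> \<otimes>\<^bsub>cocycle_group G T H \<pi>\<^esub> a = a"
    using cocycle_extensional[OF a] cocycle_closed[OF a]
    by (auto simp: cocycle_group_def extensional_def fun_eq_iff)
  show "\<exists>y\<in>carrier (cocycle_group G T H \<pi>). y \<otimes>\<^bsub>cocycle_group G T H \<pi>\<^esub> a = \<one>\<^bsub>cocycle_group G T H \<pi>\<^esub>"
    using cocycles_minus[OF T a] cocycle_closed[OF a]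
    by (auto simp: cocycle_group_def M.l_neg intro!: bexI[of _ "\<lambda>g\<in>carrier G. \<ominus>\<^bsub>H\<^esub> a g"] restrict_ext)
  fix c assume "c \<in> carrier (cocycle_group G T H \<pi>)"
  then have c: "c \<in> cocycles G T H \<pi>" by (simp add: cocycle_group_def)
  show "a \<otimes>\<^bsub>cocycle_group G T H \<pi>\<^esub> b \<otimes>\<^bsub>cocycle_group G T H \<pi>\<^esub> c =
        a \<otimes>\<^bsub>cocycle_group G T H \<pi>\<^esub> (b \<otimes>\<^bsub>cocycle_group G T H \<pi>\<^esub> c)"
    using a b c by (auto simp: cocycle_group_def cocycle_closed M.a_assoc intro!: restrict_ext)
qed

lemma normal_closure_coboundaries:
  assumes T: "topspace T = carrier G"
  shows "(cocycle_topology G T H \<pi> closure_of coboundaries G H \<pi>) \<lhd> cocycle_group G T H \<pi>"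
proof -
  let ?Z = "cocycle_group G T H \<pi>" and ?N = "cocycle_topology G T H \<pi> closure_of coboundaries G H \<pi>"
  interpret Z: comm_group ?Z by (rule comm_group_cocycle_group[OF T])
  have inv: "inv\<^bsub>?Z\<^esub> b = (\<lambda>g\<in>carrier G. \<ominus>\<^bsub>H\<^esub> b g)" if b: "b \<in> cocycles G T H \<pi>" for b
    using cocycles_minus[OF T b] cocycle_closed[OF b] b
    by (intro Z.inv_equality) (auto simp: cocycle_group_def M.l_neg intro!: restrict_ext)
  have QG: "Q \<subseteq> carrier G" if "compactin T Q" for Q using that T compactin_subset_topspace by blast
  have "subgroup ?N ?Z"
  proof (rule Z.subgroupI)
    show "?N \<subseteq> carrier ?Z" by (auto simp: cocycle_closure_iff[OF T] cocycle_group_def)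
    have "(\<lambda>g\<in>carrier G. \<zero>\<^bsub>H\<^esub> \<ominus>\<^bsub>H\<^esub> \<pi> g \<zero>\<^bsub>H\<^esub>) \<in> coboundaries G H \<pi>" by (simp add: coboundaries_def)
    moreover have "coboundaries G H \<pi> \<subseteq> ?N"
    proof (rule closure_of_subset)
      show "coboundaries G H \<pi> \<subseteq> topspace (cocycle_topology G T H \<pi>)"
        using coboundaries_subset[OF T] by (simp add: topspace_cocycle_topology)
    qed
    ultimately show "?N \<noteq> {}" by blast
  next
    fix b assume bN: "b \<in> ?N"
    then have b: "b \<in> cocycles G T H \<pi>" by (simp add: cocycle_closure_iff[OF T])
    have "\<exists>v\<in>carrier H. \<forall>g\<in>Q. hdist H ((\<lambda>g\<in>carrier G. \<ominus>\<^bsub>H\<^esub> b g) g) (v \<ominus>\<^bsub>H\<^esub> \<pi> g v) < \<epsilon>"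
      if Q: "compactin T Q" "\<epsilon> > 0" for Q \<epsilon>
    proof -
      obtain v where v: "v \<in> carrier H" and d: "\<forall>g\<in>Q. hdist H (b g) (v \<ominus>\<^bsub>H\<^esub> \<pi> g v) < \<epsilon>"
        using bN Q unfolding cocycle_closure_iff[OF T] by blast
      have "hdist H ((\<lambda>g\<in>carrier G. \<ominus>\<^bsub>H\<^esub> b g) g) (\<ominus>\<^bsub>H\<^esub> v \<ominus>\<^bsub>H\<^esub> \<pi> g (\<ominus>\<^bsub>H\<^esub> v)) < \<epsilon>" if g: "g \<in> Q" for g
      proof -
        have gG: "g \<in> carrier G" using g QG Q by blast
        have "\<ominus>\<^bsub>H\<^esub> v \<ominus>\<^bsub>H\<^esub> \<pi> g (\<ominus>\<^bsub>H\<^esub> v) = \<ominus>\<^bsub>H\<^esub> (v \<ominus>\<^bsub>H\<^esub> \<pi> g v)"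
          using v gG by (simp add: a_minus_def rep_minus M.minus_add rep_closed)
        then show ?thesis
          using d g gG v b by (simp add: hdist_minus cocycle_closed rep_closed)
      qed
      then show ?thesis using v by (intro bexI[of _ "\<ominus>\<^bsub>H\<^esub> v"]) auto
    qed
    then show "inv\<^bsub>?Z\<^esub> b \<in> ?N"
      unfolding inv[OF b] cocycle_closure_iff[OF T] using cocycles_minus[OF T b] by blast
  next
    fix b c assume bN: "b \<in> ?N" and cN: "c \<in> ?N"
    then have b: "b \<in> cocycles G T H \<pi>" and c: "c \<in> cocycles G T H \<pi>"
      by (simp_all add: cocycle_closure_iff[OF T])
    have "\<exists>v\<in>carrier H. \<forall>g\<in>Q. hdist H ((\<lambda>g\<in>carrier G. b g \<oplus>\<^bsub>H\<^esub> c g) g) (v \<ominus>\<^bsub>H\<^esub> \<pi> g v) < \<epsilon>"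
      if Q: "compactin T Q" "\<epsilon> > 0" for Q \<epsilon>
    proof -
      obtain v where v: "v \<in> carrier H" and d: "\<forall>g\<in>Q. hdist H (b g) (v \<ominus>\<^bsub>H\<^esub> \<pi> g v) < \<epsilon>/2"
        using bN Q half_gt_zero unfolding cocycle_closure_iff[OF T] by blast
      obtain w where w: "w \<in> carrier H" and e: "\<forall>g\<in>Q. hdist H (c g) (w \<ominus>\<^bsub>H\<^esub> \<pi> g w) < \<epsilon>/2"
        using cN Q half_gt_zero unfolding cocycle_closure_iff[OF T] by blast
      have "hdist H ((\<lambda>g\<in>carrier G. b g \<oplus>\<^bsub>H\<^esub> c g) g) ((v \<oplus>\<^bsub>H\<^esub> w) \<ominus>\<^bsub>H\<^esub> \<pi> g (v \<oplus>\<^bsub>H\<^esub> w)) < \<epsilon>" if g: "g \<in> Q" for g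
      proof -
        have gG: "g \<in> carrier G" using g QG Q by blast
        have "(v \<oplus>\<^bsub>H\<^esub> w) \<ominus>\<^bsub>H\<^esub> \<pi> g (v \<oplus>\<^bsub>H\<^esub> w) = (v \<ominus>\<^bsub>H\<^esub> \<pi> g v) \<oplus>\<^bsub>H\<^esub> (w \<ominus>\<^bsub>H\<^esub> \<pi> g w)"
          using v w gG by (simp add: a_minus_def rep_add M.minus_add rep_closed M.a_ac)
        then have "hdist H ((\<lambda>g\<in>carrier G. b g \<oplus>\<^bsub>H\<^esub> c g) g) ((v \<oplus>\<^bsub>H\<^esub> w) \<ominus>\<^bsub>H\<^esub> \<pi> g (v \<oplus>\<^bsub>H\<^esub> w))
           \<le> hdist H (b g) (v \<ominus>\<^bsub>H\<^esub> \<pi> g v) + hdist H (c g) (w \<ominus>\<^bsub>H\<^esub> \<pi> g w)"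
          using gG v w b c by (simp add: hdist_add cocycle_closed rep_closed)
        also have "\<dots> < \<epsilon>" using d e g by fastforce
        finally show ?thesis .
      qed
      then show ?thesis using v w by (intro bexI[of _ "v \<oplus>\<^bsub>H\<^esub> w"]) auto
    qed
    then have "(\<lambda>g\<in>carrier G. b g \<oplus>\<^bsub>H\<^esub> c g) \<in> ?N"
      unfolding cocycle_closure_iff[OF T] using cocycles_add[OF T b c] by blast
    then show "b \<otimes>\<^bsub>?Z\<^esub> c \<in> ?N" by (simp add: cocycle_group_def)
  qed
  then show ?thesis by (rule Z.subgroup_imp_normal)
qed

lemma group_reduced_H1:
  "topspace T = carrier G \<Longrightarrow> group (reduced_H1 G T H \<pi>)"
  unfolding reduced_H1_def by (intro normal.factorgroup_is_group normal_closure_coboundaries)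

lemma reduced_H1_nontrivial_iff:
  assumes T: "topspace T = carrier G"
  shows "\<not> trivial_group (reduced_H1 G T H \<pi>) \<longleftrightarrow>
    (\<exists>b\<in>cocycles G T H \<pi>. \<exists>Q \<epsilon>. compactin T Q \<and> \<epsilon> > 0 \<and>
       (\<forall>v\<in>carrier H. \<exists>g\<in>Q. \<epsilon> \<le> hdist H (b g) (v \<ominus>\<^bsub>H\<^esub> \<pi> g v)))"
proof -
  let ?Z = "cocycle_group G T H \<pi>" and ?N = "cocycle_topology G T H \<pi> closure_of coboundaries G H \<pi>"
  interpret Z: comm_group ?Z by (rule comm_group_cocycle_group[OF T])
  interpret N: normal ?N ?Z by (rule normal_closure_coboundaries[OF T])
  interpret R: group "reduced_H1 G T H \<pi>" by (rule group_reduced_H1[OF T])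
  have "trivial_group (reduced_H1 G T H \<pi>) \<longleftrightarrow> (\<forall>b\<in>carrier ?Z. ?N #>\<^bsub>?Z\<^esub> b = ?N)"
    unfolding R.trivial_group_subset by (auto simp: reduced_H1_def carrier_FactGroup)
  also have "\<dots> \<longleftrightarrow> (\<forall>b\<in>cocycles G T H \<pi>. b \<in> ?N)"
    using Z.coset_join1[of ?N] Z.coset_join2[of _ ?N] N.subset N.subgroup_axioms
    by (auto simp: cocycle_group_def)
  finally show ?thesis unfolding cocycle_closure_iff[OF T] by (auto simp: not_less)
qed

end

section \<open>Property \<open>H\<^sub>F\<^sub>D\<close> on Hilbert spaces over any type\<close>

definition transport_space :: "('v \<Rightarrow> 'w) \<Rightarrow> 'v set \<Rightarrow> 'v inner_module \<Rightarrow> 'w inner_module" where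
  "transport_space \<phi> V H =
     \<lparr>carrier = \<phi> ` V, mult = undefined, one = undefined, ring.zero = \<phi> \<zero>\<^bsub>H\<^esub>,
      add = (\<lambda>x y. \<phi> (inv_into V \<phi> x \<oplus>\<^bsub>H\<^esub> inv_into V \<phi> y)),
      smult = (\<lambda>a x. \<phi> (a \<odot>\<^bsub>H\<^esub> inv_into V \<phi> x)),
      ip = (\<lambda>x y. ip H (inv_into V \<phi> x) (inv_into V \<phi> y))\<rparr>"

locale closed_subspace = hilbert_space K H for K and H :: "'v inner_module" +
  fixes V :: "'v set" and \<phi> :: "'v \<Rightarrow> 'w"
  assumes V_sub: "V \<subseteq> carrier H" and V_zero: "\<zero>\<^bsub>H\<^esub> \<in> V"
    and V_add: "\<lbrakk>x \<in> V; y \<in> V\<rbrakk> \<Longrightarrow> x \<oplus>\<^bsub>H\<^esub> y \<in> V"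
    and V_smult: "\<lbrakk>a \<in> K; x \<in> V\<rbrakk> \<Longrightarrow> a \<odot>\<^bsub>H\<^esub> x \<in> V"
    and V_closed: "\<lbrakk>range s \<subseteq> V; limitin (htop H) s x sequentially\<rbrakk> \<Longrightarrow> x \<in> V"
    and inj: "inj_on \<phi> V"
begin

abbreviation "L \<equiv> transport_space \<phi> V H"

lemma inv_phi [simp]: "x \<in> V \<Longrightarrow> inv_into V \<phi> (\<phi> x) = x"
  using inj by simp

lemma V_carrier: "x \<in> V \<Longrightarrow> x \<in> carrier H" using V_sub by blast

lemma V_minus: "x \<in> V \<Longrightarrow> \<ominus>\<^bsub>H\<^esub> x \<in> V"
  using minus_eq_smult[of x] V_smult[of "of_real (-1)" x] real_in_scalars[of "-1"] V_carrier by simp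

lemma V_diff: "\<lbrakk>x \<in> V; y \<in> V\<rbrakk> \<Longrightarrow> x \<ominus>\<^bsub>H\<^esub> y \<in> V"
  by (simp add: a_minus_def V_add V_minus)

lemma L_carrier: "carrier L = \<phi> ` V" by (simp add: transport_space_def)
lemma L_zero: "\<zero>\<^bsub>L\<^esub> = \<phi> \<zero>\<^bsub>H\<^esub>" by (simp add: transport_space_def)
lemma L_add: "\<lbrakk>x \<in> V; y \<in> V\<rbrakk> \<Longrightarrow> \<phi> x \<oplus>\<^bsub>L\<^esub> \<phi> y = \<phi> (x \<oplus>\<^bsub>H\<^esub> y)" by (simp add: transport_space_def)
lemma L_smult: "x \<in> V \<Longrightarrow> a \<odot>\<^bsub>L\<^esub> \<phi> x = \<phi> (a \<odot>\<^bsub>H\<^esub> x)" by (simp add: transport_space_def)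
lemma L_ip: "\<lbrakk>x \<in> V; y \<in> V\<rbrakk> \<Longrightarrow> ip L (\<phi> x) (\<phi> y) = ip H x y" by (simp add: transport_space_def)

lemma L_abelian: "abelian_group L"
proof (rule abelian_groupI)
  fix x assume "x \<in> carrier L"
  then obtain u where u: "u \<in> V" "x = \<phi> u" by (auto simp: L_carrier)
  show "\<zero>\<^bsub>L\<^esub> \<oplus>\<^bsub>L\<^esub> x = x" using u by (simp add: L_zero L_add V_zero V_carrier)
  show "\<exists>y\<in>carrier L. y \<oplus>\<^bsub>L\<^esub> x = \<zero>\<^bsub>L\<^esub>"
    using u by (intro bexI[of _ "\<phi> (\<ominus>\<^bsub>H\<^esub> u)"]) (auto simp: L_carrier L_zero L_add V_minus V_carrier M.l_neg)
qed (auto simp: L_carrier L_zero L_add V_zero V_add V_carrier M.a_ac)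

lemma L_module: "Module.module (scalar_field K) L"
proof (rule Module.moduleI)
  show "cring (scalar_field K)" by (rule R.is_cring)
qed (auto simp: L_abelian L_carrier L_add L_smult V_add V_smult V_carrier
    smult_l_distr[simplified] smult_r_distr[simplified] smult_assoc1[simplified] smult_one[simplified])

lemma L_inner: "inner_product_space K L"
proof (intro inner_product_space.intro inner_product_space_axioms.intro)
  show "Module.module (scalar_field K) L" by (rule L_module)
  show "K = \<real> \<or> K = UNIV" by (rule scalars)
qed (auto simp: L_carrier L_zero L_add L_smult L_ip V_add V_smult V_carrier ip_closed ip_add_left ip_smult_left
    intro!: ip_pos ip_commute)

sublocale L: inner_product_space K L by (rule L_inner)

lemma L_minus: "x \<in> V \<Longrightarrow> \<ominus>\<^bsub>L\<^esub> \<phi> x = \<phi> (\<ominus>\<^bsub>H\<^esub> x)"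
  by (intro L.M.minus_equality) (auto simp: L_carrier L_zero L_add V_minus V_carrier M.l_neg)

lemma L_diff: "\<lbrakk>x \<in> V; y \<in> V\<rbrakk> \<Longrightarrow> \<phi> x \<ominus>\<^bsub>L\<^esub> \<phi> y = \<phi> (x \<ominus>\<^bsub>H\<^esub> y)"
  by (simp add: a_minus_def L_minus L_add V_minus)

lemma L_hdist: "\<lbrakk>x \<in> V; y \<in> V\<rbrakk> \<Longrightarrow> hdist L (\<phi> x) (\<phi> y) = hdist H x y"
  by (simp add: hdist_def L_carrier V_carrier L_diff hnorm_def L_ip V_diff)

lemma L_complete: "Metric_space.mcomplete (carrier L) (hdist L)"
  unfolding L.Metric.mcomplete_def
proof (intro allI impI)
  fix s assume c: "L.Metric.MCauchy s"
  define \<tau> where "\<tau> = inv_into V \<phi> \<circ> s"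
  have sV: "s n \<in> \<phi> ` V" for n using c[unfolded L.Metric.MCauchy_def] L_carrier by blast
  then have \<tau>V: "\<tau> n \<in> V" for n by (simp add: \<tau>_def inv_into_into)
  have s: "s n = \<phi> (\<tau> n)" for n using sV[of n] by (simp add: \<tau>_def f_inv_into_f)
  have "Metric.MCauchy \<tau>"
    unfolding Metric.MCauchy_def
  proof (intro conjI)
    show "range \<tau> \<subseteq> carrier H" using \<tau>V V_carrier by blast
    show "\<forall>\<epsilon>>0. \<exists>N. \<forall>n n'. N \<le> n \<longrightarrow> N \<le> n' \<longrightarrow> hdist H (\<tau> n) (\<tau> n') < \<epsilon>"
      using c unfolding L.Metric.MCauchy_def s by (simp add: L_hdist \<tau>V)
  qed
  then obtain x where x: "limitin Metric.mtopology \<tau> x sequentially"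
    using complete unfolding Metric.mcomplete_def by blast
  have xV: "x \<in> V" using \<tau>V x by (intro V_closed) (auto simp: htop_eq)
  have "limitin L.Metric.mtopology s (\<phi> x) sequentially"
    using x unfolding Metric.limit_metric_sequentially L.Metric.limit_metric_sequentially
    by (simp add: s L_hdist \<tau>V xV L_carrier) meson
  then show "\<exists>x. limitin L.Metric.mtopology s x sequentially" ..
qed

lemma L_hilbert: "hilbert_space K L"
  by (intro hilbert_space.intro hilbert_space_axioms.intro L_inner L_complete)

lemma L_continuous:
  assumes "continuous_map Y (htop H) f" and "\<And>x. x \<in> topspace Y \<Longrightarrow> f x \<in> V"
  shows "continuous_map Y (htop L) (\<lambda>x. \<phi> (f x))"
  unfolding L.continuous_map_htop
proof (intro conjI ballI allI impI)
  fix x and \<epsilon> :: real assume x: "x \<in> topspace Y" and "\<epsilon> > 0"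
  then obtain U where U: "openin Y U" "x \<in> U" "\<forall>y\<in>U. hdist H (f x) (f y) < \<epsilon>"
    using assms(1) unfolding continuous_map_htop by meson
  have "hdist L (\<phi> (f x)) (\<phi> (f y)) < \<epsilon>" if "y \<in> U" for y
    using U(3) that assms(2) x openin_subset[OF U(1)] by (subst L_hdist) auto
  then show "\<exists>U. openin Y U \<and> x \<in> U \<and> (\<forall>y\<in>U. hdist L (\<phi> (f x)) (\<phi> (f y)) < \<epsilon>)"
    using U by blast
qed (use assms(2) in \<open>simp add: L_carrier\<close>)

lemma L_finsum:
  assumes "finite B" and "\<And>x. x \<in> B \<Longrightarrow> f x \<in> V"
  shows "(\<Oplus>\<^bsub>H\<^esub>x\<in>B. f x) \<in> V \<and> \<phi> (\<Oplus>\<^bsub>H\<^esub>x\<in>B. f x) = (\<Oplus>\<^bsub>L\<^esub>x\<in>B. \<phi> (f x))"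
  using assms
proof (induction B)
  case empty
  then show ?case by (simp add: V_zero L_zero)
next
  case (insert x B)
  then have "f \<in> B \<rightarrow> carrier H" "f x \<in> carrier H" "(\<lambda>x. \<phi> (f x)) \<in> B \<rightarrow> carrier L" "\<phi> (f x) \<in> carrier L"
    by (auto simp: V_carrier L_carrier)
  then show ?case using insert by (simp add: M.finsum_insert L.M.finsum_insert V_add L_add[symmetric])
qed

end

lemma (in inner_product_space) limitin_ip_zero:
  assumes lim: "limitin (htop H) s x sequentially" and z: "z \<in> carrier H"
    and s: "\<And>n. s n \<in> carrier H" "\<And>n. ip H (s n) z = 0"
  shows "Re (ip H x z) = 0"
proof (rule ccontr)
  assume nz: "Re (ip H x z) \<noteq> 0"
  have x: "x \<in> carrier H" using lim by (simp add: htop_eq Metric.limit_metric_sequentially)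
  have pos: "hnorm H z + 1 > 0" using hnorm_nonneg[OF z] by simp
  then obtain n where n: "hdist H (s n) x < \<bar>Re (ip H x z)\<bar> / (hnorm H z + 1)"
    using lim nz unfolding htop_eq Metric.limit_metric_sequentially
    by (meson divide_pos_pos order_refl zero_less_abs_iff)
  have "\<bar>Re (ip H x z)\<bar> = \<bar>Re (ip H (s n \<ominus>\<^bsub>H\<^esub> x) z)\<bar>"
    using x z s by (simp add: ip_diff_left)
  also have "\<dots> \<le> hnorm H (s n \<ominus>\<^bsub>H\<^esub> x) * hnorm H z"
    using x z s by (intro Re_ip_le) auto
  also have "\<dots> \<le> hdist H (s n) x * (hnorm H z + 1)"
    using x s hnorm_nonneg[of "s n \<ominus>\<^bsub>H\<^esub> x"] hnorm_nonneg[OF z] by (auto simp: hdist_def intro!: mult_left_mono)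
  also have "\<dots> < \<bar>Re (ip H x z)\<bar>" using n pos by (simp add: field_simps)
  finally show False by simp
qed

theorem property_HFD_any_space:
  fixes G :: "('g, 'm) monoid_scheme" and T :: "'g topology" and H :: "'v inner_module"
  assumes T: "topspace T = carrier G" and HFD: "property_HFD G T"
    and rep: "unitary_rep G T H \<pi>" and nt: "\<not> trivial_group (reduced_H1 G T H \<pi>)"
  shows "has_finite_dimensional_subrep G UNIV H \<pi>"
proof -
  interpret hilbert_rep G T UNIV H \<pi> by (rule rep)
  interpret G: group G by (rule groupG)
  obtain b Q \<epsilon> where b: "b \<in> cocycles G T H \<pi>" and Q: "compactin T Q" "\<epsilon> > 0"
    and far: "\<forall>v\<in>carrier H. \<exists>g\<in>Q. \<epsilon> \<le> hdist H (b g) (v \<ominus>\<^bsub>H\<^esub> \<pi> g v)"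
    using nt unfolding reduced_H1_nontrivial_iff[OF T] by blast
  have bH: "b g \<in> carrier H" if "g \<in> carrier G" for g using b that by (rule cocycle_closed)
  have QG: "Q \<subseteq> carrier G" using Q T compactin_subset_topspace by blast
  define N where "N = {x \<in> carrier H. \<forall>g\<in>carrier G. ip H x (b g) = 0}"
  define V where "V = {x \<in> carrier H. \<forall>n\<in>N. ip H x n = 0}"
  define \<phi> where "\<phi> = (\<lambda>x g. if g \<in> carrier G then ip H x (b g) else 0)"
  have NH: "n \<in> carrier H" if "n \<in> N" for n using that by (simp add: N_def)
  have VH: "x \<in> carrier H" if "x \<in> V" for x using that by (simp add: V_def)
  have smH: "a \<odot>\<^bsub>H\<^esub> x \<in> carrier H" if "x \<in> carrier H" for a x using smult_closed[of a x] that by simp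
  have adj: "ip H (\<pi> g x) y = ip H x (\<pi> (inv\<^bsub>G\<^esub> g) y)" if "g \<in> carrier G" "x \<in> carrier H" "y \<in> carrier H" for g x y
  proof -
    have "ip H (\<pi> (inv\<^bsub>G\<^esub> g) (\<pi> g x)) (\<pi> (inv\<^bsub>G\<^esub> g) y) = ip H (\<pi> g x) y"
      using that by (intro rep_ip) (auto intro: rep_closed)
    moreover have "\<pi> (inv\<^bsub>G\<^esub> g) (\<pi> g x) = x" using that by (intro orbit_sym_aux) auto
    ultimately show ?thesis by simp
  qed
  have pib: "\<pi> g (b h) = b (g \<otimes>\<^bsub>G\<^esub> h) \<ominus>\<^bsub>H\<^esub> b g" if "g \<in> carrier G" "h \<in> carrier G" for g h
    using that cocycle_mult[OF b that] bH rep_closed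
    by (simp add: a_minus_def M.a_assoc M.r_neg)
  have N_rep: "\<pi> g n \<in> N" if g: "g \<in> carrier G" and n: "n \<in> N" for g n
  proof -
    have "ip H (\<pi> g n) (b h) = 0" if h: "h \<in> carrier G" for h
      using adj[OF g NH[OF n] bH[OF h]] g h n bH by (simp add: pib ip_diff_right NH) (simp add: N_def)
    then show ?thesis using rep_closed[OF g NH[OF n]] by (simp add: N_def)
  qed
  have V_rep: "\<pi> g x \<in> V" if g: "g \<in> carrier G" and x: "x \<in> V" for g x
  proof -
    have "ip H (\<pi> g x) n = 0" if n: "n \<in> N" for n
      using adj[OF g VH[OF x] NH[OF n]] N_rep[of "inv\<^bsub>G\<^esub> g" n] g n x by (simp add: V_def)
    then show ?thesis using rep_closed[OF g VH[OF x]] by (simp add: V_def)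
  qed
  have bV: "b g \<in> V" if g: "g \<in> carrier G" for g
  proof -
    have "ip H (b g) n = 0" if "n \<in> N" for n
      using ip_commute[of n "b g"] NH[OF that] bH[OF g] that g by (simp add: N_def)
    then show ?thesis using bH[OF g] by (simp add: V_def)
  qed
  interpret closed_subspace UNIV H V \<phi>
  proof
    show "V \<subseteq> carrier H" by (auto simp: V_def)
    show "\<zero>\<^bsub>H\<^esub> \<in> V" by (simp add: V_def NH)
    show "x \<oplus>\<^bsub>H\<^esub> y \<in> V" if "x \<in> V" "y \<in> V" for x y
      using that by (simp add: V_def ip_add_left NH)
    show "a \<odot>\<^bsub>H\<^esub> x \<in> V" if "a \<in> UNIV" "x \<in> V" for a x
      using that smH by (simp add: V_def ip_smult_left NH)
    show "x \<in> V" if s: "range s \<subseteq> V" and lim: "limitin (htop H) s x sequentially" for s x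
    proof -
      have x: "x \<in> carrier H" using lim by (simp add: htop_eq Metric.limit_metric_sequentially)
      have sVn: "s k \<in> carrier H" for k using s V_def by blast
      have sV0: "ip H (s k) n = 0" if "n \<in> N" for k n
        using s that unfolding V_def by blast
      have "ip H x n = 0" if n: "n \<in> N" for n
      proof -
        have 0: "Re (ip H x n) = 0"
          using sVn sV0 n by (intro limitin_ip_zero[OF lim NH[OF n]]) blast+
        have "Re (ip H x (\<i> \<odot>\<^bsub>H\<^esub> n)) = 0"
          using sVn sV0[OF n] NH[OF n] by (intro limitin_ip_zero[OF lim smH]) (simp_all add: ip_smult_right)
        then have "Im (ip H x n) = 0" using x NH[OF n] by (simp add: ip_smult_right)
        with 0 show ?thesis by (simp add: complex_eq_iff)
      qed
      then show ?thesis using x by (simp add: V_def)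
    qed
    show "inj_on \<phi> V"
    proof (rule inj_onI)
      fix x y assume x: "x \<in> V" and y: "y \<in> V" and e: "\<phi> x = \<phi> y"
      let ?d = "x \<ominus>\<^bsub>H\<^esub> y"
      have xH: "x \<in> carrier H" and yH: "y \<in> carrier H" using VH x y by auto
      then have d: "?d \<in> carrier H" by simp
      have "ip H ?d (b g) = 0" if g: "g \<in> carrier G" for g
        using fun_cong[OF e, of g] g ip_diff_left[OF xH yH bH[OF g]] by (simp add: \<phi>_def)
      then have dN: "?d \<in> N" using d unfolding N_def by blast
      have "ip H x ?d = 0" "ip H y ?d = 0" using x y dN unfolding V_def by blast+
      then have "ip H ?d ?d = 0" using ip_diff_left[OF xH yH d] by simp
      then have "?d = \<zero>\<^bsub>H\<^esub>" using ip_pos[OF d] by fastforce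
      then show "x = y" using diff_eq_zero[OF xH yH] by simp
    qed
  qed
  define \<rho> where "\<rho> = (\<lambda>g. \<lambda>f\<in>carrier L. \<phi> (\<pi> g (inv_into V \<phi> f)))"
  have \<rho>: "\<rho> g (\<phi> x) = \<phi> (\<pi> g x)" if "x \<in> V" for g x
    using that by (simp add: \<rho>_def L_carrier)
  have \<rho>_ext: "\<rho> g \<in> extensional (carrier L)" for g by (simp add: \<rho>_def)
  have inv_rep: "\<pi> (inv\<^bsub>G\<^esub> g) (\<pi> g x) = x" if "g \<in> carrier G" "x \<in> V" for g x
    using that VH by (intro orbit_sym_aux) auto
  have act: "group_action G (carrier L) \<rho>"
  proof (intro group_action.intro group_hom.intro group_hom_axioms.intro homI G.is_group group_BijGroup)
    have bij: "bij_betw (\<rho> g) (carrier L) (carrier L)" if g: "g \<in> carrier G" for g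
    proof (rule bij_betw_byWitness[where f' = "\<rho> (inv\<^bsub>G\<^esub> g)"])
      show "\<forall>a\<in>carrier L. \<rho> (inv\<^bsub>G\<^esub> g) (\<rho> g a) = a"
        using g by (auto simp: L_carrier \<rho> V_rep inv_rep)
      show "\<forall>a\<in>carrier L. \<rho> g (\<rho> (inv\<^bsub>G\<^esub> g) a) = a"
        using g inv_rep[of "inv\<^bsub>G\<^esub> g"] by (auto simp: L_carrier \<rho> V_rep)
    qed (use g in \<open>auto simp: L_carrier \<rho> V_rep\<close>)
    show Bij: "\<rho> g \<in> carrier (BijGroup (carrier L))" if "g \<in> carrier G" for g
      using bij[OF that] \<rho>_ext by (simp add: BijGroup_def Bij_def)
    show "\<rho> (g \<otimes>\<^bsub>G\<^esub> h) = \<rho> g \<otimes>\<^bsub>BijGroup (carrier L)\<^esub> \<rho> h" if g: "g \<in> carrier G" and h: "h \<in> carrier G" for g h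
    proof
      fix f show "\<rho> (g \<otimes>\<^bsub>G\<^esub> h) f = (\<rho> g \<otimes>\<^bsub>BijGroup (carrier L)\<^esub> \<rho> h) f"
      proof -
        have "(\<rho> g \<otimes>\<^bsub>BijGroup (carrier L)\<^esub> \<rho> h) f = compose (carrier L) (\<rho> g) (\<rho> h) f"
          using Bij[OF g] Bij[OF h] by (simp add: BijGroup_def)
        also have "\<dots> = \<rho> (g \<otimes>\<^bsub>G\<^esub> h) f"
        proof (cases "f \<in> carrier L")
          case True
          then obtain x where x: "x \<in> V" "f = \<phi> x" by (auto simp: L_carrier)
          then show ?thesis
            using True x(1) g h V_rep[OF h x(1)] VH[OF x(1)]
            by (simp add: compose_eq \<rho> composition_rule)
        next
          case False
          then show ?thesis using \<rho>_ext by (simp add: compose_def extensional_def)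
        qed
        finally show ?thesis by simp
      qed
    qed
  qed
  have rep': "unitary_rep G T L \<rho>"
  proof (intro hilbert_rep.intro hilbert_rep_axioms.intro act L_hilbert)
    show "continuous_map T (htop L) (\<lambda>g. \<rho> g x)" if x: "x \<in> carrier L" for x
    proof -
      obtain u where u: "u \<in> V" "x = \<phi> u" using x by (auto simp: L_carrier)
      then show ?thesis using L_continuous[OF rep_continuous[of u]] VH V_rep T by (simp add: \<rho>)
    qed
  qed (auto simp: L_carrier L_add L_smult L_ip \<rho> V_add V_smult V_rep rep_add rep_smult rep_ip V_carrier)
  interpret L': hilbert_rep G T UNIV L \<rho> by (rule rep')
  have "\<not> trivial_group (reduced_H1 G T L \<rho>)"
    unfolding L'.reduced_H1_nontrivial_iff[OF T]
  proof (intro bexI[of _ "\<lambda>g\<in>carrier G. \<phi> (b g)"] exI[of _ Q] exI[of _ \<epsilon>] conjI ballI)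
    show "(\<lambda>g\<in>carrier G. \<phi> (b g)) \<in> cocycles G T L \<rho>"
      using b T by (intro L'.cocyclesI L_continuous)
        (auto simp: bV V_rep \<rho> L_add cocycle_mult cocycle_continuous)
    show "compactin T Q" "\<epsilon> > 0" using Q by auto
    fix v assume "v \<in> carrier L"
    then obtain u where u: "u \<in> V" "v = \<phi> u" by (auto simp: L_carrier)
    then obtain g where g: "g \<in> Q" "\<epsilon> \<le> hdist H (b g) (u \<ominus>\<^bsub>H\<^esub> \<pi> g u)" using far VH by blast
    then show "\<exists>g\<in>Q. \<epsilon> \<le> hdist L ((\<lambda>g\<in>carrier G. \<phi> (b g)) g) (v \<ominus>\<^bsub>L\<^esub> \<rho> g v)"
      using QG u by (intro bexI[of _ g]) (auto simp: subset_iff \<rho> L_diff V_rep L_hdist bV V_diff)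
  qed
  then have "has_finite_dimensional_subrep G UNIV L \<rho>"
    using HFD rep' unfolding property_HFD_def by blast
  then obtain W where W: "submodule W (scalar_field UNIV) L" "\<forall>g\<in>carrier G. \<rho> g ` W \<subseteq> W"
    and fd: "finite_dimensional UNIV L W" and nz: "W \<noteq> {\<zero>\<^bsub>L\<^esub>}"
    unfolding has_finite_dimensional_subrep_def by blast
  define U where "U = {x \<in> V. \<phi> x \<in> W}"
  have WL: "W \<subseteq> \<phi> ` V" using L.submoduleE(1)[OF W(1)] by (simp add: L_carrier)
  then have WU: "W = \<phi> ` U" by (auto simp: U_def)
  have WZ: "\<zero>\<^bsub>L\<^esub> \<in> W" using submodule.axioms(1)[OF W(1)] subgroup.one_closed by fastforce
  have "submodule U (scalar_field UNIV) H"
  proof (rule submoduleI)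
    show "U \<subseteq> carrier H" using VH by (auto simp: U_def)
    show "\<zero>\<^bsub>H\<^esub> \<in> U" using WZ by (simp add: U_def L_zero V_zero)
    show "\<ominus>\<^bsub>H\<^esub> a \<in> U" if "a \<in> U" for a
      using that L.submoduleE(3)[OF W(1), of "\<phi> a"] by (simp add: U_def L_minus V_minus)
    show "a \<oplus>\<^bsub>H\<^esub> c \<in> U" if "a \<in> U" "c \<in> U" for a c
      using that L.submoduleE(5)[OF W(1), of "\<phi> a" "\<phi> c"] by (simp add: U_def L_add V_add)
    show "a \<odot>\<^bsub>H\<^esub> x \<in> U" if "a \<in> carrier (scalar_field UNIV)" "x \<in> U" for a x
      using that L.submoduleE(4)[OF W(1), of a "\<phi> x"] by (simp add: U_def L_smult V_smult)
  qed
  moreover have "\<forall>g\<in>carrier G. \<pi> g ` U \<subseteq> U"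
  proof (intro ballI subsetI)
    fix g y assume g: "g \<in> carrier G" and "y \<in> \<pi> g ` U"
    then obtain x where x: "x \<in> V" "\<phi> x \<in> W" "y = \<pi> g x" by (auto simp: U_def)
    have "\<rho> g (\<phi> x) \<in> W" using W(2) g x(2) by blast
    then show "y \<in> U" using x g by (simp add: U_def \<rho> V_rep)
  qed
  moreover have "finite_dimensional UNIV H U"
  proof -
    obtain B where B: "finite B" "B \<subseteq> W"
      and gen: "\<forall>w\<in>W. \<exists>c\<in>B \<rightarrow> UNIV. w = (\<Oplus>\<^bsub>L\<^esub>x\<in>B. c x \<odot>\<^bsub>L\<^esub> x)"
      using fd unfolding finite_dimensional_def by blast
    let ?\<psi> = "inv_into V \<phi>"
    have BV: "?\<psi> x \<in> V" "\<phi> (?\<psi> x) = x" if "x \<in> B" for x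
      using that B WL by (auto intro: inv_into_into f_inv_into_f)
    have inj': "inj_on ?\<psi> B" using BV by (metis inj_onI)
    show ?thesis unfolding finite_dimensional_def
    proof (intro exI[of _ "?\<psi> ` B"] conjI ballI)
      show "finite (?\<psi> ` B)" using B by simp
      show "?\<psi> ` B \<subseteq> U" using BV B by (auto simp: U_def)
      fix w assume w: "w \<in> U"
      then obtain c where c: "\<phi> w = (\<Oplus>\<^bsub>L\<^esub>x\<in>B. c x \<odot>\<^bsub>L\<^esub> x)" using gen by (auto simp: U_def)
      have sV: "c x \<odot>\<^bsub>H\<^esub> ?\<psi> x \<in> V" if "x \<in> B" for x using that BV V_smult by simp
      have "(\<Oplus>\<^bsub>L\<^esub>x\<in>B. c x \<odot>\<^bsub>L\<^esub> x) = (\<Oplus>\<^bsub>L\<^esub>x\<in>B. \<phi> (c x \<odot>\<^bsub>H\<^esub> ?\<psi> x))"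
        using sV BV by (intro L.M.finsum_cong') (auto simp: L_carrier L_smult[symmetric])
      then have "\<phi> w = \<phi> (\<Oplus>\<^bsub>H\<^esub>x\<in>B. c x \<odot>\<^bsub>H\<^esub> ?\<psi> x)" "(\<Oplus>\<^bsub>H\<^esub>x\<in>B. c x \<odot>\<^bsub>H\<^esub> ?\<psi> x) \<in> V"
        using c L_finsum[OF B(1) sV] by auto
      then have "w = (\<Oplus>\<^bsub>H\<^esub>x\<in>B. c x \<odot>\<^bsub>H\<^esub> ?\<psi> x)" using inj w by (auto simp: U_def inj_on_def)
      also have "\<dots> = (\<Oplus>\<^bsub>H\<^esub>x\<in>B. c (\<phi> (?\<psi> x)) \<odot>\<^bsub>H\<^esub> ?\<psi> x)"
        using sV BV VH by (intro M.finsum_cong') auto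
      also have "\<dots> = (\<Oplus>\<^bsub>H\<^esub>y\<in>?\<psi> ` B. c (\<phi> y) \<odot>\<^bsub>H\<^esub> y)"
        using inj' sV BV VH by (intro M.finsum_reindex[symmetric]) auto
      finally show "\<exists>c\<in>?\<psi> ` B \<rightarrow> UNIV. w = (\<Oplus>\<^bsub>H\<^esub>x\<in>?\<psi> ` B. c x \<odot>\<^bsub>H\<^esub> x)" by auto
    qed
  qed
  moreover have "U \<noteq> {\<zero>\<^bsub>H\<^esub>}" using nz WU by (auto simp: L_zero)
  ultimately show ?thesis unfolding has_finite_dimensional_subrep_def by blast
qed

end

theory Submission
  imports Defs
begin

text \<open>
  Let \<open>b\<close> be a cocycle with linear growth in a representation \<open>\<pi>\<close> on a Hilbert space \<open>H\<close>, which may be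
  taken to be unitary (\<open>complexified_cocycle\<close>). The proof replaces \<open>b\<close> first by a cocycle with values in a
  finite-dimensional representation, and then by one whose image is cobounded.

  \<^emph>\<open>Reduction to finite dimension.\<close> Let \<open>V\<close> be the closed span of all finite-dimensional
  subrepresentations. Its orthogonal complement has none, so by property \<open>H\<^sub>F\<^sub>D\<close> the component of \<open>b\<close> there is a
  limit of coboundaries. The component in \<open>V\<close> is, uniformly on a compact generating set, close to its
  projection to one finite-dimensional subrepresentation \<open>W\<close>. Altogether, for every \<open>\<epsilon>\<close> there are \<open>W\<close> and a
  coboundary \<open>\<partial>v\<close> such that the cocycle \<open>b - P\<^sub>W b - \<partial>v\<close> has norm at most \<open>\<epsilon>\<close> on generators
  (\<open>finite_dimensional_approximation\<close>), hence at most \<open>\<epsilon> |g|\<close> at \<open>g\<close>, whereas \<open>\<partial>v\<close> is bounded. For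
  small \<open>\<epsilon>\<close> the linear growth of \<open>b\<close> passes to \<open>P\<^sub>W b\<close>, which is therefore proper
  (\<open>finite_dimensional_proper_cocycle\<close>).

  \<^emph>\<open>Cocompactness.\<close> Consider a cocycle \<open>b\<close> in a finite-dimensional orthogonal representation. If its image
  is not cobounded, then translates of large balls missing the image converge to a half-space, so that
  \<open>\<langle>b(g), u\<rangle> \<le> 1\<close> for all \<open>g\<close> and some unit vector \<open>u\<close> (\<open>half_space_of_not_cobounded\<close>). Since the orbit of \<open>u\<close>
  is relatively compact, a recurrence argument turns this one-sided bound into boundedness of the component
  of \<open>b\<close> in the span of the orbit of \<open>u\<close> (\<open>split_off_bounded_part\<close>). Removing that component lowers the
  dimension and changes \<open>b\<close> by a bounded amount only; after finitely many steps the image is cobounded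
  (\<open>cobounded_projection\<close>). The affine action given by the final cocycle is proper and cocompact
  (\<open>euclidean_action_of_cocycle\<close>).

  \<^emph>\<open>Discrete groups.\<close> For discrete \<open>G\<close>, iterated commutators \<open>[g, [g, \<dots> [g, h]]]\<close> of elements with rotation
  part near the identity converge to the trivial isometry, hence reach it by discreteness. From this and
  coboundedness it follows that an element with rotation part near the identity is a translation
  (\<open>near_id_trivial\<close>), which is the core of the first Bieberbach theorem. So the elements acting as translations
  have finite index; their commutators form a finite set, and a finitely generated group with this property
  has an abelian subgroup of finite index (\<open>virtually_abelian_of_finite_commutators\<close>).

  The finite-dimensional part takes place in subspaces of a real inner product space, the type \<open>finseq\<close> of
  finitely supported complex sequences being large enough to contain a copy of every such representation.
\<close>

section \<open>Finite-dimensional subspaces of a real inner product space\<close>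

definition orthonormal_proj :: "'a set \<Rightarrow> 'a \<Rightarrow> 'a::real_inner" where
  "orthonormal_proj B x = (\<Sum>e\<in>B. (x \<bullet> e) *\<^sub>R e)"

lemma linear_orthonormal_proj: "linear (orthonormal_proj B)"
  by (rule linearI) (simp_all add: orthonormal_proj_def inner_add_left scaleR_add_left sum.distrib scaleR_sum_right)

locale orthonormal_set =
  fixes B :: "'a::real_inner set"
  assumes finite_B: "finite B" and orth: "pairwise orthogonal B" and unit: "e \<in> B \<Longrightarrow> norm e = 1"
begin

lemma proj_in_span: "orthonormal_proj B x \<in> span B"
  unfolding orthonormal_proj_def by (intro span_sum span_scale span_base)

lemma proj_inner: "e \<in> B \<Longrightarrow> orthonormal_proj B x \<bullet> e = x \<bullet> e"
proof -
  assume e: "e \<in> B"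
  have "orthonormal_proj B x \<bullet> e = (\<Sum>f\<in>B. (x \<bullet> f) * (f \<bullet> e))"
    by (simp add: orthonormal_proj_def inner_sum_left)
  also have "\<dots> = (\<Sum>f\<in>B. if f = e then x \<bullet> e else 0)"
    using e orth unit[of e] by (intro sum.cong) (auto simp: pairwise_def orthogonal_def dot_square_norm)
  finally show ?thesis using finite_B e by simp
qed

lemma proj_orthogonal: "y \<in> span B \<Longrightarrow> (x - orthonormal_proj B x) \<bullet> y = 0"
proof (induction rule: span_induct)
  case base
  show ?case by (simp add: subspace_def inner_add_right)
next
  case (step e)
  then show ?case by (simp add: inner_diff_left proj_inner)
qed

lemma proj_unique:
  assumes "y \<in> span B" "\<And>e. e \<in> B \<Longrightarrow> (x - y) \<bullet> e = 0"
  shows "orthonormal_proj B x = y"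
proof -
  have "orthonormal_proj B x = orthonormal_proj B y"
    unfolding orthonormal_proj_def using assms(2) by (intro sum.cong) (auto simp: inner_diff_left)
  also have "\<dots> = y"
  proof -
    have "y - orthonormal_proj B y \<in> span B" using assms proj_in_span span_diff by blast
    then have "(y - orthonormal_proj B y) \<bullet> (y - orthonormal_proj B y) = 0" by (rule proj_orthogonal)
    then show ?thesis by simp
  qed
  finally show ?thesis .
qed

lemma proj_span: "y \<in> span B \<Longrightarrow> orthonormal_proj B y = y"
  by (rule proj_unique) auto

lemma norm_minus_proj: "norm (x - orthonormal_proj B x) \<le> norm x"
proof (rule power2_le_imp_le)
  let ?p = "orthonormal_proj B x"
  have "(x - ?p) \<bullet> ?p = 0" by (rule proj_orthogonal[OF proj_in_span])
  then have "(norm x)\<^sup>2 = (norm (x - ?p))\<^sup>2 + (norm ?p)\<^sup>2"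
    by (simp add: power2_norm_eq_inner inner_diff_left inner_diff_right inner_commute)
  then show "(norm (x - ?p))\<^sup>2 \<le> (norm x)\<^sup>2" by simp
qed simp

end

text \<open>
  The strict inequality for a proper subspace of \<open>span C\<close> is what makes inductions on the dimension
  terminate.
\<close>

lemma orthonormal_basis_of_subspace:
  fixes V :: "'a::real_inner set"
  assumes V: "subspace V" and C: "finite C" "V \<subseteq> span C"
  shows "\<exists>B. orthonormal_set B \<and> span B = V \<and> card B \<le> card C \<and> (\<forall>u\<in>span C - V. card B < card C)"
proof -
  obtain A where A: "A \<subseteq> V" "independent A" "V \<subseteq> span A"
    using maximal_independent_subset by blast
  have spA: "span A = V" by (intro subset_antisym span_minimal A V)
  have cA: "finite A" "card A \<le> card C" using independent_span_bound[OF C(1) A(2)] A(1) C(2) by auto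
  have less: "card A < card C" if u: "u \<in> span C" "u \<notin> V" for u
  proof -
    have "independent (insert u A)" using u A spA by (simp add: independent_insert)
    moreover have "insert u A \<subseteq> span C" using u A C by auto
    ultimately have "card (insert u A) \<le> card C" using independent_span_bound[OF C(1)] by blast
    moreover have "u \<notin> A" using u A by auto
    ultimately show ?thesis using cA by simp
  qed
  obtain D where D: "finite D" "card D \<le> card A" "span D = span A" "pairwise orthogonal D"
    using basis_orthogonal[OF cA(1)] by blast
  let ?D = "D - {0}" and ?c = "\<lambda>e::'a. 1 / norm e"
  define B where "B = (\<lambda>e. ?c e *\<^sub>R e) ` ?D"
  have fin: "finite ?D" using D by simp
  have "span B = span ?D" unfolding B_def by (rule span_image_scale) (use fin in auto)
  then have spB: "span B = V" using D spA by simp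
  have cB: "card B \<le> card A" using card_image_le[OF fin, of "\<lambda>e. ?c e *\<^sub>R e"] D(2) card_mono[OF D(1), of ?D]
    unfolding B_def by simp
  have "pairwise orthogonal B"
    unfolding B_def pairwise_image using D(4)
    by (auto simp: pairwise_def orthogonal_def)
  moreover have "norm e = 1" if e: "e \<in> B" for e
  proof -
    obtain d where "d \<noteq> 0" "e = (1 / norm d) *\<^sub>R d" using e by (auto simp: B_def)
    then show ?thesis by simp
  qed
  moreover have "finite B" using fin by (simp add: B_def)
  ultimately have "orthonormal_set B" by (simp add: orthonormal_set_def)
  moreover have "card B < card C" if "u \<in> span C - V" for u using less[of u] that cB by simp
  ultimately show ?thesis using spB cB cA by auto
qed

text \<open>
  The ball is a closed part of the set of all linear combinations of an orthonormal basis with coefficients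
  in \<open>[-R, R]\<close>, which is a finite sum of compact segments.
\<close>

lemma compact_subspace_cball:
  fixes V :: "'a::real_inner set"
  assumes V: "subspace V" and C: "finite C" "V \<subseteq> span C"
  shows "compact (V \<inter> cball 0 R)"
proof -
  obtain B where oB: "orthonormal_set B" and B: "span B = V"
    using orthonormal_basis_of_subspace[OF V C] by blast
  interpret orthonormal_set B by (rule oB)
  define box where "box = (\<lambda>D. {\<Sum>e\<in>D. f e *\<^sub>R e | f::'a\<Rightarrow>real. \<forall>e\<in>D. \<bar>f e\<bar> \<le> R})"
  have "compact (box D)" if "finite D" for D
    using that
  proof induction
    case empty
    then show ?case by (simp add: box_def)
  next
    case (insert e D)
    have "box (insert e D) = {x + y | x y. x \<in> (\<lambda>t. t *\<^sub>R e) ` {-R..R} \<and> y \<in> box D}" (is "_ = ?S")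
    proof
      show "box (insert e D) \<subseteq> ?S"
      proof
        fix z assume "z \<in> box (insert e D)"
        then obtain f where f: "\<forall>x\<in>insert e D. \<bar>f x\<bar> \<le> R" and z: "z = (\<Sum>x\<in>insert e D. f x *\<^sub>R x)"
          unfolding box_def by blast
        have "f e *\<^sub>R e \<in> (\<lambda>t. t *\<^sub>R e) ` {-R..R}" using f by (intro imageI) (auto simp: abs_le_iff)
        moreover have "(\<Sum>x\<in>D. f x *\<^sub>R x) \<in> box D" using f unfolding box_def by auto
        moreover have "z = f e *\<^sub>R e + (\<Sum>x\<in>D. f x *\<^sub>R x)" using z insert by simp
        ultimately show "z \<in> ?S" by blast
      qed
      show "?S \<subseteq> box (insert e D)"
      proof
        fix z assume "z \<in> ?S"
        then obtain t f where t: "\<bar>t\<bar> \<le> R" and f: "\<forall>e\<in>D. \<bar>f e\<bar> \<le> R"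
          and z: "z = t *\<^sub>R e + (\<Sum>e\<in>D. f e *\<^sub>R e)"
          unfolding box_def by (force simp: abs_le_iff)
        have "(\<Sum>x\<in>D. (f(e := t)) x *\<^sub>R x) = (\<Sum>x\<in>D. f x *\<^sub>R x)"
          using insert by (intro sum.cong) auto
        then have "z = (\<Sum>x\<in>insert e D. (f(e := t)) x *\<^sub>R x)" using insert z by simp
        then show "z \<in> box (insert e D)" using t f unfolding box_def
          by (intro CollectI exI[of _ "f(e := t)"]) auto
      qed
    qed
    moreover have "compact ((\<lambda>t. t *\<^sub>R e) ` {-R..R})"
      by (intro compact_continuous_image continuous_intros) auto
    ultimately show ?case using compact_sums[OF _ insert.IH] by simp
  qed
  then have box: "compact (box B)" using finite_B by blast
  have "V \<inter> cball 0 R = box B \<inter> cball 0 R"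
  proof (intro equalityI subsetI)
    fix x assume x: "x \<in> V \<inter> cball 0 R"
    then have "x = (\<Sum>e\<in>B. (x \<bullet> e) *\<^sub>R e)" using proj_span[of x] B by (simp add: orthonormal_proj_def)
    moreover have "\<bar>x \<bullet> e\<bar> \<le> R" if "e \<in> B" for e
      using Cauchy_Schwarz_ineq2[of x e] unit[OF that] x by simp
    ultimately show "x \<in> box B \<inter> cball 0 R" using x unfolding box_def by auto
  next
    fix x assume "x \<in> box B \<inter> cball 0 R"
    then obtain f where f: "x = (\<Sum>e\<in>B. f e *\<^sub>R e)" and R: "norm x \<le> R" by (auto simp: box_def)
    have "x \<in> span B" unfolding f by (intro span_sum span_scale span_base)
    then show "x \<in> V \<inter> cball 0 R" using B R by simp
  qed
  then show ?thesis using box by (simp add: compact_Int_closed)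
qed

text \<open>
  Recording for each \<open>v \<in> J\<close> a point of a finite net near \<open>f g v\<close> gives finitely many patterns; one \<open>g\<close> is
  kept for each pattern.
\<close>

lemma finite_net_of_maps:
  fixes f :: "'g \<Rightarrow> 'b \<Rightarrow> 'a::metric_space"
  assumes J: "finite J" and K: "compact K" and f: "\<And>g v. g \<in> A \<Longrightarrow> v \<in> J \<Longrightarrow> f g v \<in> K" and e: "\<epsilon> > 0"
  obtains N where "finite N" "N \<subseteq> A" "\<And>g. g \<in> A \<Longrightarrow> \<exists>x\<in>N. \<forall>v\<in>J. dist (f g v) (f x v) < \<epsilon>"
proof -
  obtain Z where Z: "finite Z" "K \<subseteq> (\<Union>z\<in>Z. ball z (\<epsilon>/2))"
    using K e unfolding compact_eq_totally_bounded by (meson half_gt_zero)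
  define near where "near = (\<lambda>y. SOME z. z \<in> Z \<and> dist z y < \<epsilon>/2)"
  have near: "near y \<in> Z \<and> dist (near y) y < \<epsilon>/2" if "y \<in> K" for y
  proof -
    obtain z where "z \<in> Z" "y \<in> ball z (\<epsilon>/2)" using Z \<open>y \<in> K\<close> by blast
    then have "\<exists>z. z \<in> Z \<and> dist z y < \<epsilon>/2" by (intro exI[of _ z]) (simp only: mem_ball)
    then show ?thesis unfolding near_def by (rule someI_ex)
  qed
  define F where "F = (\<lambda>g. \<lambda>v\<in>J. near (f g v))"
  have "F ` A \<subseteq> J \<rightarrow>\<^sub>E Z" using near f by (auto simp: F_def)
  then have "finite (F ` A)" using finite_PiE[OF J, of "\<lambda>_. Z"] Z finite_subset by blast
  then obtain N where N: "N \<subseteq> A" "finite N" "F ` A = F ` N"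
    using finite_subset_image[of "F ` A" F A] by auto
  have "\<exists>x\<in>N. \<forall>v\<in>J. dist (f g v) (f x v) < \<epsilon>" if g: "g \<in> A" for g
  proof -
    obtain x where x: "x \<in> N" "F g = F x" using N g by (metis imageE imageI)
    have "dist (f g v) (f x v) < \<epsilon>" if v: "v \<in> J" for v
    proof -
      have "near (f g v) = near (f x v)" using fun_cong[OF x(2), of v] v by (simp add: F_def)
      moreover have "f g v \<in> K" "f x v \<in> K" using f g x N v by auto
      ultimately have "dist (near (f g v)) (f g v) < \<epsilon>/2" "dist (near (f g v)) (f x v) < \<epsilon>/2"
        using near by metis+
      then show ?thesis by (metis dist_triangle_half_r)
    qed
    then show ?thesis using x by blast
  qed
  then show thesis using that N by blast
qed

section \<open>Cobounded cocycles in orthogonal representations\<close>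

locale linear_isometric_rep = group G
  for G :: "('g, 'm) monoid_scheme" (structure) +
  fixes \<sigma> :: "'g \<Rightarrow> 'a::real_inner \<Rightarrow> 'a"
  assumes linear: "g \<in> carrier G \<Longrightarrow> linear (\<sigma> g)"
    and inner: "g \<in> carrier G \<Longrightarrow> \<sigma> g x \<bullet> \<sigma> g y = x \<bullet> y"
    and mult: "\<lbrakk>g \<in> carrier G; h \<in> carrier G\<rbrakk> \<Longrightarrow> \<sigma> (g \<otimes> h) x = \<sigma> g (\<sigma> h x)"
begin

lemma isometry: "g \<in> carrier G \<Longrightarrow> norm (\<sigma> g x) = norm x"
  by (simp add: norm_eq_sqrt_inner inner)

lemmas add = linear_add[OF linear] and diff = linear_diff[OF linear] and zero = linear_0[OF linear]
  and minus = linear_neg[OF linear] and scale = linear_scale[OF linear]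

lemma one: "\<sigma> \<one> x = x"
proof -
  have "norm (\<sigma> \<one> (\<sigma> \<one> x - x)) = 0" using mult[of \<one> \<one> x] by (simp add: diff)
  then show ?thesis by (simp add: isometry)
qed

lemma inv_left: "g \<in> carrier G \<Longrightarrow> \<sigma> (inv g) (\<sigma> g x) = x"
  by (simp add: one flip: mult)

lemma inv_right: "g \<in> carrier G \<Longrightarrow> \<sigma> g (\<sigma> (inv g) x) = x"
  by (simp add: one flip: mult)

lemma adjoint: "g \<in> carrier G \<Longrightarrow> \<sigma> g x \<bullet> y = x \<bullet> \<sigma> (inv g) y"
  by (metis inner inv_right)

end

locale finite_dimensional_cocycle = linear_isometric_rep G \<sigma>
  for G :: "('g, 'm) monoid_scheme" (structure) and \<sigma> :: "'g \<Rightarrow> 'a::real_inner \<Rightarrow> 'a" +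
  fixes V :: "'a set" and b :: "'g \<Rightarrow> 'a"
  assumes subspace: "subspace V" and finite_dim: "\<exists>C. finite C \<and> V \<subseteq> span C"
    and invariant: "\<lbrakk>g \<in> carrier G; x \<in> V\<rbrakk> \<Longrightarrow> \<sigma> g x \<in> V"
    and closed: "g \<in> carrier G \<Longrightarrow> b g \<in> V"
    and cocycle: "\<lbrakk>g \<in> carrier G; h \<in> carrier G\<rbrakk> \<Longrightarrow> b (g \<otimes> h) = \<sigma> g (b h) + b g"
begin

lemma cocycle_one: "b \<one> = 0" using cocycle[of \<one> \<one>] by (simp add: one)

lemma cocycle_inv: "g \<in> carrier G \<Longrightarrow> \<sigma> g (b (inv g)) = - b g"
  using cocycle[of g "inv g"] by (simp add: cocycle_one eq_neg_iff_add_eq_0)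

lemma compact_ball: "compact (V \<inter> cball 0 R)"
  using finite_dim compact_subspace_cball subspace by blast

definition cobounded :: bool where
  "cobounded \<longleftrightarrow> (\<exists>R. \<forall>x\<in>V. \<exists>g\<in>carrier G. norm (x - b g) \<le> R)"

text \<open>
  Arbitrarily large balls miss the orbit \<open>b(G)\<close>. Moving an almost nearest orbit point to the origin gives \<open>y\<close>
  of arbitrarily large norm such that the ball of radius \<open>|y| - 1\<close> about \<open>y\<close> misses the orbit. The directions
  \<open>y / |y|\<close> accumulate at a unit vector \<open>u\<close>, and in the limit the orbit lies in a half-space.
\<close>

lemma half_space_of_not_cobounded:
  assumes "\<not> cobounded"
  obtains u where "u \<in> V" "norm u = 1" "\<And>g. g \<in> carrier G \<Longrightarrow> b g \<bullet> u \<le> 1"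
proof -
  have ex: "\<exists>y\<in>V. real k < norm y \<and> (\<forall>g\<in>carrier G. norm y - 1 \<le> norm (y - b g))" for k
  proof -
    obtain x where x: "x \<in> V" and far: "\<And>g. g \<in> carrier G \<Longrightarrow> norm (x - b g) > real k + 1"
      using assms unfolding cobounded_def by (metis not_le)
    define d where "d = (INF g\<in>carrier G. norm (x - b g))"
    have bdd: "bdd_below ((\<lambda>g. norm (x - b g)) ` carrier G)" by (rule bdd_belowI[of _ 0]) auto
    have ne: "(\<lambda>g. norm (x - b g)) ` carrier G \<noteq> {}" by auto
    obtain g where g: "g \<in> carrier G" "norm (x - b g) < d + 1"
      using cInf_lessD[OF ne, of "d + 1"] unfolding d_def by auto
    have d: "d \<le> norm (x - b h)" if "h \<in> carrier G" for h
      unfolding d_def by (rule cINF_lower[OF bdd that])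
    \<comment> \<open>The isometry inverse to \<open>z \<mapsto> \<sigma> g z + b g\<close> preserves the orbit and moves \<open>b g\<close> to the origin.\<close>
    let ?y = "\<sigma> (inv g) (x - b g)"
    have ny: "norm ?y = norm (x - b g)" using g isometry by simp
    have "norm ?y - 1 \<le> norm (?y - b h)" if h: "h \<in> carrier G" for h
    proof -
      have "norm (?y - b h) = norm (\<sigma> g (?y - b h))" using g isometry by simp
      also have "\<sigma> g (?y - b h) = (x - b g) - \<sigma> g (b h)"
        using diff[OF g(1), of ?y "b h"] inv_right[OF g(1), of "x - b g"] by simp
      also have "\<dots> = x - b (g \<otimes> h)" using g h by (simp add: cocycle)
      finally show ?thesis using d[of "g \<otimes> h"] g h ny by simp
    qed
    moreover have "?y \<in> V" using g x closed invariant subspace by (simp add: subspace_diff)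
    moreover have "norm ?y > real k" using far[OF g(1)] ny by simp
    ultimately show ?thesis by blast
  qed
  let ?P = "\<lambda>k y. y \<in> V \<and> real k < norm y \<and> (\<forall>g\<in>carrier G. norm y - 1 \<le> norm (y - b g))"
  have "\<forall>k. \<exists>y. ?P k y" using ex by blast
  then obtain y where "\<forall>k. ?P k (y k)" using choice[of ?P] by blast
  then have y: "y k \<in> V" "real k < norm (y k)"
    "g \<in> carrier G \<Longrightarrow> norm (y k) - 1 \<le> norm (y k - b g)" for k g by auto
  define v where "v = (\<lambda>k. y (Suc k) /\<^sub>R norm (y (Suc k)))"
  have pos: "norm (y (Suc k)) > 1" for k using y(2)[of "Suc k"] by simp
  have nz: "norm (y (Suc k)) \<noteq> 0" for k using pos[of k] by linarith
  have nv: "norm (v k) = 1" for k using nz[of k] by (simp add: v_def)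
  have vV: "v k \<in> V \<inter> cball 0 1" for k
    using nv[of k] y(1) subspace by (simp add: v_def subspace_scale)
  obtain u r where u: "u \<in> V \<inter> cball 0 1" and r: "strict_mono r" and lim: "(v \<circ> r) \<longlonglongrightarrow> u"
    using compact_ball[of 1] vV unfolding compact_eq_seq_compact_metric seq_compact_def by blast
  have "norm u = 1"
  proof -
    have "(\<lambda>k. norm ((v \<circ> r) k)) \<longlonglongrightarrow> norm u" using lim by (rule tendsto_norm)
    then show ?thesis using nv by (simp add: LIMSEQ_const_iff)
  qed
  moreover have "b g \<bullet> u \<le> 1" if g: "g \<in> carrier G" for g
  proof -
    \<comment> \<open>Expand the square in \<open>(|y| - 1)\<^sup>2 \<le> |y - b(g)|\<^sup>2\<close> and divide by \<open>|y|\<close>.\<close>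
    have bound: "b g \<bullet> v k \<le> 1 + (norm (b g))\<^sup>2 * inverse (real (Suc k))" for k
    proof -
      let ?y = "y (Suc k)"
      have "(norm ?y - 1)\<^sup>2 \<le> (norm (?y - b g))\<^sup>2"
        using y(3)[OF g, of "Suc k"] pos[of k] by (intro power_mono) auto
      also have "\<dots> = (norm ?y)\<^sup>2 - 2 * (b g \<bullet> ?y) + (norm (b g))\<^sup>2"
        by (simp add: power2_norm_eq_inner inner_diff_left inner_diff_right inner_commute)
      finally have "2 * (b g \<bullet> ?y) \<le> 2 * norm ?y + (norm (b g))\<^sup>2"
        by (simp add: power2_eq_square algebra_simps)
      then have "b g \<bullet> ?y \<le> norm ?y + (norm (b g))\<^sup>2"
        using zero_le_power2[of "norm (b g)"] by linarith
      then have "b g \<bullet> v k \<le> (norm ?y + (norm (b g))\<^sup>2) * inverse (norm ?y)"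
        using pos[of k] by (simp add: v_def divide_simps)
      also have "\<dots> = 1 + (norm (b g))\<^sup>2 * inverse (norm ?y)" using nz[of k] by (simp add: divide_simps del: norm_eq_zero)
      also have "\<dots> \<le> 1 + (norm (b g))\<^sup>2 * inverse (real (Suc k))"
        using y(2)[of "Suc k"] by (intro add_left_mono mult_left_mono le_imp_inverse_le) auto
      finally show ?thesis .
    qed
    have 1: "(\<lambda>k. b g \<bullet> (v \<circ> r) k) \<longlonglongrightarrow> b g \<bullet> u" using lim by (intro tendsto_intros)
    have "(\<lambda>k. 1 + (norm (b g))\<^sup>2 * inverse (real (Suc k))) \<longlonglongrightarrow> 1 + (norm (b g))\<^sup>2 * 0"
      by (intro tendsto_intros LIMSEQ_inverse_real_of_nat)
    then have 2: "((\<lambda>k. 1 + (norm (b g))\<^sup>2 * inverse (real (Suc k))) \<circ> r) \<longlonglongrightarrow> 1"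
      using LIMSEQ_subseq_LIMSEQ[OF _ r] by simp
    show ?thesis
      by (rule LIMSEQ_le[OF 1 2]) (use bound in \<open>simp del: of_nat_Suc\<close>)
  qed
  ultimately show thesis using u by (intro that[of u]) simp_all
qed

end

text \<open>
  Coordinates with respect to an arbitrary basis are linear, hence controlled by their values on an orthonormal
  basis of the same space.
\<close>

lemma bounded_coordinates:
  fixes U :: "'a::real_inner set"
  assumes U: "finite U" "independent U"
  shows "\<exists>K\<ge>0. \<forall>x\<in>span U. \<forall>w\<in>U. \<bar>representation U x w\<bar> \<le> K * norm x"
proof -
  obtain E where oE: "orthonormal_set E" and E: "span E = span U"
    using orthonormal_basis_of_subspace[OF subspace_span U(1) order_refl] by blast
  interpret orthonormal_set E by (rule oE)
  define K where "K = (\<Sum>w\<in>U. \<Sum>e\<in>E. \<bar>representation U e w\<bar>)"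
  have EU: "e \<in> span U" if "e \<in> E" for e using that E span_base by blast
  have "\<bar>representation U x w\<bar> \<le> K * norm x" if x: "x \<in> span U" and w: "w \<in> U" for x w
  proof -
    have "x = (\<Sum>e\<in>E. (x \<bullet> e) *\<^sub>R e)" using proj_span[of x] x E by (simp add: orthonormal_proj_def)
    then have "representation U x = representation U (\<Sum>e\<in>E. (x \<bullet> e) *\<^sub>R e)" by simp
    also have "\<dots> = (\<lambda>w. \<Sum>e\<in>E. representation U ((x \<bullet> e) *\<^sub>R e) w)"
      using EU by (intro representation_sum U(2) span_scale)
    also have "\<dots> = (\<lambda>w. \<Sum>e\<in>E. (x \<bullet> e) * representation U e w)"
      using EU by (intro ext sum.cong refl) (simp add: representation_scale U(2))
    finally have "\<bar>representation U x w\<bar> \<le> (\<Sum>e\<in>E. \<bar>(x \<bullet> e) * representation U e w\<bar>)"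
      by (simp only: sum_abs)
    also have "\<dots> \<le> (\<Sum>e\<in>E. norm x * \<bar>representation U e w\<bar>)"
    proof (rule sum_mono)
      fix e assume "e \<in> E"
      then have "\<bar>x \<bullet> e\<bar> \<le> norm x" using Cauchy_Schwarz_ineq2[of x e] unit by simp
      then show "\<bar>(x \<bullet> e) * representation U e w\<bar> \<le> norm x * \<bar>representation U e w\<bar>"
        by (simp add: abs_mult mult_right_mono)
    qed
    also have "\<dots> = (\<Sum>e\<in>E. \<bar>representation U e w\<bar>) * norm x"
      by (simp add: sum_distrib_left mult.commute)
    also have "\<dots> \<le> K * norm x"
      unfolding K_def using U(1) w
      by (intro mult_right_mono member_le_sum[of w U "\<lambda>w. \<Sum>e\<in>E. \<bar>representation U e w\<bar>"]) (auto intro: sum_nonneg)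
    finally show ?thesis .
  qed
  moreover have "K \<ge> 0" unfolding K_def by (intro sum_nonneg) auto
  ultimately show ?thesis by blast
qed

context finite_dimensional_cocycle
begin

text \<open>
  Let \<open>\<langle>b(g), u\<rangle> \<le> 1\<close> for all \<open>g\<close>, and let \<open>U\<close> be a basis of the span of the orbit of \<open>u\<close> consisting of
  elements of the orbit. By the cocycle identity \<open>\<langle>b(g), w\<rangle>\<close> is bounded above for each \<open>w \<in> U\<close>. The point is a
  lower bound; it suffices to find one for the sum \<open>s\<close> of \<open>U\<close>. The identity
  \<open>\<langle>b(h\<^sup>-\<^sup>1), \<sigma>(h\<^sup>-\<^sup>1) s\<rangle> = - \<langle>b(h), s\<rangle>\<close> exchanges upper and lower bounds, at the price of replacing \<open>s\<close> by a
  point of its orbit; by compactness one of finitely many group elements brings that point back near \<open>s\<close>,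
  where it is still a combination of \<open>U\<close> with bounded nonnegative coefficients.
\<close>

lemma split_off_bounded_part:
  assumes "\<not> cobounded"
  shows "\<exists>E. orthonormal_set E \<and> span E \<subseteq> V \<and> span E \<noteq> {0} \<and>
    (\<forall>g\<in>carrier G. \<forall>x\<in>span E. \<sigma> g x \<in> span E) \<and>
    (\<exists>K. \<forall>g\<in>carrier G. norm (orthonormal_proj E (b g)) \<le> K)"
proof -
  obtain u where u: "u \<in> V" "norm u = 1" and half: "\<And>g. g \<in> carrier G \<Longrightarrow> b g \<bullet> u \<le> 1"
    using half_space_of_not_cobounded[OF assms] by blast
  obtain C where C: "finite C" "V \<subseteq> span C" using finite_dim by blast
  define orb where "orb = (\<lambda>g. \<sigma> g u) ` carrier G"
  have orbV: "orb \<subseteq> V" using u invariant by (auto simp: orb_def)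
  obtain U where U: "U \<subseteq> orb" "independent U" "orb \<subseteq> span U"
    using maximal_independent_subset[of orb] by blast
  have "U \<subseteq> span C" using U(1) orbV C(2) by blast
  then have finU: "finite U" using independent_span_bound[OF C(1) U(2)] by blast
  have spU: "span U = span orb" 
    using U(1,3) by (intro subset_antisym span_mono span_minimal subspace_span) auto
  have UV: "span U \<subseteq> V" using U(1) orbV subspace by (intro span_minimal) auto
  obtain E where oE: "orthonormal_set E" and E: "span E = span U"
    using orthonormal_basis_of_subspace[OF subspace_span finU order_refl] by blast
  interpret E: orthonormal_set E by (rule oE)
  have inv: "\<sigma> g x \<in> span U" if g: "g \<in> carrier G" and x: "x \<in> span U" for g x
  proof -
    have "\<sigma> g y \<in> orb" if y: "y \<in> orb" for y
    proof -
      obtain h where "h \<in> carrier G" "y = \<sigma> h u" using y unfolding orb_def by blast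
      then show ?thesis using g unfolding orb_def by (intro image_eqI[of _ _ "g \<otimes> h"]) (simp_all add: mult)
    qed
    then have "\<sigma> g ` orb \<subseteq> orb" by blast
    then have "\<sigma> g ` span orb \<subseteq> span orb"
      using linear_span_image[OF linear[OF g], of orb] span_mono by metis
    then show ?thesis using x spU by auto
  qed
  have "u \<in> orb" unfolding orb_def by (rule image_eqI[of _ _ \<one>]) (simp_all add: one)
  then have uU: "u \<in> span U" using U(3) by blast
  have "\<exists>B\<ge>0. \<forall>w\<in>U. \<forall>h\<in>carrier G. b h \<bullet> w \<le> B"
  proof -
    \<comment> \<open>If \<open>w = \<sigma> x u\<close> then \<open>\<langle>b(h), w\<rangle> = \<langle>b(x\<^sup>-\<^sup>1 h), u\<rangle> - \<langle>b(x\<^sup>-\<^sup>1), u\<rangle>\<close>.\<close>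
    have "\<exists>B. \<forall>h\<in>carrier G. b h \<bullet> w \<le> B" if w: "w \<in> U" for w
    proof -
      obtain x where x: "x \<in> carrier G" "w = \<sigma> x u" using w U(1) by (auto simp: orb_def)
      have "b h \<bullet> w \<le> 1 + norm (b (inv x))" if h: "h \<in> carrier G" for h
      proof -
        have "b h \<bullet> w = \<sigma> (inv x) (b h) \<bullet> u"
          using x adjoint[of "inv x" "b h" u] by simp
        also have "\<dots> = b (inv x \<otimes> h) \<bullet> u - b (inv x) \<bullet> u"
          using x h by (simp add: cocycle inner_add_left)
        also have "\<dots> \<le> 1 + norm (b (inv x))"
          using half[of "inv x \<otimes> h"] Cauchy_Schwarz_ineq2[of "b (inv x)" u] u x h by simp
        finally show ?thesis .
      qed
      then show ?thesis by blast
    qed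
    then have "\<forall>w\<in>U. \<exists>B. \<forall>h\<in>carrier G. b h \<bullet> w \<le> B" by blast
    from bchoice[OF this] obtain B where B: "\<forall>w\<in>U. \<forall>h\<in>carrier G. b h \<bullet> w \<le> B w" by blast
    have "b h \<bullet> w \<le> (\<Sum>w\<in>U. \<bar>B w\<bar>)" if w: "w \<in> U" and h: "h \<in> carrier G" for w h
    proof -
      have "b h \<bullet> w \<le> \<bar>B w\<bar>" using B w h by fastforce
      also have "\<dots> \<le> (\<Sum>w\<in>U. \<bar>B w\<bar>)" using member_le_sum[OF w, of "\<lambda>w. \<bar>B w\<bar>"] finU by simp
      finally show ?thesis .
    qed
    then show ?thesis by (intro exI[of _ "\<Sum>w\<in>U. \<bar>B w\<bar>"]) (auto intro: sum_nonneg)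
  qed
  then obtain B0 where B0: "B0 \<ge> 0" "\<And>w h. w \<in> U \<Longrightarrow> h \<in> carrier G \<Longrightarrow> b h \<bullet> w \<le> B0" by blast
  obtain K where K: "K \<ge> 0" "\<And>w x. w \<in> U \<Longrightarrow> x \<in> span U \<Longrightarrow> \<bar>representation U x w\<bar> \<le> K * norm x"
    using bounded_coordinates[OF finU U(2)] by blast
  have coord: "x = (\<Sum>w\<in>U. representation U x w *\<^sub>R w)" if "x \<in> span U" for x
    using sum_representation_eq[OF U(2) that finU order_refl] by simp
  define s where "s = \<Sum>U"
  have sU: "s \<in> span U" unfolding s_def by (intro span_sum span_base)
  \<comment> \<open>Every element of the orbit of \<open>s\<close> can be moved back close to \<open>s\<close> by one of finitely many group
    elements, and near \<open>s\<close> all coordinates are nonnegative.\<close>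
  obtain N where N: "finite N" "N \<subseteq> carrier G"
    "\<And>g. g \<in> carrier G \<Longrightarrow> \<exists>x\<in>N. \<forall>v\<in>{s}. dist (\<sigma> g v) (\<sigma> x v) < 1 / (K + 1)"
  proof (rule finite_net_of_maps[of "{s}" "V \<inter> cball 0 (norm s)" "carrier G" \<sigma> "1 / (K + 1)"])
    show "\<sigma> g v \<in> V \<inter> cball 0 (norm s)" if "g \<in> carrier G" "v \<in> {s}" for g v
      using that sU UV invariant isometry by auto
  qed (use K compact_ball in auto)
  define D where "D = (\<Sum>x\<in>N. norm (b (inv x)) * norm s) + 2 * real (card U) * B0"
  have lower_s: "- D \<le> b h \<bullet> s" if h: "h \<in> carrier G" for h
  proof -
    obtain x where x: "x \<in> N" and near: "norm (\<sigma> (inv h) s - \<sigma> x s) < 1 / (K + 1)"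
      using N(3)[of "inv h"] h by (auto simp: dist_norm)
    have xG: "x \<in> carrier G" using x N by blast
    define k where "k = inv x \<otimes> inv h"
    have k: "k \<in> carrier G" using xG h by (simp add: k_def)
    define d where "d = \<sigma> k s - s"
    have dU: "d \<in> span U" unfolding d_def by (intro span_diff inv k sU)
    have "norm d = norm (\<sigma> (inv x) (\<sigma> (inv h) s - \<sigma> x s))"
      using xG h by (simp add: d_def k_def mult diff inv_left)
    then have "norm d < 1 / (K + 1)" using near xG by (simp add: isometry)
    then have "(K + 1) * norm d \<le> 1" using K(1) by (simp add: field_simps)
    then have nd: "K * norm d \<le> 1" using norm_ge_zero[of d] unfolding distrib_right by linarith
    let ?c = "\<lambda>w. 1 + representation U d w"
    have c: "0 \<le> ?c w" "?c w \<le> 2" if "w \<in> U" for w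
      using K(2)[OF that dU] nd by (simp_all add: abs_le_iff)
    have "\<sigma> k s = s + d" by (simp add: d_def)
    also have "\<dots> = (\<Sum>w\<in>U. ?c w *\<^sub>R w)"
      using coord[OF dU] by (simp add: s_def scaleR_add_left sum.distrib)
    finally have ks: "\<sigma> k s = (\<Sum>w\<in>U. ?c w *\<^sub>R w)" .
    have "b k \<bullet> \<sigma> k s = (\<Sum>w\<in>U. ?c w * (b k \<bullet> w))" unfolding ks by (simp add: inner_sum_right)
    also have "\<dots> \<le> (\<Sum>w\<in>U. 2 * B0)"
    proof (rule sum_mono)
      fix w assume w: "w \<in> U"
      have "?c w * (b k \<bullet> w) \<le> ?c w * B0" using c[OF w] B0(2)[OF w k] by (intro mult_left_mono)
      also have "\<dots> \<le> 2 * B0" using c[OF w] B0(1) by (intro mult_right_mono)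
      finally show "?c w * (b k \<bullet> w) \<le> 2 * B0" .
    qed
    finally have up: "b k \<bullet> \<sigma> k s \<le> 2 * real (card U) * B0" by simp
    have "b k = \<sigma> (inv x) (b (inv h)) + b (inv x)" using xG h by (simp add: k_def cocycle)
    moreover have "\<sigma> (inv x) (b (inv h)) \<bullet> \<sigma> k s = b (inv h) \<bullet> \<sigma> (inv h) s"
      using xG h by (simp add: k_def mult inner)
    moreover have "b (inv h) \<bullet> \<sigma> (inv h) s = - (b h \<bullet> s)"
      using h adjoint[of h "b (inv h)" s] by (simp add: cocycle_inv)
    ultimately have "- (b h \<bullet> s) + b (inv x) \<bullet> \<sigma> k s \<le> 2 * real (card U) * B0"
      using up by (simp add: inner_add_left)
    moreover have "\<bar>b (inv x) \<bullet> \<sigma> k s\<bar> \<le> norm (b (inv x)) * norm s"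
      using Cauchy_Schwarz_ineq2[of "b (inv x)" "\<sigma> k s"] isometry[OF k] by simp
    moreover have "norm (b (inv x)) * norm s \<le> (\<Sum>x\<in>N. norm (b (inv x)) * norm s)"
      using N(1) x by (intro member_le_sum[of x N "\<lambda>x. norm (b (inv x)) * norm s"]) auto
    ultimately show ?thesis unfolding D_def by linarith
  qed
  define B1 where "B1 = D + real (card U) * B0 + B0"
  have bound: "\<bar>b h \<bullet> w\<bar> \<le> B1" if w: "w \<in> U" and h: "h \<in> carrier G" for w h
  proof -
    have "b h \<bullet> s = b h \<bullet> w + (\<Sum>v\<in>U - {w}. b h \<bullet> v)"
      using sum.remove[OF finU w] by (simp add: s_def inner_sum_right)
    also have "(\<Sum>v\<in>U - {w}. b h \<bullet> v) \<le> (\<Sum>v\<in>U - {w}. B0)" using B0(2) h by (intro sum_mono) auto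
    also have "\<dots> \<le> real (card U) * B0"
      using B0(1) card_mono[OF finU, of "U - {w}"] by (simp add: mult_right_mono)
    finally have "- D \<le> b h \<bullet> w + real (card U) * B0" using lower_s[OF h] by linarith
    moreover have "0 \<le> D + B0" 
      using lower_s[OF h] B0 N by (auto simp: D_def intro!: add_nonneg_nonneg sum_nonneg)
    moreover have "0 \<le> D" using B0 by (auto simp: D_def intro!: add_nonneg_nonneg sum_nonneg)
    moreover have "0 \<le> real (card U) * B0" using B0 by simp
    ultimately show ?thesis using B0(2)[OF w h] B0(1) unfolding B1_def by linarith
  qed
  have bound_E: "\<exists>K. \<forall>h\<in>carrier G. \<bar>b h \<bullet> e\<bar> \<le> K" if e: "e \<in> E" for e
  proof -
    have eU: "e \<in> span U" using e E span_base by blast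
    have "\<bar>b h \<bullet> e\<bar> \<le> (\<Sum>w\<in>U. \<bar>representation U e w\<bar> * B1)" if h: "h \<in> carrier G" for h
    proof -
      have "b h \<bullet> e = (\<Sum>w\<in>U. representation U e w * (b h \<bullet> w))"
        using arg_cong[OF coord[OF eU], of "\<lambda>x. b h \<bullet> x"] by (simp add: inner_sum_right)
      then have "\<bar>b h \<bullet> e\<bar> \<le> (\<Sum>w\<in>U. \<bar>representation U e w * (b h \<bullet> w)\<bar>)" by (simp only: sum_abs)
      also have "\<dots> \<le> (\<Sum>w\<in>U. \<bar>representation U e w\<bar> * B1)"
        using bound h by (intro sum_mono) (simp add: abs_mult mult_left_mono)
      finally show ?thesis .
    qed
    then show ?thesis by blast
  qed
  then have "\<forall>e\<in>E. \<exists>K. \<forall>h\<in>carrier G. \<bar>b h \<bullet> e\<bar> \<le> K" by blast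
  from bchoice[OF this] obtain M where M: "\<forall>e\<in>E. \<forall>h\<in>carrier G. \<bar>b h \<bullet> e\<bar> \<le> M e" by blast
  have "norm (orthonormal_proj E (b g)) \<le> (\<Sum>e\<in>E. M e)" if g: "g \<in> carrier G" for g
    unfolding orthonormal_proj_def using M g E.unit by (intro sum_norm_le) simp
  moreover have "span E \<noteq> {0}" 
  proof
    assume "span E = {0}"
    then have "u = 0" using uU E by blast
    then show False using u(2) by simp
  qed
  ultimately show ?thesis using oE E UV inv by (intro exI[of _ E] conjI) (simp_all, blast)
qed

end

lemma (in linear_isometric_rep) orthonormal_proj_commute:
  assumes E: "orthonormal_set E" and inv: "\<And>g x. g \<in> carrier G \<Longrightarrow> x \<in> span E \<Longrightarrow> \<sigma> g x \<in> span E"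
    and g: "g \<in> carrier G"
  shows "orthonormal_proj E (\<sigma> g x) = \<sigma> g (orthonormal_proj E x)"
proof -
  interpret E: orthonormal_set E by (rule E)
  show ?thesis
  proof (rule E.proj_unique)
    show "\<sigma> g (orthonormal_proj E x) \<in> span E" using inv g E.proj_in_span by blast
    fix e assume "e \<in> E"
    then have "\<sigma> (inv g) e \<in> span E" by (intro inv inv_closed g span_base)
    then show "(\<sigma> g x - \<sigma> g (orthonormal_proj E x)) \<bullet> e = 0"
      using g adjoint[of g "x - orthonormal_proj E x" e] E.proj_orthogonal by (simp add: diff)
  qed
qed

text \<open>
  Induction on the dimension: while the image is not cobounded, project to the orthogonal complement of the
  subrepresentation in which the cocycle is bounded.
\<close>

theorem cobounded_projection:
  fixes G :: "('g, 'm) monoid_scheme" (structure) and \<sigma> :: "'g \<Rightarrow> 'a::real_inner \<Rightarrow> 'a"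
  assumes "finite_dimensional_cocycle G \<sigma> V b"
  shows "\<exists>V' P K. finite_dimensional_cocycle G \<sigma> V' (\<lambda>g. P (b g)) \<and>
    finite_dimensional_cocycle.cobounded G V' (\<lambda>g. P (b g)) \<and>
    linear P \<and> (\<forall>x. norm (P x) \<le> norm x) \<and> (\<forall>g\<in>carrier G. norm (b g - P (b g)) \<le> K)"
proof -
  obtain C where "finite C" "V \<subseteq> span C" using finite_dimensional_cocycle.finite_dim[OF assms] by blast
  then show ?thesis
    using assms
  proof (induction "card C" arbitrary: C V b rule: less_induct)
    case less
    interpret finite_dimensional_cocycle G \<sigma> V b by (rule less.prems)
    show ?case
    proof (cases cobounded)
      case True
      then show ?thesis using less.prems
        by (intro exI[of _ V] exI[of _ "\<lambda>x. x"] exI[of _ 0]) (simp add: linear_ident)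
    next
      case False
      obtain E K where oE: "orthonormal_set E" and E: "span E \<subseteq> V" "span E \<noteq> {0}"
        "\<And>g x. g \<in> carrier G \<Longrightarrow> x \<in> span E \<Longrightarrow> \<sigma> g x \<in> span E"
        and K: "\<And>g. g \<in> carrier G \<Longrightarrow> norm (orthonormal_proj E (b g)) \<le> K"
        using split_off_bounded_part[OF False] by blast
      interpret E: orthonormal_set E by (rule oE)
      define Q where "Q = (\<lambda>x. x - orthonormal_proj E x)"
      define V' where "V' = {x \<in> V. orthonormal_proj E x = 0}"
      note lin = linear_orthonormal_proj[of E]
      have linQ: "linear Q" unfolding Q_def by (intro linear_compose_sub linear_ident lin)
      have com: "orthonormal_proj E (\<sigma> g x) = \<sigma> g (orthonormal_proj E x)" if "g \<in> carrier G" for g x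
        using orthonormal_proj_commute[OF oE E(3) that] by blast
      have QV': "Q x \<in> V'" if "x \<in> V" for x
        using that E.proj_in_span[of x] E(1) E.proj_span[OF E.proj_in_span[of x]] subspace
        by (auto simp: V'_def Q_def linear_diff[OF lin] intro!: subspace_diff)
      have subV': "subspace V'"
        using subspace by (auto simp: V'_def subspace_def linear_0[OF lin] linear_add[OF lin] linear_scale[OF lin])
      have cocyc: "finite_dimensional_cocycle G \<sigma> V' (\<lambda>g. Q (b g))"
      proof
        show "subspace V'" by (rule subV')
        show "\<exists>C. finite C \<and> V' \<subseteq> span C" using less.prems by (auto simp: V'_def)
        show "\<sigma> g x \<in> V'" if "g \<in> carrier G" "x \<in> V'" for g x
          using that by (simp add: V'_def invariant com zero)
        show "Q (b g) \<in> V'" if "g \<in> carrier G" for g using QV' closed[OF that] by blast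
        show "Q (b (g \<otimes> h)) = \<sigma> g (Q (b h)) + Q (b g)" if "g \<in> carrier G" "h \<in> carrier G" for g h
          using that by (simp add: Q_def cocycle linear_add[OF lin] com diff)
      qed
      obtain u where u: "u \<in> span E" "u \<noteq> 0" using E(2) span_0[of E] by blast
      have "u \<notin> V'" using u E.proj_span by (simp add: V'_def)
      moreover have "u \<in> span C" using u E(1) less.prems(2) by blast
      ultimately have uV': "u \<in> span C - V'" by blast
      have "V' \<subseteq> span C" using less.prems(2) by (auto simp: V'_def)
      from orthonormal_basis_of_subspace[OF subV' less.prems(1) this] uV'
      obtain C' where oC': "orthonormal_set C'" and C': "span C' = V'" "card C' < card C" by blast
      have "finite C'" using oC' by (simp add: orthonormal_set_def)
      from less.hyps[OF C'(2) this _ cocyc] C'(1)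
      obtain V'' P K' where IH: "finite_dimensional_cocycle G \<sigma> V'' (\<lambda>g. P (Q (b g)))"
        "finite_dimensional_cocycle.cobounded G V'' (\<lambda>g. P (Q (b g)))"
        "linear P" "\<And>x. norm (P x) \<le> norm x"
        "\<And>g. g \<in> carrier G \<Longrightarrow> norm (Q (b g) - P (Q (b g))) \<le> K'" by blast
      have "norm (b g - P (Q (b g))) \<le> K + K'" if g: "g \<in> carrier G" for g
        using norm_triangle_mono[OF K[OF g] IH(5)[OF g]] by (simp add: Q_def)
      moreover have "linear (\<lambda>x. P (Q x))" using linear_compose[OF linQ IH(3)] by (simp add: o_def)
      moreover have "norm (P (Q x)) \<le> norm x" for x
        using IH(4)[of "Q x"] E.norm_minus_proj[of x] by (simp add: Q_def)
      ultimately show ?thesis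
        using IH(1,2) by (intro exI[of _ V''] exI[of _ "\<lambda>x. P (Q x)"] exI[of _ "K + K'"]) simp
    qed
  qed
qed

section \<open>Groups with finitely many commutators\<close>

context group
begin

lemma group_action_restrictI:
  assumes closed: "\<And>g x. \<lbrakk>g \<in> carrier G; x \<in> E\<rbrakk> \<Longrightarrow> f g x \<in> E"
    and mult: "\<And>g h x. \<lbrakk>g \<in> carrier G; h \<in> carrier G; x \<in> E\<rbrakk> \<Longrightarrow> f (g \<otimes> h) x = f g (f h x)"
    and one: "\<And>x. x \<in> E \<Longrightarrow> f \<one> x = x"
  shows "group_action G E (\<lambda>g. \<lambda>x\<in>E. f g x)"
proof (intro group_action.intro group_hom.intro group_hom_axioms.intro homI is_group group_BijGroup)
  have Bij: "(\<lambda>x\<in>E. f g x) \<in> Bij E" if g: "g \<in> carrier G" for g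
  proof -
    have "f (inv g) (f g x) = x" "f g (f (inv g) x) = x" if "x \<in> E" for x
      using that g by (simp_all add: one flip: mult)
    then have "bij_betw (\<lambda>x\<in>E. f g x) E E"
      by (intro bij_betw_byWitness[where f' = "\<lambda>x\<in>E. f (inv g) x"]) (use g closed in auto)
    then show ?thesis by (simp add: Bij_def)
  qed
  fix g assume g: "g \<in> carrier G"
  show "(\<lambda>x\<in>E. f g x) \<in> carrier (BijGroup E)" using Bij[OF g] by (simp add: BijGroup_def)
  fix h assume h: "h \<in> carrier G"
  show "(\<lambda>x\<in>E. f (g \<otimes> h) x) = (\<lambda>x\<in>E. f g x) \<otimes>\<^bsub>BijGroup E\<^esub> (\<lambda>x\<in>E. f h x)"
    using Bij[OF g] Bij[OF h] g h
    by (auto simp: BijGroup_def compose_def mult closed intro!: restrict_ext)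
qed

text \<open>
  Schreier's argument: the elements \<open>t s t'\<^sup>-\<^sup>1\<close> of \<open>A\<close>, with \<open>t, t'\<close> coset representatives and \<open>s\<close> a generator
  or its inverse, generate \<open>A\<close>, because a word can be rewritten from the left as a product of them and one
  representative.
\<close>

lemma finitely_generated_of_finite_index:
  assumes S: "finite S" "generate G S = carrier G" and A: "subgroup A G"
    and N: "finite N" "N \<subseteq> carrier G" "\<And>x. x \<in> carrier G \<Longrightarrow> \<exists>t\<in>N. x \<otimes> inv t \<in> A"
  shows "\<exists>Y. finite Y \<and> Y \<subseteq> A \<and> generate G Y = A"
proof -
  interpret A: subgroup A G by (rule A)
  define R where "R = insert \<one> N"
  have R: "finite R" "R \<subseteq> carrier G" "\<one> \<in> R" using N(1,2) by (auto simp: R_def)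
  have SG: "S \<subseteq> carrier G" using generate.incl[of _ S G] S(2) by auto
  define S' where "S' = S \<union> m_inv G ` S"
  have S': "finite S'" "S' \<subseteq> carrier G" using S SG by (auto simp: S'_def)
  define Y where "Y = A \<inter> (R \<union> (\<lambda>(t, s, t'). t \<otimes> s \<otimes> inv t') ` (R \<times> S' \<times> R))"
  have Y: "finite Y" "Y \<subseteq> A" using R S' by (auto simp: Y_def)
  then have YG: "Y \<subseteq> carrier G" using A.subset by blast
  interpret Y: subgroup "generate G Y" G by (rule generate_is_subgroup[OF YG])
  have step: "\<exists>y'\<in>generate G Y. \<exists>t'\<in>R. y \<otimes> t \<otimes> s = y' \<otimes> t'"
    if y: "y \<in> generate G Y" and t: "t \<in> R" and s: "s \<in> S'" for y t s
  proof -
    have G: "y \<in> carrier G" "t \<in> carrier G" "s \<in> carrier G" using y t s R S' by auto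
    then obtain t' where t': "t' \<in> N" "t \<otimes> s \<otimes> inv t' \<in> A" using N(3)[of "t \<otimes> s"] by auto
    have t'R: "t' \<in> R" "t' \<in> carrier G" using t' R by (auto simp: R_def)
    have "t \<otimes> s \<otimes> inv t' \<in> Y" using t' t'R t s unfolding Y_def by force
    then have "t \<otimes> s \<otimes> inv t' \<in> generate G Y" by (rule generate.incl)
    then have "y \<otimes> (t \<otimes> s \<otimes> inv t') \<in> generate G Y" using y by simp
    moreover have "y \<otimes> t \<otimes> s = y \<otimes> (t \<otimes> s \<otimes> inv t') \<otimes> t'" using G t'R by (simp add: m_assoc)
    ultimately show ?thesis using t'R by blast
  qed
  have word: "\<forall>y\<in>generate G Y. \<forall>t\<in>R. \<exists>y'\<in>generate G Y. \<exists>t'\<in>R. y \<otimes> t \<otimes> x = y' \<otimes> t'"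
    if "x \<in> generate G S" for x
    using that
  proof induction
    case one
    show ?case
    proof (intro ballI)
      fix y t assume "y \<in> generate G Y" "t \<in> R"
      moreover from this have "y \<otimes> t \<otimes> \<one> = y \<otimes> t" using R by (intro r_one) auto
      ultimately show "\<exists>y'\<in>generate G Y. \<exists>t'\<in>R. y \<otimes> t \<otimes> \<one> = y' \<otimes> t'" by blast
    qed
  next
    case (incl s)
    then show ?case using step by (simp add: S'_def)
  next
    case (inv s)
    then show ?case using step by (simp add: S'_def)
  next
    case (eng x z)
    show ?case
    proof (intro ballI)
      fix y t assume y: "y \<in> generate G Y" and t: "t \<in> R"
      obtain y' t' where y': "y' \<in> generate G Y" "t' \<in> R" "y \<otimes> t \<otimes> x = y' \<otimes> t'"
        using eng.IH(1) y t by blast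
      obtain y'' t'' where y'': "y'' \<in> generate G Y" "t'' \<in> R" "y' \<otimes> t' \<otimes> z = y'' \<otimes> t''"
        using eng.IH(2) y' by blast
      have "x \<in> carrier G" "z \<in> carrier G" using eng.hyps S(2) by auto
      then have "y \<otimes> t \<otimes> (x \<otimes> z) = y'' \<otimes> t''"
        using y t R(2) y'(3) y''(3) by (subst m_assoc[symmetric]) auto
      then show "\<exists>y'\<in>generate G Y. \<exists>t'\<in>R. y \<otimes> t \<otimes> (x \<otimes> z) = y' \<otimes> t'" using y'' by blast
    qed
  qed
  have "A \<subseteq> generate G Y"
  proof
    fix a assume a: "a \<in> A"
    then have aG: "a \<in> carrier G" by simp
    then obtain y t where y: "y \<in> generate G Y" "t \<in> R" "a = y \<otimes> t"
      using word[of a] S(2) R(3) generate.one[of G Y] by fastforce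
    have "y \<in> A" using y(1) generate_subgroup_incl[OF Y(2) A] by blast
    moreover have "t = inv y \<otimes> a" using y R by (simp add: m_assoc[symmetric] subset_iff)
    ultimately have "t \<in> A" using a by simp
    then have "t \<in> generate G Y" using y(2) by (intro generate.incl) (simp add: Y_def)
    then show "a \<in> generate G Y" using y by simp
  qed
  moreover have "generate G Y \<subseteq> A" by (rule generate_subgroup_incl[OF Y(2) A])
  ultimately show ?thesis using Y by blast
qed

text \<open>
  \<open>A\<close> is finitely generated, and each generator has finitely many conjugates under \<open>A\<close>, so its centralizer in
  \<open>A\<close> has finite index. The intersection of these finitely many centralizers is the center of \<open>A\<close>.
\<close>

lemma virtually_abelian_of_finite_commutators:
  assumes S: "finite S" "generate G S = carrier G" and A: "subgroup A G"
    and N: "finite N" "N \<subseteq> carrier G" "\<And>x. x \<in> carrier G \<Longrightarrow> \<exists>t\<in>N. x \<otimes> inv t \<in> A"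
    and F: "finite F" "\<And>x y. x \<in> A \<Longrightarrow> y \<in> A \<Longrightarrow> x \<otimes> y \<otimes> inv x \<otimes> inv y \<in> F"
  shows "virtually_abelian G"
proof -
  interpret A: subgroup A G by (rule A)
  obtain Y where Y: "finite Y" "Y \<subseteq> A" "generate G Y = A"
    using finitely_generated_of_finite_index[OF S A N] by blast
  have centralizer: "subgroup {a \<in> A. \<forall>y\<in>D. a \<otimes> y = y \<otimes> a} G" if D: "D \<subseteq> A" for D
  proof
    show "{a \<in> A. \<forall>y\<in>D. a \<otimes> y = y \<otimes> a} \<subseteq> carrier G" by auto
    show "\<one> \<in> {a \<in> A. \<forall>y\<in>D. a \<otimes> y = y \<otimes> a}" using D by (auto simp: subset_iff)
    fix a assume a: "a \<in> {a \<in> A. \<forall>y\<in>D. a \<otimes> y = y \<otimes> a}"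
    have "inv a \<otimes> y = y \<otimes> inv a" if "y \<in> D" for y
    proof -
      have aG: "a \<in> carrier G" "y \<in> carrier G" using a that D by auto
      have "inv a \<otimes> y = inv a \<otimes> (y \<otimes> a) \<otimes> inv a" using aG by (simp add: m_assoc)
      also have "y \<otimes> a = a \<otimes> y" using a that by simp
      also have "inv a \<otimes> (a \<otimes> y) \<otimes> inv a = y \<otimes> inv a" using aG by (simp add: m_assoc[symmetric])
      finally show ?thesis .
    qed
    then show "inv a \<in> {a \<in> A. \<forall>y\<in>D. a \<otimes> y = y \<otimes> a}" using a by simp
    fix c assume c: "c \<in> {a \<in> A. \<forall>y\<in>D. a \<otimes> y = y \<otimes> a}"
    have "a \<otimes> c \<otimes> y = y \<otimes> (a \<otimes> c)" if "y \<in> D" for y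
    proof -
      have G: "a \<in> carrier G" "c \<in> carrier G" "y \<in> carrier G" using a c that D by auto
      have "a \<otimes> c \<otimes> y = a \<otimes> (y \<otimes> c)" using G c that by (simp add: m_assoc)
      also have "\<dots> = y \<otimes> a \<otimes> c" using G a that by (simp add: m_assoc[symmetric])
      finally show ?thesis using G by (simp add: m_assoc)
    qed
    then show "a \<otimes> c \<in> {a \<in> A. \<forall>y\<in>D. a \<otimes> y = y \<otimes> a}" using a c by simp
  qed
  define Z where "Z = {a \<in> A. \<forall>y\<in>Y. a \<otimes> y = y \<otimes> a}"
  interpret Z: subgroup Z G unfolding Z_def by (rule centralizer[OF Y(2)])
  have central: "a \<otimes> z = z \<otimes> a" if z: "z \<in> Z" and a: "a \<in> A" for a z
  proof -
    have "Y \<subseteq> {a \<in> A. \<forall>y\<in>{z}. a \<otimes> y = y \<otimes> a}" using Y(2) z by (auto simp: Z_def)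
    then have "generate G Y \<subseteq> {a \<in> A. \<forall>y\<in>{z}. a \<otimes> y = y \<otimes> a}"
      using z by (intro generate_subgroup_incl centralizer) (auto simp: Z_def)
    then show ?thesis using a Y(3) by auto
  qed
  have ZG: "group (G\<lparr>carrier := Z\<rparr>)" by (rule Z.subgroup_is_group[OF is_group])
  have comm: "comm_group (G\<lparr>carrier := Z\<rparr>)"
    using central by (intro group.group_comm_groupI[OF ZG]) (auto simp: Z_def)
  \<comment> \<open>The value \<open>\<phi> a\<close> determines the conjugates of all generators by \<open>a\<close>, that is, the coset of \<open>a\<close> modulo
    \<open>Z\<close>.\<close>
  define \<phi> where "\<phi> = (\<lambda>a. \<lambda>y\<in>Y. inv a \<otimes> y \<otimes> a \<otimes> inv y)"
  have "inv a \<otimes> y \<otimes> a \<otimes> inv y \<in> F" if "a \<in> A" "y \<in> Y" for a y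
    using F(2)[of "inv a" y] that Y(2) by auto
  then have "\<phi> ` A \<subseteq> Y \<rightarrow>\<^sub>E F" by (auto simp: \<phi>_def)
  moreover have "finite (Y \<rightarrow>\<^sub>E F)" by (rule finite_PiE) (use Y F in auto)
  ultimately have "finite (\<phi> ` A)" by (rule finite_subset)
  then obtain P where P: "P \<subseteq> A" "finite P" "\<phi> ` A = \<phi> ` P"
    using finite_subset_image[of "\<phi> ` A" \<phi> A] by auto
  have AZ: "\<exists>p\<in>P. a \<otimes> inv p \<in> Z" if a: "a \<in> A" for a
  proof -
    have "\<phi> a \<in> \<phi> ` P" using P(3) a by blast
    then obtain p where p: "p \<in> P" "\<phi> a = \<phi> p" by blast
    then have pA: "p \<in> A" using P by blast
    have "a \<otimes> inv p \<otimes> y = y \<otimes> (a \<otimes> inv p)" if y: "y \<in> Y" for y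
    proof -
      have G: "a \<in> carrier G" "p \<in> carrier G" "y \<in> carrier G" using a pA y Y by auto
      have "inv a \<otimes> y \<otimes> a \<otimes> inv y = inv p \<otimes> y \<otimes> p \<otimes> inv y"
        using fun_cong[OF p(2), of y] y by (simp add: \<phi>_def)
      then have e: "inv a \<otimes> y \<otimes> a = inv p \<otimes> y \<otimes> p" using G by simp
      have "a \<otimes> inv p \<otimes> y = a \<otimes> (inv p \<otimes> y \<otimes> p) \<otimes> inv p" using G by (simp add: m_assoc)
      also have "\<dots> = a \<otimes> (inv a \<otimes> y \<otimes> a) \<otimes> inv p" by (simp only: e)
      also have "\<dots> = y \<otimes> (a \<otimes> inv p)" using G by (simp add: m_assoc[symmetric])
      finally show ?thesis .
    qed
    then show ?thesis using p a pA by (auto simp: Z_def)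
  qed
  have "rcosets Z \<subseteq> (\<lambda>(p, t). Z #> (p \<otimes> t)) ` (P \<times> N)"
  proof
    fix C assume "C \<in> rcosets Z"
    then obtain x where x: "x \<in> carrier G" "C = Z #> x" by (auto simp: RCOSETS_def)
    then obtain t where t: "t \<in> N" "x \<otimes> inv t \<in> A" using N(3) by blast
    obtain p where p: "p \<in> P" "x \<otimes> inv t \<otimes> inv p \<in> Z" using AZ[OF t(2)] by blast
    have G: "t \<in> carrier G" "p \<in> carrier G" using t(1) N(2) p(1) P(1) A.subset by auto
    have "x \<otimes> inv (p \<otimes> t) \<in> Z" using p x G by (simp add: inv_mult_group m_assoc)
    then have "x \<in> Z #> (p \<otimes> t)"
      using x G by (intro subgroup.rcos_module_rev[OF Z.subgroup_axioms is_group]) auto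
    then have "Z #> (p \<otimes> t) = C" unfolding x(2)
      by (rule repr_independence) (use G Z.subgroup_axioms in auto)
    then show "C \<in> (\<lambda>(p, t). Z #> (p \<otimes> t)) ` (P \<times> N)" using p t by force
  qed
  moreover have "finite ((\<lambda>(p, t). Z #> (p \<otimes> t)) ` (P \<times> N))" using P(2) N(1) by auto
  ultimately have "finite (rcosets Z)" by (rule finite_subset)
  then show ?thesis using comm Z.subgroup_axioms unfolding virtually_abelian_def by blast
qed

end

section \<open>Translations in discrete cobounded groups of isometries\<close>

context linear_isometric_rep
begin

text \<open>
  An isometry has no nontrivial Jordan block: \<open>\<sigma> g y - y\<close> is orthogonal to every fixed vector, in particular
  to itself.
\<close>

lemma unipotent_trivial:
  assumes g: "g \<in> carrier G" and fixed: "\<sigma> g (\<sigma> g y - y) = \<sigma> g y - y"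
  shows "\<sigma> g y = y"
proof -
  let ?w = "\<sigma> g y - y"
  have "?w \<bullet> ?w = \<sigma> g ?w \<bullet> \<sigma> g y - ?w \<bullet> y" by (simp only: fixed inner_diff_right)
  also have "\<dots> = 0" using g by (simp only: inner diff_self)
  finally show ?thesis by simp
qed

end

context finite_dimensional_cocycle
begin

definition near_id :: "real \<Rightarrow> 'g \<Rightarrow> bool" where
  "near_id \<epsilon> g \<longleftrightarrow> g \<in> carrier G \<and> (\<forall>v\<in>V. norm (\<sigma> g v - v) \<le> \<epsilon> * norm v)"

definition comm :: "'g \<Rightarrow> 'g \<Rightarrow> 'g" where
  "comm g h = g \<otimes> h \<otimes> inv g \<otimes> inv h"

lemma comm_closed [simp]: "\<lbrakk>g \<in> carrier G; h \<in> carrier G\<rbrakk> \<Longrightarrow> comm g h \<in> carrier G"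
  by (simp add: comm_def)

lemma comm_mult: "\<lbrakk>g \<in> carrier G; h \<in> carrier G\<rbrakk> \<Longrightarrow> comm g h \<otimes> (h \<otimes> g) = g \<otimes> h"
proof -
  assume g: "g \<in> carrier G" and h: "h \<in> carrier G"
  have "comm g h = (g \<otimes> h) \<otimes> inv (h \<otimes> g)" using g h by (simp add: comm_def inv_mult_group m_assoc)
  then show ?thesis using g h m_assoc[of "g \<otimes> h" "inv (h \<otimes> g)" "h \<otimes> g"] by simp
qed

lemma rep_comm:
  assumes "g \<in> carrier G" "h \<in> carrier G"
  shows "\<sigma> (comm g h) (\<sigma> h (\<sigma> g x)) = \<sigma> g (\<sigma> h x)"
  using assms comm_mult[OF assms] mult[of "comm g h" "h \<otimes> g" x] by (simp add: mult)

lemma V_diff: "\<lbrakk>x \<in> V; y \<in> V\<rbrakk> \<Longrightarrow> x - y \<in> V"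
  using subspace by (rule subspace_diff)

text \<open>
  If \<open>A\<close> and \<open>B\<close> are the isometries of \<open>g\<close> and \<open>h\<close>, then \<open>A B - B A = (A - 1)(B - 1) - (B - 1)(A - 1)\<close>.
\<close>

lemma near_id_comm:
  assumes g: "near_id a g" and h: "near_id e h" and pos: "a \<ge> 0" "e \<ge> 0"
  shows "near_id (2 * a * e) (comm g h)"
  unfolding near_id_def
proof (intro conjI ballI)
  have gG: "g \<in> carrier G" and hG: "h \<in> carrier G" using g h by (auto simp: near_id_def)
  then show "comm g h \<in> carrier G" by simp
  fix v assume v: "v \<in> V"
  define x where "x = \<sigma> (inv g) (\<sigma> (inv h) v)"
  have xV: "x \<in> V" using v gG hG by (simp add: x_def invariant)
  have vx: "v = \<sigma> h (\<sigma> g x)" using gG hG by (simp add: x_def inv_right)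
  have nx: "norm x = norm v" using gG hG by (simp add: x_def isometry)
  have "\<sigma> (comm g h) v - v = (\<sigma> g (\<sigma> h x - x) - (\<sigma> h x - x)) - (\<sigma> h (\<sigma> g x - x) - (\<sigma> g x - x))"
    using gG hG by (simp add: vx rep_comm diff)
  also have "norm \<dots> \<le> norm (\<sigma> g (\<sigma> h x - x) - (\<sigma> h x - x)) + norm (\<sigma> h (\<sigma> g x - x) - (\<sigma> g x - x))"
    by (rule norm_triangle_ineq4)
  also have "\<dots> \<le> a * norm (\<sigma> h x - x) + e * norm (\<sigma> g x - x)"
    using g h xV gG hG by (intro add_mono) (auto simp: near_id_def invariant V_diff)
  also have "\<dots> \<le> a * (e * norm x) + e * (a * norm x)"
    using g h xV pos by (intro add_mono mult_left_mono) (auto simp: near_id_def)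
  finally show "norm (\<sigma> (comm g h) v - v) \<le> 2 * a * e * norm v" by (simp add: nx)
qed

lemma cocycle_comm:
  assumes g: "g \<in> carrier G" and h: "h \<in> carrier G"
  shows "b (comm g h) = \<sigma> g (b h) + b g - \<sigma> (comm g h) (\<sigma> h (b g) + b h)"
proof -
  have "b (comm g h \<otimes> (h \<otimes> g)) = b (g \<otimes> h)" using comm_mult[OF g h] by simp
  then show ?thesis using g h by (simp add: cocycle algebra_simps)
qed

lemma norm_cocycle_comm:
  assumes g: "near_id a g" and h: "near_id e h" and c: "near_id d (comm g h)"
  shows "norm (b (comm g h)) \<le> (a + d) * norm (b h) + e * norm (b g)"
proof -
  let ?c = "comm g h"
  have gG: "g \<in> carrier G" and hG: "h \<in> carrier G" using g h by (auto simp: near_id_def)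
  define y where "y = \<sigma> (inv g) (b g)"
  have yV: "y \<in> V" and ny: "norm y = norm (b g)" and gy: "b g = \<sigma> g y"
    using gG by (simp_all add: y_def invariant closed isometry inv_right)
  have "\<sigma> ?c (\<sigma> h (b g)) = \<sigma> g (\<sigma> h y)" using gG hG by (simp add: gy rep_comm)
  then have "b ?c = (\<sigma> g (b h) - b h) - (\<sigma> ?c (b h) - b h) - \<sigma> g (\<sigma> h y - y)"
    using gG hG unfolding cocycle_comm[OF gG hG] by (simp add: add diff gy)
  also have "norm \<dots> \<le> norm (\<sigma> g (b h) - b h) + norm (\<sigma> ?c (b h) - b h) + norm (\<sigma> g (\<sigma> h y - y))"
    by (meson add_mono norm_triangle_ineq4 order_refl order_trans)
  also have "\<dots> \<le> a * norm (b h) + d * norm (b h) + e * norm y"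
    using g h c gG hG yV closed by (intro add_mono) (auto simp: near_id_def isometry)
  finally show ?thesis by (simp add: ny algebra_simps)
qed

text \<open>
  Since \<open>C\<^sup>2 - 1 = (C - 1)(2 + (C - 1))\<close>, as long as powers of \<open>C\<close> stay near the identity each squaring enlarges
  the displacement of a vector by a factor of at least \<open>7/4\<close>.
\<close>

lemma trivial_of_powers_near_id:
  assumes cG: "c \<in> carrier G" and c: "\<And>k::nat. near_id (1/4) (c [^] k)" and v: "v \<in> V"
  shows "\<sigma> c v = v"
proof -
  have double: "(7/4) * norm (\<sigma> (c [^] k) v - v) \<le> norm (\<sigma> (c [^] (k + k)) v - v)" for k :: nat
  proof -
    let ?d = "c [^] k"
    let ?x = "\<sigma> ?d v - v"
    have d: "?d \<in> carrier G" using cG by simp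
    have xV: "?x \<in> V" using d v by (simp add: V_diff invariant)
    have "\<sigma> (c [^] (k + k)) v = \<sigma> ?d (\<sigma> ?d v)" using cG d by (simp add: mult flip: nat_pow_mult)
    then have "\<sigma> (c [^] (k + k)) v - v = 2 *\<^sub>R ?x + (\<sigma> ?d ?x - ?x)"
      using d by (simp add: diff algebra_simps scaleR_2)
    then have "norm (\<sigma> (c [^] (k + k)) v - v) \<ge> 2 * norm ?x - norm (\<sigma> ?d ?x - ?x)"
      using norm_diff_ineq[of "2 *\<^sub>R ?x" "\<sigma> ?d ?x - ?x"] by simp
    moreover have "norm (\<sigma> ?d ?x - ?x) \<le> 1/4 * norm ?x" using c[of k] xV by (simp add: near_id_def)
    ultimately show ?thesis by linarith
  qed
  have growth: "(7/4) ^ j * norm (\<sigma> c v - v) \<le> norm (\<sigma> (c [^] (2 ^ j :: nat)) v - v)" for j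
  proof (induction j)
    case 0
    then show ?case using cG by simp
  next
    case (Suc j)
    have "(7/4) ^ Suc j * norm (\<sigma> c v - v) \<le> 7/4 * norm (\<sigma> (c [^] (2 ^ j :: nat)) v - v)"
      using Suc.IH by (simp add: mult.commute)
    also have "\<dots> \<le> norm (\<sigma> (c [^] (2 ^ j + 2 ^ j :: nat)) v - v)" by (rule double)
    finally show ?case by (simp add: mult_2)
  qed
  have bound: "(7/4) ^ j * norm (\<sigma> c v - v) \<le> 1/4 * norm v" for j
    using growth[of j] c[of "2 ^ j"] v by (fastforce simp: near_id_def)
  show ?thesis
  proof (rule ccontr)
    assume "\<sigma> c v \<noteq> v"
    then have pos: "norm (\<sigma> c v - v) > 0" by simp
    obtain j where "(1/4 * norm v) / norm (\<sigma> c v - v) < (7/4 :: real) ^ j"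
      using real_arch_pow[of "7/4"] by auto
    then show False using bound[of j] pos by (simp add: field_simps)
  qed
qed

text \<open>
  Let \<open>A, B, C\<close> be the isometries of \<open>g\<close>, \<open>h\<close> and their commutator. If \<open>C\<close> commutes with \<open>A\<close>, then
  \<open>C B A = A B\<close> implies \<open>C\<^sup>k B A\<^sup>k = A\<^sup>k B\<close>. So \<open>C\<^sup>k\<close> is within \<open>2 |B - 1|\<close> of the identity for every \<open>k\<close>, which forces
  \<open>C = 1\<close>.
\<close>

lemma comm_trivial_of_commute:
  assumes g: "g \<in> carrier G" and h: "near_id (1/8) h"
    and commute: "\<And>x. x \<in> V \<Longrightarrow> \<sigma> (comm g h) (\<sigma> g x) = \<sigma> g (\<sigma> (comm g h) x)"
    and v: "v \<in> V"
  shows "\<sigma> (comm g h) v = v"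
proof (rule trivial_of_powers_near_id[OF _ _ v])
  show "comm g h \<in> carrier G" using g h by (simp add: near_id_def)
  fix k :: nat
  let ?c = "comm g h"
  have hG: "h \<in> carrier G" using h by (simp add: near_id_def)
  have cG: "?c \<in> carrier G" using g hG by simp
  note G = g hG cG
  have pow_commute: "\<sigma> (?c [^] n) (\<sigma> g x) = \<sigma> g (\<sigma> (?c [^] n) x)" if "x \<in> V" for n :: nat and x
    using that
  proof (induction n arbitrary: x)
    case 0
    then show ?case by (simp add: one)
  next
    case (Suc n)
    then show ?case using G by (simp add: mult commute invariant)
  qed
  have key: "\<sigma> (?c [^] n) (\<sigma> h (\<sigma> (g [^] n) x)) = \<sigma> (g [^] n) (\<sigma> h x)" if "x \<in> V" for n :: nat and x
    using that
  proof (induction n)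
    case 0
    then show ?case by (simp add: one)
  next
    case (Suc n)
    let ?y = "\<sigma> (g [^] n) x"
    have y: "?y \<in> V" using Suc.prems G by (simp add: invariant)
    have gs: "\<sigma> (g [^] Suc n) z = \<sigma> g (\<sigma> (g [^] n) z)" for z
      using G nat_pow_Suc2[of g n] by (simp add: mult del: nat_pow_Suc)
    have "\<sigma> (?c [^] Suc n) (\<sigma> h (\<sigma> (g [^] Suc n) x)) = \<sigma> (?c [^] n) (\<sigma> ?c (\<sigma> h (\<sigma> g ?y)))"
      unfolding gs using G by (simp add: mult)
    also have "\<dots> = \<sigma> g (\<sigma> (?c [^] n) (\<sigma> h ?y))"
      using G y by (simp add: rep_comm pow_commute invariant)
    also have "\<dots> = \<sigma> (g [^] Suc n) (\<sigma> h x)" unfolding gs using Suc by simp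
    finally show ?case .
  qed
  show "near_id (1/4) (?c [^] k)"
    unfolding near_id_def
  proof (intro conjI ballI)
    show "?c [^] k \<in> carrier G" using cG by simp
    fix w assume w: "w \<in> V"
    let ?p = "g [^] k"
    have p: "?p \<in> carrier G" using g by simp
    define x where "x = \<sigma> (inv ?p) (\<sigma> (inv h) w)"
    have xV: "x \<in> V" using w p hG by (simp add: x_def invariant)
    have nx: "norm x = norm w" using p hG by (simp add: x_def isometry)
    have wx: "w = \<sigma> h (\<sigma> ?p x)" using p hG by (simp add: x_def inv_right)
    have "\<sigma> (?c [^] k) w - w = \<sigma> ?p (\<sigma> h x - x) - (\<sigma> h (\<sigma> ?p x) - \<sigma> ?p x)"
      using p key[OF xV, of k] by (simp add: wx diff)
    also have "norm \<dots> \<le> norm (\<sigma> h x - x) + norm (\<sigma> h (\<sigma> ?p x) - \<sigma> ?p x)"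
      using norm_triangle_ineq4[of "\<sigma> ?p (\<sigma> h x - x)"] p by (simp add: isometry)
    also have "\<dots> \<le> 1/8 * norm x + 1/8 * norm (\<sigma> ?p x)"
      using h xV p by (intro add_mono) (auto simp: near_id_def invariant)
    finally show "norm (\<sigma> (?c [^] k) w - w) \<le> 1/4 * norm w" using p by (simp add: isometry nx)
  qed
qed

end

locale discrete_cobounded_cocycle = finite_dimensional_cocycle +
  assumes discrete: "finite {g \<in> carrier G. norm (b g) \<le> R}" and cobdd: cobounded
begin

primrec iter_comm :: "'a \<Rightarrow> 'a \<Rightarrow> nat \<Rightarrow> 'a" where
  "iter_comm g h 0 = h" | "iter_comm g h (Suc k) = comm g (iter_comm g h k)"

lemma near_id_iter_comm:
  assumes g: "near_id (1/8) g" and h: "near_id (1/8) h"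
  shows "near_id (1/8 * (1/4) ^ k) (iter_comm g h k)"
proof (induction k)
  case 0
  then show ?case using h by simp
next
  case (Suc k)
  have "near_id (2 * (1/8) * (1/8 * (1/4) ^ k)) (comm g (iter_comm g h k))"
    by (rule near_id_comm[OF g Suc]) auto
  then show ?case by simp
qed

lemma norm_iter_comm:
  assumes g: "near_id (1/8) g" and h: "near_id (1/8) h"
  defines "D \<equiv> max (norm (b g)) (norm (b h))"
  shows "norm (b (iter_comm g h k)) \<le> D * (1/2) ^ k"
proof (induction k)
  case 0
  then show ?case by (simp add: D_def)
next
  case (Suc k)
  let ?e = "(1/4::real) ^ k"
  have D: "0 \<le> D" "norm (b g) \<le> D" by (auto simp: D_def le_max_iff_disj)
  have e: "0 \<le> ?e" "?e \<le> 1" "?e \<le> (1/2) ^ k" by (auto intro: power_mono power_le_one)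
  have "norm (b (iter_comm g h (Suc k))) \<le> (1/8 + 1/8 * (1/4) ^ Suc k) * norm (b (iter_comm g h k))
      + 1/8 * ?e * norm (b g)"
    unfolding iter_comm.simps
    by (rule norm_cocycle_comm[OF g near_id_iter_comm[OF g h]]) (use near_id_iter_comm[OF g h, of "Suc k"] in simp)
  also have "\<dots> \<le> (1/4) * (D * (1/2) ^ k) + 1/8 * (1/2) ^ k * D"
    using D e Suc.IH by (intro add_mono mult_mono) auto
  also have "\<dots> \<le> D * (1/2) ^ Suc k" using D by simp
  finally show ?case .
qed

text \<open>
  By discreteness only finitely many elements occur, so one of them occurs infinitely often; its rotation and
  translation parts are bounded by a sequence tending to zero.
\<close>

lemma iter_comm_eventually_trivial:
  assumes g: "near_id (1/8) g" and h: "near_id (1/8) h"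
  shows "\<exists>k. (\<forall>v\<in>V. \<sigma> (iter_comm g h k) v = v) \<and> b (iter_comm g h k) = 0"
proof -
  define D where "D = max (norm (b g)) (norm (b h))"
  have D: "0 \<le> D" by (auto simp: D_def le_max_iff_disj)
  let ?I = "iter_comm g h"
  have nb: "norm (b (?I k)) \<le> D * (1/2) ^ k" for k
    unfolding D_def by (rule norm_iter_comm[OF g h])
  have "norm (b (?I k)) \<le> D" for k
    using nb[of k] D mult_left_mono[of "(1/2) ^ k" "1::real" D] power_le_one[of "1/2::real" k] by linarith
  then have "range ?I \<subseteq> {g \<in> carrier G. norm (b g) \<le> D}"
    using near_id_iter_comm[OF g h] by (auto simp: near_id_def)
  then have "finite (range ?I)" using discrete finite_subset by blast
  then obtain k0 where inf: "infinite {k \<in> UNIV. ?I k = ?I k0}"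
    using pigeonhole_infinite[of "UNIV :: nat set" ?I] by auto
  let ?x = "?I k0"
  have zero: "a \<le> 0" if a: "\<And>k. ?I k = ?x \<Longrightarrow> a \<le> C * (1/2) ^ k" and C: "C \<ge> 0" for a C :: real
  proof -
    have "a \<le> C * (1/2) ^ n" for n :: nat
    proof -
      obtain k where k: "k \<ge> n" "?I k = ?x"
        using inf unfolding infinite_nat_iff_unbounded_le by auto
      have "a \<le> C * (1/2) ^ k" using a k by blast
      also have "\<dots> \<le> C * (1/2) ^ n" using C k by (intro mult_left_mono power_decreasing) auto
      finally show ?thesis .
    qed
    moreover have "(\<lambda>n. C * (1/2) ^ n) \<longlonglongrightarrow> C * 0" by (intro tendsto_intros) auto
    ultimately show ?thesis by (intro LIMSEQ_le_const[of _ "0::real" a]) auto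
  qed
  have "norm (b ?x) \<le> 0" by (rule zero[OF _ D]) (use nb in metis)
  moreover have "\<sigma> ?x v = v" if v: "v \<in> V" for v
  proof -
    have "norm (\<sigma> ?x v - v) \<le> 0"
    proof (rule zero)
      fix k assume k: "?I k = ?x"
      have "norm (\<sigma> ?x v - v) \<le> 1/8 * (1/4) ^ k * norm v"
        using near_id_iter_comm[OF g h, of k] v unfolding near_id_def k by blast
      also have "\<dots> \<le> 1 * (1/2) ^ k * norm v" by (intro mult_right_mono mult_mono power_mono) auto
      finally show "norm (\<sigma> ?x v - v) \<le> norm v * (1/2) ^ k" by (simp add: mult.commute)
    qed simp
    then show ?thesis by simp
  qed
  ultimately show ?thesis by (intro exI[of _ k0]) auto
qed

text \<open>
  Let \<open>h\<^sub>1 = [g, h]\<close> and \<open>h\<^sub>k\<^sub>+\<^sub>1 = [g, h\<^sub>k]\<close>. Some \<open>h\<^sub>k\<close> acts trivially. Going down from there,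
  \<open>comm_trivial_of_commute\<close> shows that all \<open>h\<^sub>k\<close> with \<open>k \<ge> 1\<close> are translations. Then \<open>b(h\<^sub>k\<^sub>+\<^sub>1) = A b(h\<^sub>k)\<close> with
  \<open>A = \<sigma>(g) - 1\<close>, and going down once more with \<open>unipotent_trivial\<close> gives \<open>A b(h\<^sub>1) = 0\<close>. Finally
  \<open>b(h\<^sub>1) = A b(h) - (\<sigma>(h) - 1) b(g)\<close>, so that \<open>A\<^sup>2 b(h) = A (\<sigma>(h) - 1) b(g)\<close> is bounded independently of \<open>h\<close>.
\<close>

lemma double_displacement_bound:
  assumes g: "near_id (1/8) g" and h: "near_id (1/8) h"
  defines "A \<equiv> \<lambda>x. \<sigma> g x - x"
  shows "norm (A (A (b h))) \<le> 4 * norm (b g)"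
proof -
  have gG: "g \<in> carrier G" and hG: "h \<in> carrier G" using g h by (auto simp: near_id_def)
  let ?I = "iter_comm g h"
  have near: "near_id (1/8) (?I k)" for k
  proof -
    have "1/8 * (1/4::real) ^ k \<le> 1/8" by (simp add: power_le_one)
    then show ?thesis using near_id_iter_comm[OF g h, of k] unfolding near_id_def
      by (meson mult_right_mono norm_ge_zero order_trans)
  qed
  have IG: "?I k \<in> carrier G" for k using near[of k] by (simp add: near_id_def)
  obtain n where n: "\<forall>v\<in>V. \<sigma> (?I n) v = v" "b (?I n) = 0"
    using iter_comm_eventually_trivial[OF g h] by blast
  define triv where "triv = (\<lambda>k. \<forall>v\<in>V. \<sigma> (?I k) v = v)"
  have up: "triv (Suc k)" if t: "triv k" for k
    unfolding triv_def
  proof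
    fix v assume v: "v \<in> V"
    define x where "x = \<sigma> (inv g) (\<sigma> (inv (?I k)) v)"
    have "x \<in> V" "v = \<sigma> (?I k) (\<sigma> g x)" using v gG IG by (simp_all add: x_def invariant inv_right)
    moreover have "\<sigma> (comm g (?I k)) (\<sigma> (?I k) (\<sigma> g x)) = \<sigma> g (\<sigma> (?I k) x)"
      by (rule rep_comm[OF gG IG])
    ultimately show "\<sigma> (?I (Suc k)) v = v" using t gG by (simp add: triv_def invariant)
  qed
  have down: "triv (Suc k)" if "triv (Suc (Suc k))" for k
  proof -
    let ?c = "comm g (?I k)"
    have "\<sigma> ?c (\<sigma> g x) = \<sigma> g (\<sigma> ?c x)" if x: "x \<in> V" for x
    proof -
      have "\<sigma> ?c (\<sigma> g x) \<in> V" using x gG IG by (simp add: invariant)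
      then show ?thesis
        using \<open>triv (Suc (Suc k))\<close> rep_comm[OF gG IG[of "Suc k"], of x] by (simp add: triv_def)
    qed
    then have "\<sigma> ?c v = v" if "v \<in> V" for v
      using comm_trivial_of_commute[OF gG near[of k] _ that] by blast
    then show ?thesis by (simp add: triv_def)
  qed
  have down_b: "b (?I (Suc (Suc k))) = A (b (?I (Suc k)))" if "triv (Suc k)" for k
  proof -
    have "triv (Suc (Suc k))" using up that by blast
    moreover have "\<sigma> (?I (Suc k)) (b g) + b (?I (Suc k)) \<in> V"
      using gG IG subspace by (intro subspace_add invariant closed)
    ultimately show ?thesis
      using that gG cocycle_comm[OF gG IG[of "Suc k"]] closed by (simp add: triv_def A_def)
  qed
  have "triv (Suc n)" using n up unfolding triv_def by blast
  then have t1: "triv (Suc 0)"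
  proof (induction n)
    case (Suc m)
    then show ?case using down by blast
  qed
  then have t: "triv (Suc k)" for k using up by (induction k) auto
  have "b (?I (Suc (Suc n))) = 0"
  proof -
    have c: "\<sigma> (?I (Suc n)) (b g) = b g" using t closed gG by (simp add: triv_def)
    have "\<sigma> (comm g (?I n)) (\<sigma> (?I n) (b g) + b (?I n)) = b g"
      using n c closed gG by simp
    then have "b (?I (Suc n)) = 0" using cocycle_comm[OF gG IG[of n]] n gG by (simp add: zero)
    then show ?thesis using down_b[OF t[of n]] gG by (simp add: A_def zero)
  qed
  then have b2: "b (?I (Suc (Suc 0))) = 0"
  proof (induction n)
    case (Suc m)
    let ?y = "b (?I (Suc m))"
    have "\<sigma> g (\<sigma> g ?y - ?y) = \<sigma> g ?y - ?y"
      using Suc.prems down_b[OF t[of m]] down_b[OF t[of "Suc m"]] by (simp add: A_def)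
    then have "\<sigma> g ?y = ?y" by (rule unipotent_trivial[OF gG])
    then show ?case using Suc.IH down_b[OF t[of m]] by (simp add: A_def)
  qed
  have c1: "\<sigma> (comm g h) v = v" if "v \<in> V" for v using t1 that by (simp add: triv_def)
  have "\<sigma> h (b g) + b h \<in> V" using gG hG subspace by (intro subspace_add invariant closed)
  then have "b (comm g h) = A (b h) - (\<sigma> h (b g) - b g)"
    using cocycle_comm[OF gG hG] c1 by (simp add: A_def)
  moreover have "A (b (comm g h)) = 0" using b2 down_b[OF t1] by simp
  moreover have "A (x - y) = A x - A y" for x y using gG by (simp add: A_def diff)
  ultimately have "A (A (b h)) = A (\<sigma> h (b g) - b g)" by (metis eq_iff_diff_eq_0)
  also have "norm \<dots> \<le> 2 * norm (\<sigma> h (b g) - b g)"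
    unfolding A_def using norm_triangle_ineq4[of "\<sigma> g (\<sigma> h (b g) - b g)" "\<sigma> h (b g) - b g"] gG by (simp add: isometry)
  also have "\<dots> \<le> 2 * (2 * norm (b g))"
    using norm_triangle_ineq4[of "\<sigma> h (b g)" "b g"] hG by (simp add: isometry)
  finally show ?thesis by simp
qed

text \<open>
  The isometries of the group are controlled by their values on an orthonormal basis, which lie in a compact
  set.
\<close>

lemma finite_net_near_id:
  assumes "\<epsilon> > 0"
  obtains N where "finite N" "N \<subseteq> carrier G" "\<And>x. x \<in> carrier G \<Longrightarrow> \<exists>n\<in>N. near_id \<epsilon> (x \<otimes> inv n)"
proof -
  obtain C where C: "finite C" "V \<subseteq> span C" using finite_dim by blast
  obtain B where oB: "orthonormal_set B" and B: "span B = V"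
    using orthonormal_basis_of_subspace[OF subspace C] by blast
  interpret B: orthonormal_set B by (rule oB)
  let ?\<delta> = "\<epsilon> / (real (card B) + 1)"
  have \<delta>: "?\<delta> > 0" using assms by (simp add: add_nonneg_pos)
  have BV: "e \<in> V" if "e \<in> B" for e using that B span_base by blast
  obtain N where N: "finite N" "N \<subseteq> carrier G"
    "\<And>g. g \<in> carrier G \<Longrightarrow> \<exists>x\<in>N. \<forall>v\<in>B. dist (\<sigma> g v) (\<sigma> x v) < ?\<delta>"
  proof (rule finite_net_of_maps[of B "V \<inter> cball 0 1" "carrier G" \<sigma> ?\<delta>])
    show "\<sigma> g v \<in> V \<inter> cball 0 1" if "g \<in> carrier G" "v \<in> B" for g v
      using that BV B.unit by (simp add: invariant isometry)
  qed (use B.finite_B compact_ball \<delta> in auto)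
  have "\<exists>n\<in>N. near_id \<epsilon> (x \<otimes> inv n)" if x: "x \<in> carrier G" for x
  proof -
    obtain n where n: "n \<in> N" "\<forall>v\<in>B. dist (\<sigma> x v) (\<sigma> n v) < ?\<delta>" using N(3)[OF x] by blast
    have nG: "n \<in> carrier G" using n N by blast
    have "norm (\<sigma> (x \<otimes> inv n) v - v) \<le> \<epsilon> * norm v" if v: "v \<in> V" for v
    proof -
      define w where "w = \<sigma> (inv n) v"
      have wV: "w \<in> span B" using v nG B by (simp add: w_def invariant)
      have nw: "norm w = norm v" using nG by (simp add: w_def isometry)
      have "w = (\<Sum>e\<in>B. (w \<bullet> e) *\<^sub>R e)" using B.proj_span[OF wV] by (simp add: orthonormal_proj_def)
      then have e: "\<sigma> g w = (\<Sum>e\<in>B. (w \<bullet> e) *\<^sub>R \<sigma> g e)" if "g \<in> carrier G" for g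
        using linear_sum[OF linear[OF that], of "\<lambda>e. (w \<bullet> e) *\<^sub>R e" B] that by (simp add: scale)
      have "\<sigma> (x \<otimes> inv n) v - v = \<sigma> x w - \<sigma> n w" using x nG by (simp add: w_def mult inv_right)
      also have "\<dots> = (\<Sum>e\<in>B. (w \<bullet> e) *\<^sub>R (\<sigma> x e - \<sigma> n e))"
        using x nG by (simp add: e scaleR_diff_right sum_subtractf)
      also have "norm \<dots> \<le> (\<Sum>e\<in>B. norm w * ?\<delta>)"
      proof (rule sum_norm_le)
        fix e assume eB: "e \<in> B"
        have "\<bar>w \<bullet> e\<bar> \<le> norm w" using Cauchy_Schwarz_ineq2[of w e] B.unit[OF eB] by simp
        moreover have "norm (\<sigma> x e - \<sigma> n e) \<le> ?\<delta>" using n(2) eB by (auto simp: dist_norm less_imp_le)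
        ultimately show "norm ((w \<bullet> e) *\<^sub>R (\<sigma> x e - \<sigma> n e)) \<le> norm w * ?\<delta>"
          unfolding norm_scaleR by (intro mult_mono) auto
      qed
      also have "\<dots> = norm w * (\<epsilon> * (real (card B) / (real (card B) + 1)))" by simp
      also have "\<dots> \<le> norm w * (\<epsilon> * 1)"
        using assms by (intro mult_left_mono) auto
      finally show ?thesis by (simp add: nw mult.commute)
    qed
    then show ?thesis using n x nG by (intro bexI[of _ n]) (auto simp: near_id_def)
  qed
  then show thesis using that N by blast
qed

text \<open>
  With \<open>A = \<sigma>(g) - 1\<close>, the previous lemma bounds \<open>A\<^sup>2\<close> on the vectors \<open>b(h)\<close> with \<open>h\<close> near the identity. Every
  vector of \<open>V\<close> is within bounded distance of such a vector, because \<open>b\<close> is cobounded and finitely many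
  translates of the elements near the identity cover the group. A linear map that is bounded on all of \<open>V\<close> is
  zero, so \<open>A\<^sup>2 = 0\<close> and \<open>A = 0\<close>.
\<close>

theorem near_id_trivial:
  assumes g: "near_id (1/8) g" and v: "v \<in> V"
  shows "\<sigma> g v = v"
proof -
  define A where "A = (\<lambda>x. \<sigma> g x - x)"
  have gG: "g \<in> carrier G" using g by (simp add: near_id_def)
  have nA: "norm (A x) \<le> 2 * norm x" for x
    unfolding A_def using norm_triangle_ineq4[of "\<sigma> g x" x] gG by (simp add: isometry)
  have A_diff: "A (x - y) = A x - A y" and A_scale: "A (t *\<^sub>R x) = t *\<^sub>R A x" for x y t
    using gG by (simp_all add: A_def diff scale scaleR_diff_right)
  obtain N where N: "finite N" "N \<subseteq> carrier G"
    "\<And>x. x \<in> carrier G \<Longrightarrow> \<exists>n\<in>N. near_id (1/8) (x \<otimes> inv n)"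
    using finite_net_near_id[of "1/8"] by auto
  obtain R where R: "\<And>x. x \<in> V \<Longrightarrow> \<exists>h\<in>carrier G. norm (x - b h) \<le> R"
    using cobdd unfolding cobounded_def by blast
  define R' where "R' = (\<Sum>n\<in>N. norm (b (inv n)))"
  have bound: "norm (A (A y)) \<le> 4 * norm (b g) + 4 * (R + R')" if y: "y \<in> V" for y
  proof -
    obtain x where x: "x \<in> carrier G" "norm (y - b x) \<le> R" using R[OF y] by blast
    obtain n where n: "n \<in> N" "near_id (1/8) (x \<otimes> inv n)" using N(3)[OF x(1)] by blast
    have nG: "n \<in> carrier G" using n N by blast
    let ?h = "x \<otimes> inv n"
    have "norm (b (inv n)) \<le> R'" unfolding R'_def
      using N n by (intro member_le_sum[of n N "\<lambda>n. norm (b (inv n))"]) auto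
    moreover
    have "y - b ?h = (y - b x) - \<sigma> x (b (inv n))" using x nG by (simp add: cocycle)
    then have "norm (y - b ?h) \<le> norm (y - b x) + norm (b (inv n))"
      using x norm_triangle_ineq4[of "y - b x" "\<sigma> x (b (inv n))"] by (simp only: isometry)
    ultimately have d: "norm (y - b ?h) \<le> R + R'" using x(2) by linarith
    have "norm (A (A (y - b ?h))) \<le> 4 * norm (y - b ?h)"
      using nA[of "A (y - b ?h)"] nA[of "y - b ?h"] by simp
    moreover have "norm (A (A (b ?h))) \<le> 4 * norm (b g)"
      unfolding A_def by (rule double_displacement_bound[OF g n(2)])
    moreover have "A (A y) = A (A (b ?h)) + A (A (y - b ?h))" by (simp add: A_diff)
    ultimately show ?thesis using d norm_triangle_ineq[of "A (A (b ?h))" "A (A (y - b ?h))"] by simp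
  qed
  have "A (A v) = 0"
  proof (rule ccontr)
    assume "A (A v) \<noteq> 0"
    then have pos: "norm (A (A v)) > 0" by simp
    let ?M = "4 * norm (b g) + 4 * (R + R')"
    obtain t :: nat where t: "?M < real t * norm (A (A v))" using reals_Archimedean3[OF pos] by blast
    have "real t *\<^sub>R v \<in> V" using v subspace by (simp add: subspace_scale)
    then have "real t * norm (A (A v)) \<le> ?M" using bound[of "real t *\<^sub>R v"] by (simp add: A_scale)
    then show False using t by simp
  qed
  then show ?thesis using unipotent_trivial[OF gG, of v] by (simp add: A_def)
qed

text \<open>
  The elements with trivial rotation part form a subgroup of finite index, on which \<open>b\<close> is additive and hence
  vanishes on commutators; only finitely many elements have \<open>b = 0\<close>.
\<close>

theorem virtually_abelian:
  assumes S: "finite S" "generate G S = carrier G"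
  shows "virtually_abelian G"
proof -
  define A where "A = {g \<in> carrier G. \<forall>v\<in>V. \<sigma> g v = v}"
  have A: "subgroup A G"
  proof
    show "\<one> \<in> A" by (simp add: A_def one)
    show "x \<otimes> y \<in> A" if "x \<in> A" "y \<in> A" for x y using that by (simp add: A_def mult)
    show "inv x \<in> A" if "x \<in> A" for x using that inv_left[of x] by (auto simp: A_def) (metis)
  qed (auto simp: A_def)
  obtain N where N: "finite N" "N \<subseteq> carrier G"
    "\<And>x. x \<in> carrier G \<Longrightarrow> \<exists>n\<in>N. near_id (1/8) (x \<otimes> inv n)"
    using finite_net_near_id[of "1/8"] by auto
  have NA: "\<exists>n\<in>N. x \<otimes> inv n \<in> A" if "x \<in> carrier G" for x
    using N(3)[OF that] near_id_trivial unfolding A_def near_id_def by blast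
  have comm: "comm x y \<in> {g \<in> carrier G. norm (b g) \<le> 0}" if "x \<in> A" "y \<in> A" for x y
  proof -
    have G: "x \<in> carrier G" "y \<in> carrier G" using that by (auto simp: A_def)
    have cA: "comm x y \<in> A"
      unfolding comm_def using that A by (intro subgroup.m_closed[OF A] subgroup.m_inv_closed[OF A])
    have "b x + b y \<in> V" using G closed subspace by (simp add: subspace_add)
    then have "b (comm x y) = 0"
      using cocycle_comm[OF G] that cA closed G by (simp add: A_def add)
    then show ?thesis using G by simp
  qed
  show ?thesis
    by (rule virtually_abelian_of_finite_commutators[OF S A N(1,2) NA discrete[of 0]])
      (use comm in \<open>simp_all add: comm_def\<close>)
qed

end

section \<open>Complex Hilbert spaces on a carrier set\<close>

lemma cring_scalar_field: "K = \<real> \<or> K = UNIV \<Longrightarrow> cring (scalar_field K)"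
proof (rule cringI)
  assume K: "K = \<real> \<or> K = UNIV"
  show "abelian_group (scalar_field K)"
  proof (rule abelian_groupI)
    show "\<exists>y\<in>carrier (scalar_field K). y \<oplus>\<^bsub>scalar_field K\<^esub> x = \<zero>\<^bsub>scalar_field K\<^esub>"
      if "x \<in> carrier (scalar_field K)" for x
      using that K by (intro bexI[of _ "- x"]) auto
  qed (use K in \<open>auto simp: algebra_simps\<close>)
  show "comm_monoid (scalar_field K)" using K by (intro comm_monoidI) (auto simp: algebra_simps)
qed (auto simp: algebra_simps)

context inner_product_space
begin

lemma ip_self_zero: "\<lbrakk>x \<in> carrier H; ip H x x = 0\<rbrakk> \<Longrightarrow> x = \<zero>\<^bsub>H\<^esub>"
  using ip_pos[of x] by fastforce

text \<open>
  Testing against all vectors reduces identities between vectors to complex arithmetic.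
\<close>

lemma eq_by_ip:
  assumes x: "x \<in> carrier H" and y: "y \<in> carrier H"
    and "\<And>z. z \<in> carrier H \<Longrightarrow> ip H x z = ip H y z"
  shows "x = y"
proof -
  have "ip H (x \<ominus>\<^bsub>H\<^esub> y) (x \<ominus>\<^bsub>H\<^esub> y) = 0" using assms by (simp add: ip_diff_left)
  then show ?thesis using ip_self_zero[of "x \<ominus>\<^bsub>H\<^esub> y"] x y diff_eq_zero by simp
qed

end

locale complex_hilbert = hilbert_space UNIV H for H :: "'v inner_module" (structure)
begin

lemma smult_in [simp]: "x \<in> carrier H \<Longrightarrow> a \<odot> x \<in> carrier H"
  using smult_closed[of a x] by simp

lemmas ip_simps = ip_add_left ip_add_right ip_diff_left ip_diff_right
  ip_smult_left[OF UNIV_I] ip_smult_right[OF UNIV_I]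

lemma ip_zero_right [simp]: "x \<in> carrier H \<Longrightarrow> ip H x \<zero> = 0"
  using ip_commute[of "\<zero>" x] by simp

lemma ip_self: "x \<in> carrier H \<Longrightarrow> ip H x x = of_real ((hnorm H x)\<^sup>2)"
  using ip_commute[of x x] by (simp add: hnorm_sq complex_eq_iff)

lemma hdist_eq: "\<lbrakk>x \<in> carrier H; y \<in> carrier H\<rbrakk> \<Longrightarrow> hdist H x y = hnorm H (x \<ominus> y)"
  by (simp add: hdist_def)

lemma hnorm_zero [simp]: "hnorm H \<zero> = 0"
  by (simp add: hnorm_eq_0)

lemma hnorm_smult: "x \<in> carrier H \<Longrightarrow> hnorm H (a \<odot> x) = cmod a * hnorm H x"
proof -
  assume x: "x \<in> carrier H"
  have "ip H (a \<odot> x) (a \<odot> x) = (a * cnj a) * ip H x x"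
    using x by (simp add: ip_smult_left[OF UNIV_I] ip_smult_right[OF UNIV_I])
  then have "(complex_of_real (hnorm H (a \<odot> x)))\<^sup>2 = (of_real (cmod a * hnorm H x))\<^sup>2"
    using x by (simp add: ip_self power_mult_distrib flip: complex_norm_square)
  then have "(hnorm H (a \<odot> x))\<^sup>2 = (cmod a * hnorm H x)\<^sup>2"
    by (simp only: of_real_power[symmetric] of_real_eq_iff)
  then show ?thesis
    by (rule power2_eq_imp_eq) (use x in \<open>simp_all add: hnorm_nonneg\<close>)
qed

subsection \<open>Subspaces and orthonormal bases\<close>

definition linear_subspace :: "'v set \<Rightarrow> bool" where
  "linear_subspace V \<longleftrightarrow> V \<subseteq> carrier H \<and> \<zero> \<in> V \<and> (\<forall>x\<in>V. \<forall>y\<in>V. x \<oplus> y \<in> V) \<and>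
     (\<forall>a. \<forall>x\<in>V. a \<odot> x \<in> V)"

lemma linear_subspaceD:
  assumes "linear_subspace V"
  shows "V \<subseteq> carrier H" "\<zero> \<in> V" "x \<in> V \<Longrightarrow> x \<in> carrier H"
    "\<lbrakk>x \<in> V; y \<in> V\<rbrakk> \<Longrightarrow> x \<oplus> y \<in> V" "x \<in> V \<Longrightarrow> a \<odot> x \<in> V"
  using assms by (auto simp: linear_subspace_def)

lemma linear_subspace_diff:
  assumes V: "linear_subspace V" and x: "x \<in> V" and y: "y \<in> V"
  shows "x \<ominus> y \<in> V"
proof -
  note D = linear_subspaceD[OF V]
  have "x \<ominus> y = x \<oplus> (-1) \<odot> y"
    using D(3)[OF x] D(3)[OF y] minus_eq_smult[of y] by (simp add: a_minus_def)
  then show ?thesis using D(4)[OF x D(5)[OF y]] by simp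
qed

text \<open>
  Closure under the operations replaces finite sums in the definition of the linear span.
\<close>

inductive_set hspan :: "'v set \<Rightarrow> 'v set" for B where
  zero: "\<zero> \<in> hspan B"
| base: "x \<in> B \<Longrightarrow> x \<in> hspan B"
| add: "\<lbrakk>x \<in> hspan B; y \<in> hspan B\<rbrakk> \<Longrightarrow> x \<oplus> y \<in> hspan B"
| smult: "x \<in> hspan B \<Longrightarrow> a \<odot> x \<in> hspan B"

lemma hspan_least: "\<lbrakk>linear_subspace V; B \<subseteq> V\<rbrakk> \<Longrightarrow> hspan B \<subseteq> V"
proof
  fix x assume V: "linear_subspace V" "B \<subseteq> V" and "x \<in> hspan B"
  from this(3) show "x \<in> V"
    by induction (use V(2) linear_subspaceD[OF V(1)] in auto)
qed

lemma linear_subspace_carrier: "linear_subspace (carrier H)"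
  by (simp add: linear_subspace_def)

lemma linear_subspace_hspan: "B \<subseteq> carrier H \<Longrightarrow> linear_subspace (hspan B)"
  using hspan_least[OF linear_subspace_carrier, of B]
  by (simp add: linear_subspace_def hspan.intros)

lemma hspan_mono: "\<lbrakk>B \<subseteq> C; C \<subseteq> carrier H\<rbrakk> \<Longrightarrow> hspan B \<subseteq> hspan C"
  by (rule hspan_least[OF linear_subspace_hspan]) (auto intro: hspan.base)

lemma hspan_insert:
  assumes x: "x \<in> carrier H" and B: "B \<subseteq> carrier H" and y: "y \<in> hspan (insert x B)"
  shows "\<exists>z\<in>hspan B. \<exists>a. y = z \<oplus> a \<odot> x"
proof -
  note D = linear_subspaceD[OF linear_subspace_hspan[OF B]]
  let ?V = "{z \<oplus> a \<odot> x |z a. z \<in> hspan B}"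
  have "linear_subspace ?V"
    unfolding linear_subspace_def
  proof (intro conjI ballI allI)
    show "?V \<subseteq> carrier H" using D(3) x by auto
    have "\<zero> = \<zero> \<oplus> 0 \<odot> x" using x by (intro eq_by_ip) (auto simp: ip_simps)
    then show "\<zero> \<in> ?V" using D(2) by blast
    fix u assume "u \<in> ?V"
    then obtain z a where u: "u = z \<oplus> a \<odot> x" "z \<in> hspan B" by blast
    then have zH: "z \<in> carrier H" using D(3) by blast
    have "c \<odot> u = c \<odot> z \<oplus> (c * a) \<odot> x" for c
      unfolding u using zH x by (intro eq_by_ip) (auto simp: ip_simps algebra_simps)
    then show "c \<odot> u \<in> ?V" for c using D(5)[OF u(2)] by blast
    fix w assume "w \<in> ?V"
    then obtain z' a' where w: "w = z' \<oplus> a' \<odot> x" "z' \<in> hspan B" by blast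
    then have zH': "z' \<in> carrier H" using D(3) by blast
    have "u \<oplus> w = (z \<oplus> z') \<oplus> (a + a') \<odot> x"
      unfolding u w using zH zH' x by (intro eq_by_ip) (auto simp: ip_simps algebra_simps)
    then show "u \<oplus> w \<in> ?V" using D(4)[OF u(2) w(2)] by blast
  qed
  moreover have "insert x B \<subseteq> ?V"
  proof -
    have "x = \<zero> \<oplus> 1 \<odot> x" using x by (intro eq_by_ip) (auto simp: ip_simps)
    moreover have "y = y \<oplus> 0 \<odot> x" if "y \<in> B" for y
      using x B that by (intro eq_by_ip) (auto simp: ip_simps)
    ultimately show ?thesis using D(2) hspan.base by blast
  qed
  ultimately have "hspan (insert x B) \<subseteq> ?V" by (rule hspan_least)
  then show ?thesis using y by blast
qed

text \<open>
  An orthonormal family is a basis of a finite-dimensional space if it is maximal; in this form no linear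
  combination has to be exhibited.
\<close>

definition orthonormal_basis :: "nat \<Rightarrow> (nat \<Rightarrow> 'v) \<Rightarrow> 'v set \<Rightarrow> bool" where
  "orthonormal_basis n e V \<longleftrightarrow> (\<forall>i<n. e i \<in> V) \<and>
     (\<forall>i<n. \<forall>j<n. ip H (e i) (e j) = (if i = j then 1 else 0)) \<and>
     (\<forall>x\<in>V. (\<forall>i<n. ip H x (e i) = 0) \<longrightarrow> x = \<zero>)"

primrec lincomb :: "(nat \<Rightarrow> 'v) \<Rightarrow> (nat \<Rightarrow> complex) \<Rightarrow> nat \<Rightarrow> 'v" where
  "lincomb e c 0 = \<zero>"
| "lincomb e c (Suc n) = lincomb e c n \<oplus> c n \<odot> e n"

lemma lincomb_in:
  assumes V: "linear_subspace V"
  shows "(\<And>i. i < n \<Longrightarrow> e i \<in> V) \<Longrightarrow> lincomb e c n \<in> V"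
  by (induction n) (use linear_subspaceD[OF V] in auto)

lemma ip_lincomb:
  assumes "z \<in> carrier H"
  shows "(\<And>i. i < n \<Longrightarrow> e i \<in> carrier H) \<Longrightarrow> ip H (lincomb e c n) z = (\<Sum>i<n. c i * ip H (e i) z)"
proof (induction n)
  case 0
  then show ?case using assms by simp
next
  case (Suc n)
  then show ?case
    using assms lincomb_in[OF linear_subspace_carrier, of n e c] by (simp add: ip_simps)
qed

text \<open>
  One step of the Gram-Schmidt process for each element of \<open>B\<close>.
\<close>

lemma orthonormal_basis_exists:
  assumes "finite B" "B \<subseteq> carrier H"
  shows "\<exists>n e. orthonormal_basis n e (hspan B)"
  using assms
proof (induction B)
  case empty
  have "hspan {} \<subseteq> {\<zero>}" by (rule hspan_least) (auto simp: linear_subspace_def smult_r_null[simplified])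
  then show ?case by (intro exI[of _ 0]) (auto simp: orthonormal_basis_def)
next
  case (insert x B)
  then obtain n e where e: "orthonormal_basis n e (hspan B)" by auto
  have BH: "B \<subseteq> carrier H" and xH: "x \<in> carrier H" using insert by auto
  note D = linear_subspaceD[OF linear_subspace_hspan[OF BH]]
  note D' = linear_subspaceD[OF linear_subspace_hspan[OF insert.prems]]
  have sub: "hspan B \<subseteq> hspan (insert x B)" using insert.prems by (intro hspan_mono) auto
  have eH: "e i \<in> carrier H" if "i < n" for i using e D(3) that by (simp add: orthonormal_basis_def)
  have eB: "e i \<in> hspan B" if "i < n" for i using e that by (simp add: orthonormal_basis_def)
  have orth: "ip H (e i) (e j) = (if i = j then 1 else 0)" if "i < n" "j < n" for i j
    using e that by (simp add: orthonormal_basis_def)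
  define p where "p = lincomb e (\<lambda>i. ip H x (e i)) n"
  have pB: "p \<in> hspan B" unfolding p_def by (rule lincomb_in[OF linear_subspace_hspan[OF BH] eB])
  then have pH: "p \<in> carrier H" by (rule D)
  have pe: "ip H p (e j) = ip H x (e j)" if "j < n" for j
  proof -
    have "ip H p (e j) = (\<Sum>i<n. ip H x (e i) * ip H (e i) (e j))"
      unfolding p_def by (rule ip_lincomb) (use eH that in auto)
    also have "\<dots> = (\<Sum>i<n. if i = j then ip H x (e j) else 0)"
      using that orth by (intro sum.cong) auto
    finally show ?thesis using that by simp
  qed
  define r where "r = x \<ominus> p"
  have rH: "r \<in> carrier H" using xH pH by (simp add: r_def)
  have re: "ip H r (e i) = 0" if "i < n" for i using that pe xH pH eH by (simp add: r_def ip_simps)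
  have xr: "x = p \<oplus> r" using xH pH by (intro eq_by_ip) (auto simp: r_def ip_simps)
  have rB: "r \<in> hspan (insert x B)"
    unfolding r_def
    by (rule linear_subspace_diff[OF linear_subspace_hspan[OF insert.prems]]) (use pB sub in \<open>auto intro: hspan.base\<close>)
  have decomp: "\<exists>z\<in>hspan B. \<exists>a. y = z \<oplus> a \<odot> r" if y: "y \<in> hspan (insert x B)" for y
  proof -
    obtain z a where z: "z \<in> hspan B" "y = z \<oplus> a \<odot> x" using hspan_insert[OF xH BH y] by blast
    have "y = (z \<oplus> a \<odot> p) \<oplus> a \<odot> r"
      unfolding z(2) using D(3)[OF z(1)] pH rH xH
      by (intro eq_by_ip) (auto simp: r_def ip_simps algebra_simps)
    then show ?thesis using D(4)[OF z(1) D(5)[OF pB]] by blast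
  qed
  show ?case
  proof (cases "r = \<zero>")
    case True
    have "hspan (insert x B) \<subseteq> hspan B"
    proof
      fix y assume "y \<in> hspan (insert x B)"
      then obtain z a where "z \<in> hspan B" "y = z \<oplus> a \<odot> \<zero>" using decomp True by blast
      then show "y \<in> hspan B" using D(2,4,5) by simp
    qed
    then show ?thesis using e sub by (metis subset_antisym)
  next
    case False
    define s where "s = of_real (1 / hnorm H r) \<odot> r"
    have nr: "hnorm H r > 0" using False rH hnorm_eq_0 hnorm_nonneg by fastforce
    have sH: "s \<in> carrier H" using rH by (simp add: s_def)
    have ss: "ip H s s = 1" using rH nr by (simp add: s_def ip_simps ip_self[OF rH] power2_eq_square)
    have sB: "s \<in> hspan (insert x B)" unfolding s_def by (rule D'(5)[OF rB])
    have se: "ip H s (e i) = 0" if "i < n" for i using that re rH eH by (simp add: s_def ip_simps)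
    have es: "ip H (e i) s = 0" if "i < n" for i using se[OF that] ip_commute[OF sH eH[OF that]] by simp
    have "orthonormal_basis (Suc n) (e(n := s)) (hspan (insert x B))"
      unfolding orthonormal_basis_def
    proof (intro conjI allI impI ballI)
      show "(e(n := s)) i \<in> hspan (insert x B)" if "i < Suc n" for i
        using that eB sub sB by (auto simp: less_Suc_eq)
      show "ip H ((e(n := s)) i) ((e(n := s)) j) = (if i = j then 1 else 0)"
        if "i < Suc n" "j < Suc n" for i j
        using that orth se es ss by (auto simp: less_Suc_eq)
      fix y assume y: "y \<in> hspan (insert x B)" and 0: "\<forall>i<Suc n. ip H y ((e(n := s)) i) = 0"
      then have ye: "ip H y (e i) = 0" if "i < n" for i using that by (metis fun_upd_other less_Suc_eq less_irrefl)
      have ys: "ip H y s = 0" using 0 by (metis fun_upd_same lessI)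
      obtain z a where z: "z \<in> hspan B" "y = z \<oplus> a \<odot> r" using decomp[OF y] by blast
      have zH: "z \<in> carrier H" using z D by blast
      have "ip H z (e i) = 0" if "i < n" for i
        using ye[OF that] that zH rH eH re by (simp add: z(2) ip_simps)
      then have z0: "z = \<zero>" using e z(1) by (simp add: orthonormal_basis_def)
      have "ip H y r = 0" using ys nr rH D'(3)[OF y] by (simp add: s_def ip_simps)
      then have "a * ip H r r = 0" using rH by (simp add: z(2) z0 ip_simps)
      then have "a = 0" using ip_self_zero[OF rH] False by auto
      then show "y = \<zero>" using z0 rH z(2) by (intro eq_by_ip) (auto simp: ip_simps)
    qed
    then show ?thesis by blast
  qed
qed

lemma lincomb_basis:
  assumes V: "linear_subspace V" and e: "orthonormal_basis n e V"
  shows "j < n \<Longrightarrow> ip H (lincomb e c n) (e j) = c j"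
    and "x \<in> V \<Longrightarrow> lincomb e (\<lambda>i. ip H x (e i)) n = x"
proof -
  have eV: "e i \<in> V" "e i \<in> carrier H" if "i < n" for i
    using e V that by (auto simp: orthonormal_basis_def linear_subspace_def)
  have coord: "ip H (lincomb e c n) (e j) = c j" if "j < n" for c j
  proof -
    have "ip H (lincomb e c n) (e j) = (\<Sum>i<n. c i * ip H (e i) (e j))"
      by (rule ip_lincomb) (use eV that in auto)
    also have "\<dots> = (\<Sum>i<n. if i = j then c j else 0)"
      using that e by (intro sum.cong) (auto simp: orthonormal_basis_def)
    finally show ?thesis using that by simp
  qed
  show "j < n \<Longrightarrow> ip H (lincomb e c n) (e j) = c j" by (rule coord)
  assume x: "x \<in> V"
  let ?y = "lincomb e (\<lambda>i. ip H x (e i)) n"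
  have y: "?y \<in> V" by (rule lincomb_in[OF V eV(1)])
  have H: "x \<in> carrier H" "?y \<in> carrier H" using x y V linear_subspaceD by auto
  have "x \<ominus> ?y = \<zero>"
    using e linear_subspace_diff[OF V x y] H eV coord by (simp add: orthonormal_basis_def ip_simps)
  then show "?y = x" using H diff_eq_zero by auto
qed

subsection \<open>Orthogonal projections\<close>

definition projectable :: "'v set \<Rightarrow> bool" where
  "projectable V \<longleftrightarrow> linear_subspace V \<and> (\<forall>x\<in>carrier H. \<exists>p\<in>V. \<forall>v\<in>V. ip H (x \<ominus> p) v = 0)"

definition hproj :: "'v set \<Rightarrow> 'v \<Rightarrow> 'v" where
  "hproj V x = (SOME p. p \<in> V \<and> (\<forall>v\<in>V. ip H (x \<ominus> p) v = 0))"

lemma projectable_hspan: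
  assumes B: "finite B" "B \<subseteq> carrier H"
  shows "projectable (hspan B)"
  unfolding projectable_def
proof (intro conjI ballI)
  show V: "linear_subspace (hspan B)" by (rule linear_subspace_hspan[OF B(2)])
  note D = linear_subspaceD[OF V]
  obtain n e where e: "orthonormal_basis n e (hspan B)" using orthonormal_basis_exists[OF B] by blast
  have eV: "e i \<in> hspan B" "e i \<in> carrier H" if "i < n" for i
    using e D(3) that by (auto simp: orthonormal_basis_def)
  fix x assume x: "x \<in> carrier H"
  let ?p = "lincomb e (\<lambda>i. ip H x (e i)) n"
  have p: "?p \<in> hspan B" by (rule lincomb_in[OF V eV(1)])
  let ?r = "x \<ominus> ?p"
  have r: "?r \<in> carrier H" using x D(3)[OF p] by simp
  have re: "ip H (e i) ?r = 0" if "i < n" for i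
    using that lincomb_basis(1)[OF V e that] x D(3)[OF p] eV ip_commute[of ?r "e i"] by (simp add: ip_simps)
  have "ip H ?r v = 0" if v: "v \<in> hspan B" for v
  proof -
    have "ip H v ?r = (\<Sum>i<n. ip H v (e i) * ip H (e i) ?r)"
      using ip_lincomb[OF r, of n e "\<lambda>i. ip H v (e i)"] eV lincomb_basis(2)[OF V e v] by simp
    then show ?thesis using re r D(3)[OF v] ip_commute[of v ?r] by simp
  qed
  then show "\<exists>p\<in>hspan B. \<forall>v\<in>hspan B. ip H (x \<ominus> p) v = 0" using p by blast
qed

context
  fixes V assumes V: "projectable V"
begin

lemma hproj_closed: "linear_subspace V" using V by (simp add: projectable_def)

lemma hproj: 
  assumes "x \<in> carrier H"
  shows "hproj V x \<in> V" and "\<And>v. v \<in> V \<Longrightarrow> ip H (x \<ominus> hproj V x) v = 0"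
proof -
  have "\<exists>p. p \<in> V \<and> (\<forall>v\<in>V. ip H (x \<ominus> p) v = 0)" using V assms by (auto simp: projectable_def)
  from someI_ex[OF this] show "hproj V x \<in> V" "\<And>v. v \<in> V \<Longrightarrow> ip H (x \<ominus> hproj V x) v = 0"
    by (auto simp: hproj_def)
qed

lemma hproj_carrier [simp]: "x \<in> carrier H \<Longrightarrow> hproj V x \<in> carrier H"
  using hproj(1) linear_subspaceD(3)[OF hproj_closed] by blast

lemma hproj_unique:
  assumes x: "x \<in> carrier H" and p: "p \<in> V" "\<And>v. v \<in> V \<Longrightarrow> ip H (x \<ominus> p) v = 0"
  shows "hproj V x = p"
proof -
  let ?q = "hproj V x" and ?d = "p \<ominus> hproj V x"
  have pH: "p \<in> carrier H" using p linear_subspaceD(3)[OF hproj_closed] by blast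
  have d: "?d \<in> V" using hproj(1)[OF x] p linear_subspace_diff[OF hproj_closed] by blast
  have "ip H ?d ?d = ip H (x \<ominus> ?q) ?d - ip H (x \<ominus> p) ?d"
    using x pH by (simp add: ip_simps)
  then have "ip H ?d ?d = 0" using hproj(2)[OF x d] p(2)[OF d] by simp
  then show ?thesis using ip_self_zero[of ?d] pH x diff_eq_zero by auto
qed

lemma hproj_add:
  assumes x: "x \<in> carrier H" and y: "y \<in> carrier H"
  shows "hproj V (x \<oplus> y) = hproj V x \<oplus> hproj V y"
proof (rule hproj_unique)
  show "hproj V x \<oplus> hproj V y \<in> V" using hproj(1) x y linear_subspaceD(4)[OF hproj_closed] by blast
  fix v assume v: "v \<in> V"
  then have "v \<in> carrier H" using linear_subspaceD(3)[OF hproj_closed] by blast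
  then show "ip H (x \<oplus> y \<ominus> (hproj V x \<oplus> hproj V y)) v = 0"
    using hproj(2)[OF x v] hproj(2)[OF y v] x y by (simp add: ip_simps)
qed (use x y in simp)

lemma hproj_pythagoras:
  assumes x: "x \<in> carrier H" and v: "v \<in> V"
  shows "(hnorm H (x \<ominus> v))\<^sup>2 = (hnorm H (x \<ominus> hproj V x))\<^sup>2 + (hnorm H (hproj V x \<ominus> v))\<^sup>2"
proof -
  let ?r = "x \<ominus> hproj V x" and ?d = "hproj V x \<ominus> v"
  have vH: "v \<in> carrier H" using v linear_subspaceD(3)[OF hproj_closed] by blast
  have r: "?r \<in> carrier H" and d: "?d \<in> carrier H" using x vH by simp_all
  have dV: "?d \<in> V" using hproj(1)[OF x] v linear_subspace_diff[OF hproj_closed] by blast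
  have o: "ip H ?r ?d = 0" using hproj(2)[OF x dV] .
  then have o': "ip H ?d ?r = 0" using ip_commute[OF r d] by simp
  have "x \<ominus> v = ?r \<oplus> ?d" using x vH by (intro eq_by_ip) (auto simp: ip_simps)
  then show ?thesis using r d o o' by (simp add: hnorm_sq ip_add_left ip_add_right)
qed

lemma hproj_best:
  assumes x: "x \<in> carrier H" and v: "v \<in> V"
  shows "hnorm H (x \<ominus> hproj V x) \<le> hnorm H (x \<ominus> v)"
proof (rule power2_le_imp_le)
  show "(hnorm H (x \<ominus> hproj V x))\<^sup>2 \<le> (hnorm H (x \<ominus> v))\<^sup>2"
    using hproj_pythagoras[OF assms] by simp
qed (use x v linear_subspaceD(3)[OF hproj_closed v] in \<open>simp add: hnorm_nonneg\<close>)

lemma hproj_norm: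
  assumes x: "x \<in> carrier H"
  shows "hnorm H (hproj V x) \<le> hnorm H x"
proof (rule power2_le_imp_le)
  have "y \<ominus> \<zero> = y" if "y \<in> carrier H" for y
    using that by (intro eq_by_ip) (auto simp: ip_simps)
  then show "(hnorm H (hproj V x))\<^sup>2 \<le> (hnorm H x)\<^sup>2"
    using hproj_pythagoras[OF x linear_subspaceD(2)[OF hproj_closed]] x by simp
qed (use x in \<open>simp add: hnorm_nonneg\<close>)

lemma hproj_diff:
  assumes x: "x \<in> carrier H" and y: "y \<in> carrier H"
  shows "hproj V (x \<ominus> y) = hproj V x \<ominus> hproj V y"
proof -
  have "x = (x \<ominus> y) \<oplus> y" using x y by (intro eq_by_ip) (auto simp: ip_simps)
  then have "hproj V x = hproj V (x \<ominus> y) \<oplus> hproj V y"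
    using hproj_add[of "x \<ominus> y" y] x y by simp
  then show ?thesis using x y by (intro eq_by_ip) (auto simp: ip_simps)
qed

lemma hproj_contraction:
  "\<lbrakk>x \<in> carrier H; y \<in> carrier H\<rbrakk> \<Longrightarrow> hdist H (hproj V x) (hproj V y) \<le> hdist H x y"
  using hproj_norm[of "x \<ominus> y"] by (simp add: hdist_eq hproj_diff)

end

lemma hproj_hproj:
  assumes V: "projectable V" and W: "projectable W" "W \<subseteq> V" and x: "x \<in> carrier H"
  shows "hproj W (hproj V x) = hproj W x"
proof (rule hproj_unique[OF W(1)])
  show "hproj V x \<in> carrier H" "hproj W x \<in> W" using hproj_carrier[OF V x] hproj(1)[OF W(1) x] by auto
  fix v assume v: "v \<in> W"
  then have "v \<in> carrier H" using linear_subspaceD(3)[OF hproj_closed[OF W(1)]] by blast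
  then show "ip H (hproj V x \<ominus> hproj W x) v = 0"
    using hproj(2)[OF W(1) x v] hproj(2)[OF V x, of v] v W(2) x hproj_carrier[OF V x] hproj_carrier[OF W(1) x]
    by (auto simp: ip_simps)
qed

subsection \<open>Closed subspaces\<close>

definition closed_linear_subspace :: "'v set \<Rightarrow> bool" where
  "closed_linear_subspace V \<longleftrightarrow> linear_subspace V \<and>
     (\<forall>s x. range s \<subseteq> V \<and> limitin (htop H) s x sequentially \<longrightarrow> x \<in> V)"

text \<open>
  The classical projection theorem: by the parallelogram law a sequence in \<open>V\<close> minimizing the distance to \<open>x\<close>
  is a Cauchy sequence, and its limit is the nearest point.
\<close>

lemma projectable_closed:
  assumes "closed_linear_subspace V"
  shows "projectable V"
proof -
  have V: "linear_subspace V" using assms by (simp add: closed_linear_subspace_def)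
  note D = linear_subspaceD[OF V]
  have "\<exists>p\<in>V. \<forall>v\<in>V. ip H (x \<ominus> p) v = 0" if x: "x \<in> carrier H" for x
  proof -
    let ?f = "\<lambda>v. (hnorm H (x \<ominus> v))\<^sup>2"
    define \<delta> where "\<delta> = (INF v\<in>V. ?f v)"
    have bdd: "bdd_below (?f ` V)" by (rule bdd_belowI[of _ 0]) auto
    have ne: "?f ` V \<noteq> {}" using D(2) by blast
    have \<delta>: "\<delta> \<le> ?f v" if "v \<in> V" for v unfolding \<delta>_def by (rule cINF_lower[OF bdd that])
    have "\<exists>v\<in>V. ?f v < \<delta> + inverse (real (Suc n))" for n
      using cInf_lessD[OF ne, of "\<delta> + inverse (real (Suc n))"] unfolding \<delta>_def by auto
    then have "\<forall>n. \<exists>v. v \<in> V \<and> ?f v < \<delta> + inverse (real (Suc n))" by blast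
    from choice[OF this] obtain s where s: "\<And>n. s n \<in> V" "\<And>n. ?f (s n) < \<delta> + inverse (real (Suc n))" by blast
    have sH: "s n \<in> carrier H" for n using s D(3) by blast
    \<comment> \<open>The parallelogram law for \<open>x - s m\<close> and \<open>x - s n\<close>, whose midpoint is \<open>x\<close> minus an element of \<open>V\<close>.\<close>
    have gap: "(hdist H (s m) (s n))\<^sup>2 \<le> 2 * inverse (real (Suc m)) + 2 * inverse (real (Suc n))" for m n
    proof -
      let ?h = "(1/2) \<odot> (s m \<oplus> s n)"
      have h: "?h \<in> V" using D(4,5) s(1) by blast
      have "(hdist H (s m) (s n))\<^sup>2 = 2 * ?f (s m) + 2 * ?f (s n) - 4 * ?f ?h"
        using sH x by (simp add: hdist_eq hnorm_sq ip_simps algebra_simps)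
      also have "\<dots> \<le> 2 * ?f (s m) + 2 * ?f (s n) - 4 * \<delta>" using \<delta>[OF h] by simp
      finally show ?thesis using s(2)[of m] s(2)[of n] by linarith
    qed
    have "Metric.MCauchy s"
      unfolding Metric.MCauchy_def
    proof (intro conjI allI impI)
      show "range s \<subseteq> carrier H" using sH by blast
      fix \<epsilon> :: real assume e: "\<epsilon> > 0"
      then obtain N where N: "inverse (real (Suc N)) < \<epsilon>\<^sup>2 / 4" using reals_Archimedean[of "\<epsilon>\<^sup>2 / 4"] by auto
      have "hdist H (s m) (s n) < \<epsilon>" if "N \<le> m" "N \<le> n" for m n
      proof -
        have "inverse (real (Suc m)) \<le> inverse (real (Suc N))" "inverse (real (Suc n)) \<le> inverse (real (Suc N))"
          using that by (intro le_imp_inverse_le; simp)+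
        then have "(hdist H (s m) (s n))\<^sup>2 < \<epsilon>\<^sup>2" using gap[of m n] N by linarith
        then show ?thesis using e by (simp add: power_less_imp_less_base)
      qed
      then show "\<exists>N. \<forall>n n'. N \<le> n \<longrightarrow> N \<le> n' \<longrightarrow> hdist H (s n) (s n') < \<epsilon>" by blast
    qed
    then obtain p where p: "limitin Metric.mtopology s p sequentially"
      using complete unfolding Metric.mcomplete_def by blast
    then have pV: "p \<in> V"
      using assms s(1) by (auto simp: closed_linear_subspace_def htop_eq image_subset_iff)
    have pH: "p \<in> carrier H" by (rule D(3)[OF pV])
    have "?f p \<le> \<delta>"
    proof -
      have "hnorm H (x \<ominus> p) \<le> sqrt \<delta> + \<epsilon>" if e: "\<epsilon> > 0" for \<epsilon>
      proof -
        have \<delta>0: "\<delta> \<ge> 0" unfolding \<delta>_def by (rule cINF_greatest) (use D(2) in auto)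
        obtain N where N: "\<And>n. n \<ge> N \<Longrightarrow> hdist H (s n) p < \<epsilon> / 2"
          using p e unfolding Metric.limit_metric_sequentially by (meson half_gt_zero)
        obtain M where M: "inverse (real (Suc M)) < (\<epsilon> / 2)\<^sup>2" using e reals_Archimedean[of "(\<epsilon>/2)\<^sup>2"] by auto
        let ?n = "max N M"
        have "inverse (real (Suc ?n)) \<le> inverse (real (Suc M))" by (intro le_imp_inverse_le) auto
        then have "?f (s ?n) \<le> \<delta> + (\<epsilon> / 2)\<^sup>2" using s(2)[of ?n] M by linarith
        also have "\<dots> \<le> (sqrt \<delta> + \<epsilon> / 2)\<^sup>2" using \<delta>0 e by (simp add: power2_sum)
        finally have "hnorm H (x \<ominus> s ?n) \<le> sqrt \<delta> + \<epsilon> / 2"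
          by (rule power2_le_imp_le) (use e \<delta>0 in simp)
        moreover have "hdist H x p \<le> hdist H x (s ?n) + hdist H (s ?n) p"
          using x sH pH by (intro Metric.triangle) auto
        ultimately show ?thesis using N[of ?n] x sH pH by (simp add: hdist_eq)
      qed
      then have "hnorm H (x \<ominus> p) \<le> sqrt \<delta>" by (rule field_le_epsilon)
      moreover have "\<delta> \<ge> 0" unfolding \<delta>_def by (rule cINF_greatest) (use D(2) in auto)
      ultimately show ?thesis
        using hnorm_nonneg[of "x \<ominus> p"] x pH power_mono[of "hnorm H (x \<ominus> p)" "sqrt \<delta>" 2] by simp
    qed
    then have min: "?f p \<le> ?f v" if "v \<in> V" for v using \<delta>[OF that] by linarith
    \<comment> \<open>If the real part did not vanish, moving \<open>p\<close> slightly in the direction of \<open>v\<close> would bring it closer to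
      \<open>x\<close>. The imaginary part is the real part for \<open>\<i> v\<close>.\<close>
    have Re0: "Re (ip H (x \<ominus> p) v) = 0" if v: "v \<in> V" for v
    proof -
      let ?a = "Re (ip H (x \<ominus> p) v)" and ?c = "Re (ip H v v)"
      have vH: "v \<in> carrier H" by (rule D(3)[OF v])
      have quad: "0 \<le> t\<^sup>2 * ?c - 2 * t * ?a" for t :: real
      proof -
        let ?w = "p \<oplus> of_real t \<odot> v"
        have "?f ?w = ?f p - 2 * t * ?a + t\<^sup>2 * ?c"
          using x pH vH ip_commute[of x v] ip_commute[of p v]
          by (simp add: hnorm_sq ip_simps power2_eq_square[of t] algebra_simps)
        then show ?thesis using min[OF D(4)[OF pV D(5)[OF v]], of "of_real t"] by linarith
      qed
      show ?thesis
      proof (rule ccontr)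
        assume nz: "?a \<noteq> 0"
        have c: "0 \<le> ?c" using ip_nonneg[OF vH] .
        define t where "t = ?a / (?c + 1)"
        have a: "?a = t * (?c + 1)" using c by (simp add: t_def)
        have "t \<noteq> 0" using nz a by auto
        then have "0 < t\<^sup>2 * (?c + 2)" using c by simp
        also have "t\<^sup>2 * (?c + 2) = - (t\<^sup>2 * ?c - 2 * t * ?a)" unfolding a
          by (simp add: power2_eq_square algebra_simps)
        also have "\<dots> \<le> 0" using quad[of t] by simp
        finally show False by simp
      qed
    qed
    have "ip H (x \<ominus> p) v = 0" if v: "v \<in> V" for v
      using Re0[OF v] Re0[OF D(5)[OF v], of \<i>] x pH D(3)[OF v]
      by (simp add: complex_eq_iff ip_smult_right[OF UNIV_I])
    then show ?thesis using pV by blast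
  qed
  then show ?thesis using V by (simp add: projectable_def)
qed

definition hclosure :: "'v set \<Rightarrow> 'v set" where
  "hclosure U = {x \<in> carrier H. \<forall>\<epsilon>>0. \<exists>u\<in>U. hdist H x u < \<epsilon>}"

lemma hclosureD: "\<lbrakk>x \<in> hclosure U; \<epsilon> > 0\<rbrakk> \<Longrightarrow> \<exists>u\<in>U. hdist H x u < \<epsilon>"
  by (simp add: hclosure_def)

lemma closed_hclosure:
  assumes U: "linear_subspace U"
  shows "closed_linear_subspace (hclosure U)"
  unfolding closed_linear_subspace_def
proof (intro conjI allI impI)
  note D = linear_subspaceD[OF U]
  show "linear_subspace (hclosure U)"
    unfolding linear_subspace_def
  proof (intro conjI ballI allI)
    show "hclosure U \<subseteq> carrier H" by (auto simp: hclosure_def)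
    have "hdist H \<zero> \<zero> = 0" by simp
    then show "\<zero> \<in> hclosure U" using D(2) unfolding hclosure_def by force
    fix x assume x: "x \<in> hclosure U"
    then have xH: "x \<in> carrier H" by (simp add: hclosure_def)
    show "a \<odot> x \<in> hclosure U" for a
      unfolding hclosure_def
    proof (intro CollectI conjI allI impI)
      fix \<epsilon> :: real assume e: "\<epsilon> > 0"
      then have "\<epsilon> / (cmod a + 1) > 0" by (simp add: add_nonneg_pos)
      then obtain u where u: "u \<in> U" "hdist H x u < \<epsilon> / (cmod a + 1)" using x unfolding hclosure_def by blast
      have uH: "u \<in> carrier H" using u D by blast
      have "a \<odot> x \<ominus> a \<odot> u = a \<odot> (x \<ominus> u)"
        using xH uH by (intro eq_by_ip) (auto simp: ip_simps algebra_simps)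
      then have "hdist H (a \<odot> x) (a \<odot> u) = cmod a * hdist H x u"
        using xH uH by (simp add: hdist_eq hnorm_smult)
      also have "\<dots> \<le> (cmod a + 1) * hdist H x u" by (intro mult_right_mono) auto
      also have "\<dots> < \<epsilon>"
      proof -
        have "cmod a + 1 > 0" by (simp add: add_nonneg_pos)
        then show ?thesis using u(2) by (simp only: pos_less_divide_eq mult.commute)
      qed
      finally show "\<exists>v\<in>U. hdist H (a \<odot> x) v < \<epsilon>" using D(5)[OF u(1)] by blast
    qed (use xH in simp)
    fix y assume y: "y \<in> hclosure U"
    then have yH: "y \<in> carrier H" by (simp add: hclosure_def)
    show "x \<oplus> y \<in> hclosure U"
      unfolding hclosure_def
    proof (intro CollectI conjI allI impI)
      fix \<epsilon> :: real assume e: "\<epsilon> > 0"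
      obtain u where u: "u \<in> U" "hdist H x u < \<epsilon> / 2" using hclosureD[OF x, of "\<epsilon> / 2"] e by auto
      obtain v where v: "v \<in> U" "hdist H y v < \<epsilon> / 2" using hclosureD[OF y, of "\<epsilon> / 2"] e by auto
      have "hdist H (x \<oplus> y) (u \<oplus> v) \<le> hdist H x u + hdist H y v"
        using xH yH D(3)[OF u(1)] D(3)[OF v(1)] by (rule hdist_add)
      also have "\<dots> < \<epsilon>" using u v by simp
      finally show "\<exists>w\<in>U. hdist H (x \<oplus> y) w < \<epsilon>" using D(4)[OF u(1) v(1)] by blast
    qed (use xH yH in simp)
  qed
  fix s x assume s: "range s \<subseteq> hclosure U \<and> limitin (htop H) s x sequentially"
  then have x: "x \<in> carrier H" by (simp add: htop_eq Metric.limit_metric_sequentially)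
  have "\<exists>u\<in>U. hdist H x u < \<epsilon>" if e: "\<epsilon> > 0" for \<epsilon>
  proof -
    obtain n where n: "hdist H (s n) x < \<epsilon> / 2"
      using s e unfolding htop_eq Metric.limit_metric_sequentially by (meson half_gt_zero order_refl)
    have sn: "s n \<in> hclosure U" using s by blast
    then obtain u where u: "u \<in> U" "hdist H (s n) u < \<epsilon> / 2"
      using hclosureD[OF sn, of "\<epsilon> / 2"] e by auto
    have "hdist H x u \<le> hdist H x (s n) + hdist H (s n) u"
      using x sn D(3)[OF u(1)] by (intro Metric.triangle) (auto simp: hclosure_def)
    then show ?thesis using n u Metric.commute[of x "s n"] by (intro bexI[of _ u]) auto
  qed
  then show "x \<in> hclosure U" using x by (simp add: hclosure_def)
qed

lemma hclosure_superset: "U \<subseteq> carrier H \<Longrightarrow> U \<subseteq> hclosure U"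
proof
  fix x assume U: "U \<subseteq> carrier H" "x \<in> U"
  then have "hdist H x x = 0" by auto
  then show "x \<in> hclosure U" using U unfolding hclosure_def by force
qed

definition orthogonal_complement :: "'v set \<Rightarrow> 'v set" where
  "orthogonal_complement V = {x \<in> carrier H. \<forall>v\<in>V. ip H x v = 0}"

lemma closed_orthogonal_complement:
  assumes V: "V \<subseteq> carrier H"
  shows "closed_linear_subspace (orthogonal_complement V)"
  unfolding closed_linear_subspace_def
proof (intro conjI allI impI)
  show "linear_subspace (orthogonal_complement V)"
    using V by (auto simp: orthogonal_complement_def linear_subspace_def ip_simps subset_iff)
  fix s x assume s: "range s \<subseteq> orthogonal_complement V \<and> limitin (htop H) s x sequentially"
  then have x: "x \<in> carrier H" by (simp add: htop_eq Metric.limit_metric_sequentially)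
  have sH: "s n \<in> carrier H" and s0: "v \<in> V \<Longrightarrow> ip H (s n) v = 0" for n v
    using s by (auto simp: orthogonal_complement_def image_subset_iff)
  have "ip H x v = 0" if v: "v \<in> V" for v
  proof -
    have vH: "v \<in> carrier H" using v V by blast
    have lim: "limitin (htop H) s x sequentially" using s by blast
    have "Re (ip H x v) = 0" by (rule limitin_ip_zero[OF lim vH sH s0[OF v]])
    moreover have "Re (ip H x (\<i> \<odot> v)) = 0"
      by (rule limitin_ip_zero[OF lim _ sH]) (use vH sH s0[OF v] in \<open>auto simp: ip_smult_right[OF UNIV_I]\<close>)
    ultimately show ?thesis using x vH by (simp add: complex_eq_iff ip_smult_right[OF UNIV_I])
  qed
  then show "x \<in> orthogonal_complement V" using x by (simp add: orthogonal_complement_def)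
qed

end

section \<open>Approximating a cocycle in finite-dimensional subrepresentations\<close>

locale unitary_cocycle = hilbert_rep G T UNIV H \<pi> + complex_hilbert H + locally_compact_group G T
  for G :: "('g, 'm) monoid_scheme" (structure) and T :: "'g topology"
    and H :: "'v inner_module" and \<pi> +
  fixes b
  assumes b: "b \<in> cocycles G T H \<pi>"
begin

definition invariant :: "'v set \<Rightarrow> bool" where
  "invariant V \<longleftrightarrow> (\<forall>g\<in>carrier G. \<forall>x\<in>V. \<pi> g x \<in> V)"

lemma b_closed [simp]: "g \<in> carrier G \<Longrightarrow> b g \<in> carrier H"
  by (rule cocycle_closed[OF b])

lemma rep_in [simp]: "\<lbrakk>g \<in> carrier G; x \<in> carrier H\<rbrakk> \<Longrightarrow> \<pi> g x \<in> carrier H"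
  by (rule rep_closed)

lemma rep_one: "x \<in> carrier H \<Longrightarrow> \<pi> \<one> x = x"
  using id_eq_one by (metis restrict_apply')

lemma rep_inv_left [simp]: "\<lbrakk>g \<in> carrier G; x \<in> carrier H\<rbrakk> \<Longrightarrow> \<pi> (inv g) (\<pi> g x) = x"
  by (rule orbit_sym_aux) auto

lemma rep_inv_right [simp]: "\<lbrakk>g \<in> carrier G; x \<in> carrier H\<rbrakk> \<Longrightarrow> \<pi> g (\<pi> (inv g) x) = x"
  using rep_inv_left[of "inv g" x] by simp

lemma rep_adjoint:
  assumes g: "g \<in> carrier G" and x: "x \<in> carrier H" and y: "y \<in> carrier H"
  shows "ip H (\<pi> g x) y = ip H x (\<pi> (inv g) y)"
  using rep_ip[OF g x, of "\<pi> (inv g) y"] g y by simp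

lemma rep_hnorm: "\<lbrakk>g \<in> carrier G; x \<in> carrier H\<rbrakk> \<Longrightarrow> hnorm H (\<pi> g x) = hnorm H x"
  by (simp add: hnorm_def rep_ip)

lemma rep_hdist: "\<lbrakk>g \<in> carrier G; x \<in> carrier H; y \<in> carrier H\<rbrakk> \<Longrightarrow> hdist H (\<pi> g x) (\<pi> g y) = hdist H x y"
  by (simp add: hdist_eq rep_hnorm flip: rep_diff)

lemma hproj_rep:
  assumes V: "projectable V" "invariant V" and g: "g \<in> carrier G" and x: "x \<in> carrier H"
  shows "hproj V (\<pi> g x) = \<pi> g (hproj V x)"
proof (rule hproj_unique[OF V(1)])
  note D = linear_subspaceD[OF hproj_closed[OF V(1)]]
  show "\<pi> g x \<in> carrier H" using g x by simp
  show "\<pi> g (hproj V x) \<in> V" using V(2) hproj(1)[OF V(1) x] g by (simp add: invariant_def)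
  fix v assume v: "v \<in> V"
  have "\<pi> (inv g) v \<in> V" using V(2) v g by (simp add: invariant_def)
  then show "ip H (\<pi> g x \<ominus>\<^bsub>H\<^esub> \<pi> g (hproj V x)) v = 0"
    using hproj(2)[OF V(1) x] rep_adjoint[OF g, of "x \<ominus>\<^bsub>H\<^esub> hproj V x" v] x g D(3)[OF v] hproj_carrier[OF V(1) x]
    by (simp add: rep_diff)
qed

lemma cocycle_hproj:
  assumes V: "projectable V" "invariant V" and c: "c \<in> cocycles G T H \<pi>"
  shows "(\<lambda>g\<in>carrier G. hproj V (c g)) \<in> cocycles G T H \<pi>"
proof (rule cocyclesI[OF topspace_eq])
  have cH: "c g \<in> carrier H" if "g \<in> carrier G" for g using c that by (rule cocycle_closed)
  show "continuous_map T (htop H) (\<lambda>g. hproj V (c g))"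
    unfolding continuous_map_htop topspace_eq
  proof (intro conjI ballI allI impI)
    fix x and \<epsilon> :: real assume x: "x \<in> carrier G" and "\<epsilon> > 0"
    then obtain U where U: "openin T U" "x \<in> U" "\<forall>y\<in>U. hdist H (c x) (c y) < \<epsilon>"
      using cocycle_continuous[OF c] unfolding continuous_map_htop topspace_eq by meson
    have "hdist H (hproj V (c x)) (hproj V (c y)) < \<epsilon>" if y: "y \<in> U" for y
    proof -
      have "y \<in> carrier G" using y U(1) openin_subset topspace_eq by blast
      then show ?thesis using hproj_contraction[OF V(1) cH[OF x] cH] U(3) y by fastforce
    qed
    then show "\<exists>U. openin T U \<and> x \<in> U \<and> (\<forall>y\<in>U. hdist H (hproj V (c x)) (hproj V (c y)) < \<epsilon>)"
      using U by blast
  qed (use cH hproj_carrier[OF V(1)] in simp)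
  fix g h assume "g \<in> carrier G" "h \<in> carrier G"
  then show "hproj V (c (g \<otimes> h)) = \<pi> g (hproj V (c h)) \<oplus>\<^bsub>H\<^esub> hproj V (c g)"
    using cH by (simp add: cocycle_mult[OF c] hproj_add[OF V(1)] hproj_rep[OF V])
qed

lemma cocycles_diff:
  assumes c: "c \<in> cocycles G T H \<pi>" and d: "d \<in> cocycles G T H \<pi>"
  shows "(\<lambda>g\<in>carrier G. c g \<ominus>\<^bsub>H\<^esub> d g) \<in> cocycles G T H \<pi>"
proof -
  have "(\<lambda>g\<in>carrier G. c g \<ominus>\<^bsub>H\<^esub> d g) = (\<lambda>g\<in>carrier G. c g \<oplus>\<^bsub>H\<^esub> (\<lambda>g\<in>carrier G. \<ominus>\<^bsub>H\<^esub> d g) g)"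
    by (intro restrict_ext) (simp add: a_minus_def)
  then show ?thesis using cocycles_add[OF topspace_eq c cocycles_minus[OF topspace_eq d]] by simp
qed

subsection \<open>The closed span of the finite-dimensional subrepresentations\<close>

text \<open>
  Finite-dimensional subrepresentations are handled through finite spanning sets, so that finite sums of
  subrepresentations correspond to finite unions.
\<close>

definition fd_spans :: "'v set set" where
  "fd_spans = {B. finite B \<and> B \<subseteq> carrier H \<and> invariant (hspan B)}"

lemma fd_spansD:
  assumes "B \<in> fd_spans"
  shows "finite B" "B \<subseteq> carrier H" "invariant (hspan B)" "projectable (hspan B)"
    "linear_subspace (hspan B)"
  using assms projectable_hspan linear_subspace_hspan by (auto simp: fd_spans_def)

lemma fd_spans_Un:
  assumes B: "B \<in> fd_spans" and C: "C \<in> fd_spans"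
  shows "B \<union> C \<in> fd_spans"
proof -
  note DB = fd_spansD[OF B] and DC = fd_spansD[OF C]
  have BC: "B \<union> C \<subseteq> carrier H" using DB DC by auto
  note D = linear_subspaceD[OF linear_subspace_hspan[OF BC]]
  have "\<pi> g x \<in> hspan (B \<union> C)" if g: "g \<in> carrier G" and x: "x \<in> hspan (B \<union> C)" for g x
  proof -
    let ?V = "{x \<in> carrier H. \<pi> g x \<in> hspan (B \<union> C)}"
    have "linear_subspace ?V"
      using D g by (auto simp: linear_subspace_def rep_zero rep_add rep_smult)
    moreover have "B \<union> C \<subseteq> ?V"
    proof
      fix x assume "x \<in> B \<union> C"
      then have "\<pi> g x \<in> hspan B \<or> \<pi> g x \<in> hspan C"
        using DB(3) DC(3) g hspan.base by (auto simp: invariant_def)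
      then have "\<pi> g x \<in> hspan (B \<union> C)"
        using hspan_mono[of B "B \<union> C"] hspan_mono[of C "B \<union> C"] BC by blast
      then show "x \<in> ?V" using \<open>x \<in> B \<union> C\<close> BC by blast
    qed
    ultimately have "hspan (B \<union> C) \<subseteq> ?V" by (rule hspan_least)
    then show ?thesis using x by blast
  qed
  then show ?thesis using DB DC by (auto simp: fd_spans_def invariant_def)
qed

lemma fd_spans_Union: "\<lbrakk>finite \<B>; \<B> \<subseteq> fd_spans\<rbrakk> \<Longrightarrow> \<Union>\<B> \<in> fd_spans"
proof (induction rule: finite_induct)
  case empty
  have "hspan {} \<subseteq> {\<zero>\<^bsub>H\<^esub>}" by (rule hspan_least) (auto simp: linear_subspace_def smult_r_null[simplified])
  then show ?case by (auto simp: fd_spans_def invariant_def subset_iff rep_zero hspan.zero)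
next
  case (insert B \<B>)
  then show ?case using fd_spans_Un by simp
qed

definition fd_part :: "'v set" where
  "fd_part = (\<Union>B\<in>fd_spans. hspan B)"

lemma fd_part_sub: "fd_part \<subseteq> carrier H"
  using fd_spansD(5) linear_subspaceD(1) by (fastforce simp: fd_part_def)

lemma linear_subspace_fd_part: "linear_subspace fd_part"
  unfolding linear_subspace_def
proof (intro conjI ballI allI)
  show "fd_part \<subseteq> carrier H" by (rule fd_part_sub)
  have "{} \<in> fd_spans" using fd_spans_Union[of "{}"] by simp
  then show "\<zero>\<^bsub>H\<^esub> \<in> fd_part" using hspan.zero by (auto simp: fd_part_def)
  fix x assume "x \<in> fd_part"
  then obtain B where B: "B \<in> fd_spans" "x \<in> hspan B" by (auto simp: fd_part_def)
  then show "a \<odot>\<^bsub>H\<^esub> x \<in> fd_part" for a using hspan.smult by (auto simp: fd_part_def)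
  fix y assume "y \<in> fd_part"
  then obtain C where C: "C \<in> fd_spans" "y \<in> hspan C" by (auto simp: fd_part_def)
  have BC: "B \<union> C \<in> fd_spans" by (rule fd_spans_Un[OF B(1) C(1)])
  then have "x \<in> hspan (B \<union> C)" "y \<in> hspan (B \<union> C)"
    using B C hspan_mono[of B "B \<union> C"] hspan_mono[of C "B \<union> C"] fd_spansD(2)[OF BC] by blast+
  then show "x \<oplus>\<^bsub>H\<^esub> y \<in> fd_part" using BC hspan.add by (auto simp: fd_part_def)
qed

text \<open>
  The Hilbert space is the orthogonal sum of the closed span of all finite-dimensional subrepresentations and
  a subrepresentation without finite-dimensional ones.
\<close>

abbreviation "V_fd \<equiv> hclosure fd_part"
abbreviation "V_inf \<equiv> orthogonal_complement V_fd"

lemma V_fd_sub: "V_fd \<subseteq> carrier H" by (auto simp: hclosure_def)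

lemma projectable_V_fd: "projectable V_fd"
  by (intro projectable_closed closed_hclosure linear_subspace_fd_part)

lemma invariant_V_fd: "invariant V_fd"
  unfolding invariant_def
proof (intro ballI)
  fix g x assume g: "g \<in> carrier G" and x: "x \<in> V_fd"
  then have xH: "x \<in> carrier H" using V_fd_sub by blast
  have "\<exists>u\<in>fd_part. hdist H (\<pi> g x) u < \<epsilon>" if e: "\<epsilon> > 0" for \<epsilon>
  proof -
    obtain u where u: "u \<in> fd_part" "hdist H x u < \<epsilon>" using hclosureD[OF x e] by blast
    have "\<pi> g u \<in> fd_part" using u(1) g fd_spansD(3) by (fastforce simp: fd_part_def invariant_def)
    then show ?thesis using u xH g fd_part_sub by (intro bexI[of _ "\<pi> g u"]) (auto simp: rep_hdist)
  qed
  then show "\<pi> g x \<in> V_fd" using g xH by (simp add: hclosure_def)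
qed

lemma invariant_V_inf: "invariant V_inf"
  using invariant_V_fd V_fd_sub by (auto simp: invariant_def orthogonal_complement_def rep_adjoint subset_iff)

lemma V_inf_no_fd:
  assumes B: "B \<in> fd_spans" "hspan B \<subseteq> V_inf" and x: "x \<in> hspan B"
  shows "x = \<zero>\<^bsub>H\<^esub>"
proof -
  have "x \<in> V_fd" using hclosure_superset[OF fd_part_sub] B(1) x by (auto simp: fd_part_def)
  moreover have "x \<in> V_inf" using B x by blast
  ultimately have "ip H x x = 0" "x \<in> carrier H" by (auto simp: orthogonal_complement_def)
  then show ?thesis using ip_self_zero by blast
qed

text \<open>
  The complement, as a Hilbert space in its own right, has no nonzero finite-dimensional subrepresentation, so
  its first reduced cohomology vanishes by property \<open>H\<^sub>F\<^sub>D\<close>.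
\<close>

lemma approx_on_V_inf:
  assumes HFD: "property_HFD G T" and c: "c \<in> cocycles G T H \<pi>"
    and cV: "\<And>g. g \<in> carrier G \<Longrightarrow> c g \<in> V_inf"
    and Q: "compactin T Q" "\<epsilon> > 0"
  shows "\<exists>v\<in>V_inf. \<forall>g\<in>Q. hdist H (c g) (v \<ominus>\<^bsub>H\<^esub> \<pi> g v) < \<epsilon>"
proof -
  \<comment> \<open>The transport along the identity restricts the carrier of \<open>H\<close> to a closed subspace.\<close>
  let ?\<phi> = "\<lambda>x::'v. x"
  have clV: "closed_linear_subspace V_inf" by (rule closed_orthogonal_complement[OF V_fd_sub])
  then have linV: "linear_subspace V_inf" by (simp add: closed_linear_subspace_def)
  note D = linear_subspaceD[OF linV]
  have V_rep: "\<pi> g x \<in> V_inf" if "g \<in> carrier G" "x \<in> V_inf" for g x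
    using invariant_V_inf that by (simp add: invariant_def)
  interpret S: closed_subspace UNIV H V_inf ?\<phi>
  proof
    show "x \<in> V_inf" if "range s \<subseteq> V_inf" "limitin (htop H) s x sequentially" for s x
      using clV that unfolding closed_linear_subspace_def by blast
  qed (use D in auto)
  let ?L = "transport_space ?\<phi> V_inf H"
  have LC: "carrier ?L = V_inf" using S.L_carrier by simp
  define \<rho> where "\<rho> = (\<lambda>g. \<lambda>x\<in>V_inf. \<pi> g x)"
  have \<rho>: "\<rho> g x = \<pi> g x" if "x \<in> V_inf" for g x using that by (simp add: \<rho>_def)
  have act: "group_action G (carrier ?L) \<rho>"
    unfolding LC \<rho>_def using D(3) by (intro group_action_restrictI) (auto simp: V_rep composition_rule rep_one)
  have rep': "unitary_rep G T ?L \<rho>"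
  proof (intro hilbert_rep.intro hilbert_rep_axioms.intro act S.L_hilbert)
    show "continuous_map T (htop ?L) (\<lambda>g. \<rho> g x)" if x: "x \<in> carrier ?L" for x
      using S.L_continuous[OF rep_continuous[of x]] x D(3) V_rep unfolding LC by (simp add: \<rho> topspace_eq)
  qed (use S.L_add S.L_smult S.L_ip D in \<open>auto simp: LC \<rho> V_rep rep_add rep_smult rep_ip\<close>)
  interpret L': hilbert_rep G T UNIV ?L \<rho> by (rule rep')
  have cL: "(\<lambda>g\<in>carrier G. c g) \<in> cocycles G T ?L \<rho>"
    using c by (intro L'.cocyclesI[OF topspace_eq] S.L_continuous)
      (use S.L_add in \<open>auto simp: topspace_eq cV V_rep \<rho> cocycle_mult[OF c] cocycle_continuous\<close>)
  have "trivial_group (reduced_H1 G T ?L \<rho>)"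
  proof (rule ccontr)
    assume "\<not> trivial_group (reduced_H1 G T ?L \<rho>)"
    then have "has_finite_dimensional_subrep G UNIV ?L \<rho>"
      by (rule property_HFD_any_space[OF topspace_eq HFD rep'])
    then obtain W B where W: "submodule W (scalar_field UNIV) ?L" "\<forall>g\<in>carrier G. \<rho> g ` W \<subseteq> W"
      and nz: "W \<noteq> {\<zero>\<^bsub>?L\<^esub>}" and B: "finite B" "B \<subseteq> W"
      and gen: "\<forall>w\<in>W. \<exists>f\<in>B \<rightarrow> UNIV. w = (\<Oplus>\<^bsub>?L\<^esub>x\<in>B. f x \<odot>\<^bsub>?L\<^esub> x)"
      unfolding has_finite_dimensional_subrep_def finite_dimensional_def by blast
    have WV: "W \<subseteq> V_inf" using S.L.submoduleE(1)[OF W(1)] LC by simp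
    have WH: "W \<subseteq> carrier H" using WV D(1) by blast
    have W0: "\<zero>\<^bsub>H\<^esub> \<in> W" using submodule.axioms(1)[OF W(1)] subgroup.one_closed S.L_zero by fastforce
    have linW: "linear_subspace W"
      unfolding linear_subspace_def
    proof (intro conjI ballI allI)
      show "W \<subseteq> carrier H" "\<zero>\<^bsub>H\<^esub> \<in> W" by (fact WH W0)+
      show "x \<oplus>\<^bsub>H\<^esub> y \<in> W" if "x \<in> W" "y \<in> W" for x y
        using S.L.submoduleE(5)[OF W(1) that] S.L_add[OF subsetD[OF WV that(1)] subsetD[OF WV that(2)]] by simp
      show "a \<odot>\<^bsub>H\<^esub> x \<in> W" if "x \<in> W" for a x
        using S.L.submoduleE(4)[OF W(1), of a x] S.L_smult[of x a] that WV by auto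
    qed
    have BH: "B \<subseteq> carrier H" using B WH by blast
    note DB = linear_subspaceD[OF linear_subspace_hspan[OF BH]]
    have hW: "hspan B \<subseteq> W" by (rule hspan_least[OF linW B(2)])
    have "W \<subseteq> hspan B"
    proof
      fix w assume "w \<in> W"
      then obtain f where w: "w = (\<Oplus>\<^bsub>?L\<^esub>x\<in>B. f x \<odot>\<^bsub>?L\<^esub> x)" using gen by blast
      have fV: "f x \<odot>\<^bsub>H\<^esub> x \<in> V_inf" if "x \<in> B" for x using that B WV D(5) by blast
      have "(\<Oplus>\<^bsub>?L\<^esub>x\<in>B. f x \<odot>\<^bsub>?L\<^esub> x) = (\<Oplus>\<^bsub>?L\<^esub>x\<in>B. f x \<odot>\<^bsub>H\<^esub> x)"
        using fV B WV S.L_smult by (intro S.L.M.finsum_cong') (auto simp: LC subset_iff)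
      also have "\<dots> = (\<Oplus>\<^bsub>H\<^esub>x\<in>B. f x \<odot>\<^bsub>H\<^esub> x)" using S.L_finsum[OF B(1), of "\<lambda>x. f x \<odot>\<^bsub>H\<^esub> x"] fV by auto
      also have "\<dots> \<in> hspan B"
      proof -
        have "(\<Oplus>\<^bsub>H\<^esub>x\<in>C. f x \<odot>\<^bsub>H\<^esub> x) \<in> hspan B" if "finite C" "C \<subseteq> B" for C
          using that
        proof (induction C)
          case (insert x C)
          then have "x \<in> B" "x \<in> carrier H" "C \<subseteq> carrier H" using BH by auto
          then show ?case using insert by (subst M.finsum_insert) (auto intro: hspan.intros)
        qed (simp add: hspan.zero)
        then show ?thesis using B by blast
      qed
      finally show "w \<in> hspan B" using w by simp
    qed
    then have WB: "W = hspan B" using hW by blast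
    have "invariant (hspan B)"
      using W(2) WV unfolding WB[symmetric] by (auto simp: invariant_def \<rho> image_subset_iff subset_iff)
    then have "B \<in> fd_spans" using B BH by (simp add: fd_spans_def)
    then have "W \<subseteq> {\<zero>\<^bsub>H\<^esub>}" using V_inf_no_fd WV unfolding WB by blast
    then show False using nz W0 S.L_zero by auto
  qed
  then obtain v where v: "v \<in> V_inf" "\<forall>g\<in>Q. hdist ?L ((\<lambda>g\<in>carrier G. c g) g) (v \<ominus>\<^bsub>?L\<^esub> \<rho> g v) < \<epsilon>"
    using L'.reduced_H1_nontrivial_iff[OF topspace_eq] cL Q unfolding LC by (meson not_le)
  have QG: "Q \<subseteq> carrier G" using Q(1) topspace_eq compactin_subset_topspace by blast
  have "hdist H (c g) (v \<ominus>\<^bsub>H\<^esub> \<pi> g v) < \<epsilon>" if g: "g \<in> Q" for g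
  proof -
    have gG: "g \<in> carrier G" using g QG by blast
    have "hdist ?L (c g) (v \<ominus>\<^bsub>?L\<^esub> \<rho> g v) = hdist H (c g) (v \<ominus>\<^bsub>H\<^esub> \<pi> g v)"
      using S.L_diff[OF v(1) V_rep[OF gG v(1)]] S.L_hdist[OF cV[OF gG] S.V_diff[OF v(1) V_rep[OF gG v(1)]]] v(1)
      by (simp add: \<rho>)
    then show ?thesis using v(2) g gG by auto
  qed
  then show ?thesis using v(1) by blast
qed

text \<open>
  The component of \<open>b\<close> in \<open>V_inf\<close> is near a coboundary. The component in \<open>V_fd\<close> takes each value near some
  finite-dimensional subrepresentation; by continuity and compactness finitely many of them, hence their sum,
  serve for all of \<open>S\<close>.
\<close>

lemma finite_dimensional_approximation:
  assumes HFD: "property_HFD G T" and S: "compactin T S" and e: "\<epsilon> > 0"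
  shows "\<exists>B\<in>fd_spans. \<exists>v\<in>carrier H. \<forall>s\<in>S.
    hnorm H ((b s \<ominus>\<^bsub>H\<^esub> hproj (hspan B) (b s)) \<ominus>\<^bsub>H\<^esub> (v \<ominus>\<^bsub>H\<^esub> \<pi> s v)) \<le> \<epsilon>"
proof -
  have SG: "S \<subseteq> carrier G" using S topspace_eq compactin_subset_topspace by blast
  let ?P = "hproj V_fd"
  note PV = projectable_V_fd and invV = invariant_V_fd
  define c where "c = (\<lambda>g\<in>carrier G. b g \<ominus>\<^bsub>H\<^esub> (\<lambda>g\<in>carrier G. ?P (b g)) g)"
  have c: "c \<in> cocycles G T H \<pi>" unfolding c_def by (rule cocycles_diff[OF b cocycle_hproj[OF PV invV b]])
  have cg: "c g = b g \<ominus>\<^bsub>H\<^esub> ?P (b g)" if "g \<in> carrier G" for g using that by (simp add: c_def)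
  have cV: "c g \<in> V_inf" if "g \<in> carrier G" for g
    using that hproj(2)[OF PV b_closed[OF that]] hproj_carrier[OF PV b_closed[OF that]]
    by (simp add: cg orthogonal_complement_def)
  obtain v where v: "v \<in> V_inf" "\<And>g. g \<in> S \<Longrightarrow> hdist H (c g) (v \<ominus>\<^bsub>H\<^esub> \<pi> g v) < \<epsilon> / 2"
    using approx_on_V_inf[OF HFD c cV S half_gt_zero[OF e]] by blast
  have vH: "v \<in> carrier H" using v(1) by (simp add: orthogonal_complement_def)
  have near: "\<exists>U B. openin T U \<and> s \<in> U \<and> B \<in> fd_spans \<and> (\<forall>t\<in>U. \<exists>w\<in>hspan B. hnorm H (?P (b t) \<ominus>\<^bsub>H\<^esub> w) < \<epsilon> / 2)"
    if s: "s \<in> S" for s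
  proof -
    have sG: "s \<in> carrier G" using s SG by blast
    have e4: "\<epsilon> / 4 > 0" using e by simp
    obtain w where w: "w \<in> fd_part" "hdist H (?P (b s)) w < \<epsilon> / 4"
      using hclosureD[OF hproj(1)[OF PV b_closed[OF sG]] e4] by blast
    then obtain B where B: "B \<in> fd_spans" "w \<in> hspan B" by (auto simp: fd_part_def)
    have wH: "w \<in> carrier H" using w(1) fd_part_sub by blast
    obtain U where U: "openin T U" "s \<in> U" "\<forall>t\<in>U. hdist H (b s) (b t) < \<epsilon> / 4"
      using cocycle_continuous[OF b] sG e4 unfolding continuous_map_htop topspace_eq by meson
    have "hnorm H (?P (b t) \<ominus>\<^bsub>H\<^esub> w) < \<epsilon> / 2" if t: "t \<in> U" for t
    proof -
      have tG: "t \<in> carrier G" using t U(1) openin_subset topspace_eq by blast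
      have "hdist H (?P (b t)) w \<le> hdist H (?P (b t)) (?P (b s)) + hdist H (?P (b s)) w"
        using hproj_carrier[OF PV] tG sG wH by (intro Metric.triangle) auto
      also have "hdist H (?P (b t)) (?P (b s)) \<le> hdist H (b s) (b t)"
        using hproj_contraction[OF PV, of "b t" "b s"] tG sG Metric.commute[of "b s" "b t"] by simp
      finally show ?thesis
        using U(3) t w(2) hproj_carrier[OF PV] tG wH by (fastforce simp: hdist_eq)
    qed
    then show ?thesis using U B by blast
  qed
  then have "\<forall>s\<in>S. \<exists>p. openin T (fst p) \<and> s \<in> fst p \<and> snd p \<in> fd_spans \<and>
      (\<forall>t\<in>fst p. \<exists>w\<in>hspan (snd p). hnorm H (?P (b t) \<ominus>\<^bsub>H\<^esub> w) < \<epsilon> / 2)"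
    by simp
  from bchoice[OF this] obtain p where p: "\<And>s. s \<in> S \<Longrightarrow> openin T (fst (p s)) \<and> s \<in> fst (p s) \<and> snd (p s) \<in> fd_spans \<and>
      (\<forall>t\<in>fst (p s). \<exists>w\<in>hspan (snd (p s)). hnorm H (?P (b t) \<ominus>\<^bsub>H\<^esub> w) < \<epsilon> / 2)" by blast
  have cover: "S \<subseteq> \<Union>((\<lambda>s. fst (p s)) ` S)" using p by blast
  have "\<And>U. U \<in> (\<lambda>s. fst (p s)) ` S \<Longrightarrow> openin T U" using p by blast
  with S cover obtain \<F> where F: "finite \<F>" "\<F> \<subseteq> (\<lambda>s. fst (p s)) ` S" "S \<subseteq> \<Union>\<F>"
    unfolding compactin_def by meson
  from finite_subset_image[OF F(1,2)] obtain N where N: "N \<subseteq> S" "finite N" "\<F> = (\<lambda>s. fst (p s)) ` N" by blast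
  define B where "B = \<Union>((\<lambda>s. snd (p s)) ` N)"
  have B: "B \<in> fd_spans" unfolding B_def by (rule fd_spans_Union) (use N p in auto)
  note DB = fd_spansD[OF B]
  have BV: "hspan B \<subseteq> V_fd" using hclosure_superset[OF fd_part_sub] B by (auto simp: fd_part_def)
  have "hnorm H ((b s \<ominus>\<^bsub>H\<^esub> hproj (hspan B) (b s)) \<ominus>\<^bsub>H\<^esub> (v \<ominus>\<^bsub>H\<^esub> \<pi> s v)) \<le> \<epsilon>" if s: "s \<in> S" for s
  proof -
    have sG: "s \<in> carrier G" using s SG by blast
    obtain r where r: "r \<in> N" "s \<in> fst (p r)" using s F(3) N(3) by blast
    then obtain w where w: "w \<in> hspan (snd (p r))" "hnorm H (?P (b s) \<ominus>\<^bsub>H\<^esub> w) < \<epsilon> / 2" using p N by blast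
    have "w \<in> hspan B"
      using w(1) r(1) hspan_mono[OF _ DB(2), of "snd (p r)"] by (auto simp: B_def)
    then have 1: "hnorm H (?P (b s) \<ominus>\<^bsub>H\<^esub> hproj (hspan B) (b s)) < \<epsilon> / 2"
      using hproj_best[OF DB(4) hproj_carrier[OF PV b_closed[OF sG]]] w(2)
        hproj_hproj[OF PV DB(4) BV b_closed[OF sG]] by fastforce
    have 2: "hnorm H (c s \<ominus>\<^bsub>H\<^esub> (v \<ominus>\<^bsub>H\<^esub> \<pi> s v)) < \<epsilon> / 2"
      using v(2)[OF s] cocycle_closed[OF c sG] vH sG by (simp add: hdist_eq)
    have H: "?P (b s) \<in> carrier H" "hproj (hspan B) (b s) \<in> carrier H"
      using hproj_carrier[OF PV] hproj_carrier[OF DB(4)] sG by auto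
    have "(b s \<ominus>\<^bsub>H\<^esub> hproj (hspan B) (b s)) \<ominus>\<^bsub>H\<^esub> (v \<ominus>\<^bsub>H\<^esub> \<pi> s v)
        = (?P (b s) \<ominus>\<^bsub>H\<^esub> hproj (hspan B) (b s)) \<oplus>\<^bsub>H\<^esub> (c s \<ominus>\<^bsub>H\<^esub> (v \<ominus>\<^bsub>H\<^esub> \<pi> s v))"
      using H sG vH by (intro eq_by_ip) (auto simp: cg ip_simps)
    also have "hnorm H \<dots> \<le> hnorm H (?P (b s) \<ominus>\<^bsub>H\<^esub> hproj (hspan B) (b s)) + hnorm H (c s \<ominus>\<^bsub>H\<^esub> (v \<ominus>\<^bsub>H\<^esub> \<pi> s v))"
      using H sG vH by (intro hnorm_triangle) (auto simp: cg)
    finally show ?thesis using 1 2 by simp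
  qed
  then show ?thesis using B vH by blast
qed

end

section \<open>Word length and growth of cocycles\<close>

context group
begin

lemma foldr_mult_closed: "set xs \<subseteq> carrier G \<Longrightarrow> foldr (\<otimes>) xs \<one> \<in> carrier G"
  by (induction xs) auto

lemma foldr_mult_append:
  "\<lbrakk>set xs \<subseteq> carrier G; set ys \<subseteq> carrier G\<rbrakk> \<Longrightarrow> foldr (\<otimes>) (xs @ ys) \<one> = foldr (\<otimes>) xs \<one> \<otimes> foldr (\<otimes>) ys \<one>"
  by (induction xs) (auto simp: foldr_mult_closed m_assoc)

lemma generate_word:
  assumes S: "S \<subseteq> carrier G" and g: "g \<in> generate G S"
  shows "\<exists>xs. set xs \<subseteq> S \<union> m_inv G ` S \<and> g = foldr (\<otimes>) xs \<one>"
  using g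
proof induction
  case one
  show ?case by (intro exI[of _ "[]"]) simp
next
  case (incl h)
  then show ?case using S by (intro exI[of _ "[h]"]) auto
next
  case (inv h)
  then show ?case using S by (intro exI[of _ "[inv h]"]) auto
next
  case (eng g h)
  then obtain xs ys where w: "set xs \<subseteq> S \<union> m_inv G ` S" "g = foldr (\<otimes>) xs \<one>"
    "set ys \<subseteq> S \<union> m_inv G ` S" "h = foldr (\<otimes>) ys \<one>" by blast
  have "S \<union> m_inv G ` S \<subseteq> carrier G" using S by auto
  then have "set xs \<subseteq> carrier G" "set ys \<subseteq> carrier G" using w by blast+
  then show ?case using w foldr_mult_append[of xs ys] by (intro exI[of _ "xs @ ys"]) (simp del: foldr_append)
qed

lemma word_length_word:
  assumes S: "S \<subseteq> carrier G" and g: "g \<in> generate G S"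
  shows "\<exists>xs. length xs = word_length G S g \<and> set xs \<subseteq> S \<union> m_inv G ` S \<and> g = foldr (\<otimes>) xs \<one>"
  unfolding word_length_def by (rule LeastI_ex) (use generate_word[OF S g] in blast)

end

lemma (in topological_group) compact_word_ball:
  assumes S: "compactin T S" "generate G S = carrier G"
  shows "\<exists>Q. compactin T Q \<and> {g \<in> carrier G. word_length G S g \<le> n} \<subseteq> Q"
proof -
  have SG: "S \<subseteq> carrier G" using S(1) topspace_eq compactin_subset_topspace by blast
  define S' where "S' = S \<union> m_inv G ` S"
  have S': "compactin T S'"
    unfolding S'_def by (intro compactin_Un S(1) image_compactin[OF S(1) continuous_inv])
  have words: "\<exists>Q. compactin T Q \<and> (\<forall>xs. length xs = k \<and> set xs \<subseteq> S' \<longrightarrow> foldr (\<otimes>) xs \<one> \<in> Q)" for k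
  proof (induction k)
    case 0
    show ?case by (intro exI[of _ "{\<one>}"]) (simp add: topspace_eq)
  next
    case (Suc k)
    then obtain Q where Q: "compactin T Q" "\<And>xs. length xs = k \<Longrightarrow> set xs \<subseteq> S' \<Longrightarrow> foldr (\<otimes>) xs \<one> \<in> Q" by blast
    have "compactin T ((\<lambda>(x, y). x \<otimes> y) ` (S' \<times> Q))"
      using S' Q(1) by (intro image_compactin[OF _ continuous_mult]) (simp add: compactin_Times)
    moreover have "foldr (\<otimes>) xs \<one> \<in> (\<lambda>(x, y). x \<otimes> y) ` (S' \<times> Q)" if "length xs = Suc k" "set xs \<subseteq> S'" for xs
    proof -
      obtain x ys where xs: "xs = x # ys" "length ys = k" using \<open>length xs = Suc k\<close> by (auto simp: length_Suc_conv)
      then have "(x, foldr (\<otimes>) ys \<one>) \<in> S' \<times> Q" using Q(2)[of ys] that(2) by simp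
      then show ?thesis unfolding xs(1) by (rule rev_image_eqI) simp
    qed
    ultimately show ?case by blast
  qed
  then obtain Q where Q: "\<And>k. compactin T (Q k)"
    "\<And>k xs. length xs = k \<Longrightarrow> set xs \<subseteq> S' \<Longrightarrow> foldr (\<otimes>) xs \<one> \<in> Q k"
    using choice[of "\<lambda>k Q. compactin T Q \<and> (\<forall>xs. length xs = k \<and> set xs \<subseteq> S' \<longrightarrow> foldr (\<otimes>) xs \<one> \<in> Q)"]
    by blast
  have "compactin T (\<Union>(Q ` {..n}))" by (intro compactin_Union) (use Q in auto)
  moreover have "g \<in> \<Union>(Q ` {..n})" if g: "g \<in> carrier G" and n: "word_length G S g \<le> n" for g
  proof -
    obtain xs where "length xs = word_length G S g" "set xs \<subseteq> S'" "g = foldr (\<otimes>) xs \<one>"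
      using word_length_word[OF SG, of g] S(2) g unfolding S'_def by blast
    then have "g \<in> Q (word_length G S g)" using Q(2)[of xs "word_length G S g"] by simp
    moreover have "word_length G S g \<in> {..n}" using n by simp
    ultimately show ?thesis by blast
  qed
  ultimately show ?thesis by blast
qed

context unitary_cocycle
begin

lemma cocycle_at_one: "c \<in> cocycles G T H \<pi> \<Longrightarrow> c \<one> = \<zero>\<^bsub>H\<^esub>"
proof -
  assume c: "c \<in> cocycles G T H \<pi>"
  then have c1: "c \<one> \<in> carrier H" by (rule cocycle_closed) simp
  then have "c \<one> = c \<one> \<oplus>\<^bsub>H\<^esub> c \<one>" using cocycle_mult[OF c one_closed one_closed] by (simp add: rep_one)
  then show ?thesis using c1 M.add.l_cancel_one by metis
qed

lemma hnorm_cocycle_inv: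
  assumes c: "c \<in> cocycles G T H \<pi>" and g: "g \<in> carrier G"
  shows "hnorm H (c (inv g)) = hnorm H (c g)"
proof -
  have cH: "c g \<in> carrier H" "c (inv g) \<in> carrier H" using g cocycle_closed[OF c] by auto
  have "\<pi> g (c (inv g)) \<oplus>\<^bsub>H\<^esub> c g = \<zero>\<^bsub>H\<^esub>"
    using cocycle_mult[OF c g, of "inv g"] g cocycle_at_one[OF c] by simp
  then have "\<pi> g (c (inv g)) = \<ominus>\<^bsub>H\<^esub> c g" 
    using M.minus_equality[of "\<pi> g (c (inv g))" "c g"] cH g by simp
  then show ?thesis using rep_hnorm[OF g cH(2)] hnorm_minus[OF cH(1)] by simp
qed

lemma cocycle_word_bound:
  assumes c: "c \<in> cocycles G T H \<pi>" and S: "S \<subseteq> carrier G"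
    and bound: "\<And>s. s \<in> S \<Longrightarrow> hnorm H (c s) \<le> \<epsilon>"
  shows "set xs \<subseteq> S \<union> m_inv G ` S \<Longrightarrow> hnorm H (c (foldr (\<otimes>) xs \<one>)) \<le> \<epsilon> * real (length xs)"
proof (induction xs)
  case Nil
  then show ?case using cocycle_at_one[OF c] by simp
next
  case (Cons x xs)
  have SS: "S \<union> m_inv G ` S \<subseteq> carrier G" using S by auto
  let ?y = "foldr (\<otimes>) xs \<one>"
  have x: "x \<in> carrier G" using Cons.prems SS by auto
  have "set xs \<subseteq> carrier G" using Cons.prems SS by auto
  then have y: "?y \<in> carrier G" by (rule foldr_mult_closed)
  have nx: "hnorm H (c x) \<le> \<epsilon>"
    using Cons.prems bound hnorm_cocycle_inv[OF c] S by (auto simp: subset_iff)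
  have "hnorm H (c (x \<otimes> ?y)) \<le> hnorm H (\<pi> x (c ?y)) + hnorm H (c x)"
    using x y cocycle_closed[OF c] by (simp add: cocycle_mult[OF c] hnorm_triangle)
  also have "\<dots> \<le> \<epsilon> * real (length xs) + \<epsilon>"
    using nx Cons x y cocycle_closed[OF c] by (simp add: rep_hnorm)
  finally show ?case by (simp add: algebra_simps)
qed

text \<open>
  Subtracting from \<open>b\<close> its projection and a coboundary leaves a cocycle with norm at most \<open>\<epsilon>\<close> on generators, hence
  at most \<open>\<epsilon> |g|\<close> at \<open>g\<close>. As \<open>|g| \<le> M \<parallel>b(g)\<parallel>\<close> off a compact set, the choice \<open>\<epsilon> = 1 / (2 M)\<close> leaves at least half
  of the growth to the projection, up to a constant. So where the projection is bounded the word length is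
  bounded, and word balls are relatively compact.
\<close>

theorem finite_dimensional_proper_cocycle:
  assumes HFD: "property_HFD G T" and growth: "linear_growth G T (\<lambda>g. hnorm H (b g))"
  shows "\<exists>B\<in>fd_spans. \<forall>R. \<exists>Q. compactin T Q \<and> {g \<in> carrier G. hnorm H (hproj (hspan B) (b g)) \<le> R} \<subseteq> Q"
proof -
  obtain S M Q where S: "compactin T S" "generate G S = carrier G" and M: "M > 0" and Q: "compactin T Q"
    and lin: "\<And>g. g \<in> carrier G \<Longrightarrow> g \<notin> Q \<Longrightarrow> real (word_length G S g) \<le> M * hnorm H (b g)"
    using growth unfolding linear_growth_def compact_generating_set_def by blast
  have SG: "S \<subseteq> carrier G" using S(1) topspace_eq compactin_subset_topspace by blast
  define \<epsilon> where "\<epsilon> = 1 / (2 * M)"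
  have e: "\<epsilon> > 0" using M by (simp add: \<epsilon>_def)
  obtain B v where B: "B \<in> fd_spans" and v: "v \<in> carrier H"
    and approx: "\<And>s. s \<in> S \<Longrightarrow> hnorm H ((b s \<ominus>\<^bsub>H\<^esub> hproj (hspan B) (b s)) \<ominus>\<^bsub>H\<^esub> (v \<ominus>\<^bsub>H\<^esub> \<pi> s v)) \<le> \<epsilon>"
    using finite_dimensional_approximation[OF HFD S(1) e] by blast
  note DB = fd_spansD[OF B]
  let ?P = "hproj (hspan B)"
  have Pb: "?P (b g) \<in> carrier H" if "g \<in> carrier G" for g using hproj_carrier[OF DB(4)] that by simp
  define d where "d = (\<lambda>g\<in>carrier G. (\<lambda>g\<in>carrier G. b g \<ominus>\<^bsub>H\<^esub> (\<lambda>g\<in>carrier G. ?P (b g)) g) g \<ominus>\<^bsub>H\<^esub> (\<lambda>g\<in>carrier G. v \<ominus>\<^bsub>H\<^esub> \<pi> g v) g)"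
  have cob: "(\<lambda>g\<in>carrier G. v \<ominus>\<^bsub>H\<^esub> \<pi> g v) \<in> cocycles G T H \<pi>"
    using coboundaries_subset[OF topspace_eq] v unfolding coboundaries_def by blast
  have d: "d \<in> cocycles G T H \<pi>"
    unfolding d_def by (rule cocycles_diff[OF cocycles_diff[OF b cocycle_hproj[OF DB(4,3) b]] cob])
  have dg: "d g = (b g \<ominus>\<^bsub>H\<^esub> ?P (b g)) \<ominus>\<^bsub>H\<^esub> (v \<ominus>\<^bsub>H\<^esub> \<pi> g v)" if "g \<in> carrier G" for g
    using that by (simp add: d_def)
  have dS: "hnorm H (d s) \<le> \<epsilon>" if "s \<in> S" for s using approx[OF that] dg that SG by auto
  have dw: "hnorm H (d g) \<le> \<epsilon> * real (word_length G S g)" if g: "g \<in> carrier G" for g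
  proof -
    obtain xs where xs: "length xs = word_length G S g" "set xs \<subseteq> S \<union> m_inv G ` S" "g = foldr (\<otimes>) xs \<one>"
      using word_length_word[OF SG, of g] S(2) g by blast
    show ?thesis using cocycle_word_bound[OF d SG dS xs(2)] unfolding xs(3)[symmetric] xs(1) by blast
  qed
  have small: "real (word_length G S g) \<le> 2 * M * (R + 2 * hnorm H v)"
    if g: "g \<in> carrier G" "g \<notin> Q" and R: "hnorm H (?P (b g)) \<le> R" for g R
  proof -
    have H: "d g \<in> carrier H" "?P (b g) \<in> carrier H" "\<pi> g v \<in> carrier H" "v \<ominus>\<^bsub>H\<^esub> \<pi> g v \<in> carrier H"
      using g v Pb cocycle_closed[OF d] by auto
    have "b g = d g \<oplus>\<^bsub>H\<^esub> (?P (b g) \<oplus>\<^bsub>H\<^esub> (v \<ominus>\<^bsub>H\<^esub> \<pi> g v))"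
      using g v H by (intro eq_by_ip) (auto simp: dg ip_simps)
    then have "hnorm H (b g) \<le> hnorm H (d g) + hnorm H (?P (b g) \<oplus>\<^bsub>H\<^esub> (v \<ominus>\<^bsub>H\<^esub> \<pi> g v))"
      using hnorm_triangle[OF H(1), of "?P (b g) \<oplus>\<^bsub>H\<^esub> (v \<ominus>\<^bsub>H\<^esub> \<pi> g v)"] H by simp
    also have "hnorm H (?P (b g) \<oplus>\<^bsub>H\<^esub> (v \<ominus>\<^bsub>H\<^esub> \<pi> g v)) \<le> hnorm H (?P (b g)) + hnorm H (v \<ominus>\<^bsub>H\<^esub> \<pi> g v)"
      by (rule hnorm_triangle[OF H(2,4)])
    also have "hnorm H (v \<ominus>\<^bsub>H\<^esub> \<pi> g v) \<le> 2 * hnorm H v"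
      using hnorm_triangle[of v "\<ominus>\<^bsub>H\<^esub> \<pi> g v"] v g by (simp add: a_minus_def hnorm_minus rep_hnorm)
    finally have "hnorm H (b g) \<le> \<epsilon> * real (word_length G S g) + R + 2 * hnorm H v"
      using dw[OF g(1)] R by linarith
    then have "M * hnorm H (b g) \<le> M * (\<epsilon> * real (word_length G S g) + R + 2 * hnorm H v)"
      using M by (intro mult_left_mono) auto
    also have "\<dots> = real (word_length G S g) / 2 + M * (R + 2 * hnorm H v)"
      using M by (simp add: \<epsilon>_def field_simps)
    finally show ?thesis using lin[OF g] by linarith
  qed
  have "\<exists>Q'. compactin T Q' \<and> {g \<in> carrier G. hnorm H (?P (b g)) \<le> R} \<subseteq> Q'" for R
  proof -
    obtain n :: nat where n: "2 * M * (R + 2 * hnorm H v) \<le> real n" using real_arch_simple by blast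
    obtain K where K: "compactin T K" "{g \<in> carrier G. word_length G S g \<le> n} \<subseteq> K"
      using compact_word_ball[OF S] by blast
    have "{g \<in> carrier G. hnorm H (?P (b g)) \<le> R} \<subseteq> Q \<union> K"
    proof
      fix g assume "g \<in> {g \<in> carrier G. hnorm H (?P (b g)) \<le> R}"
      then have g: "g \<in> carrier G" "hnorm H (?P (b g)) \<le> R" by auto
      show "g \<in> Q \<union> K"
      proof (cases "g \<in> Q")
        case False
        then have "real (word_length G S g) \<le> real n" using small[OF g(1) False g(2)] n by linarith
        then show ?thesis using K(2) g(1) by auto
      qed simp
    qed
    then show ?thesis using compactin_Un[OF Q K(1)] by blast
  qed
  then show ?thesis using B by blast
qed

end

section \<open>Complexification of an orthogonal representation\<close>

text \<open>
  The pair \<open>(x, y)\<close> stands for \<open>x + \<i> y\<close>.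
\<close>

definition complexify :: "'v inner_module \<Rightarrow> ('v \<times> 'v) inner_module" where
  "complexify H =
     \<lparr>carrier = carrier H \<times> carrier H, mult = undefined, one = undefined,
      ring.zero = (\<zero>\<^bsub>H\<^esub>, \<zero>\<^bsub>H\<^esub>),
      add = (\<lambda>p q. (fst p \<oplus>\<^bsub>H\<^esub> fst q, snd p \<oplus>\<^bsub>H\<^esub> snd q)),
      smult = (\<lambda>a p. (of_real (Re a) \<odot>\<^bsub>H\<^esub> fst p \<oplus>\<^bsub>H\<^esub> of_real (- Im a) \<odot>\<^bsub>H\<^esub> snd p,
                      of_real (Re a) \<odot>\<^bsub>H\<^esub> snd p \<oplus>\<^bsub>H\<^esub> of_real (Im a) \<odot>\<^bsub>H\<^esub> fst p)),
      ip = (\<lambda>p q. ip H (fst p) (fst q) + ip H (snd p) (snd q)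
                  + \<i> * (ip H (snd p) (fst q) - ip H (fst p) (snd q)))\<rparr>"

locale real_hilbert = hilbert_space \<real> H for H :: "'v inner_module"
begin

abbreviation "C \<equiv> complexify H"

lemma C_carrier: "carrier C = carrier H \<times> carrier H"
  and C_zero: "\<zero>\<^bsub>C\<^esub> = (\<zero>\<^bsub>H\<^esub>, \<zero>\<^bsub>H\<^esub>)"
  and C_add: "(x, y) \<oplus>\<^bsub>C\<^esub> (x', y') = (x \<oplus>\<^bsub>H\<^esub> x', y \<oplus>\<^bsub>H\<^esub> y')"
  and C_smult: "a \<odot>\<^bsub>C\<^esub> (x, y) = (of_real (Re a) \<odot>\<^bsub>H\<^esub> x \<oplus>\<^bsub>H\<^esub> of_real (- Im a) \<odot>\<^bsub>H\<^esub> y,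
      of_real (Re a) \<odot>\<^bsub>H\<^esub> y \<oplus>\<^bsub>H\<^esub> of_real (Im a) \<odot>\<^bsub>H\<^esub> x)"
  and C_ip: "ip C (x, y) (x', y') = ip H x x' + ip H y y' + \<i> * (ip H y x' - ip H x y')"
  by (simp_all add: complexify_def)

lemma smult_real_in [simp]: "\<lbrakk>a \<in> \<real>; x \<in> carrier H\<rbrakk> \<Longrightarrow> a \<odot>\<^bsub>H\<^esub> x \<in> carrier H"
  using smult_closed[of a x] by simp

declare ip_smult_left [simp]

lemma Im_ip [simp]: "\<lbrakk>x \<in> carrier H; y \<in> carrier H\<rbrakk> \<Longrightarrow> Im (ip H x y) = 0"
  using ip_closed[of x y] by (simp add: complex_is_Real_iff)

lemma C_abelian: "abelian_group C"
proof (rule abelian_groupI)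
  fix p assume "p \<in> carrier C"
  then obtain x y where p: "p = (x, y)" "x \<in> carrier H" "y \<in> carrier H" by (auto simp: C_carrier)
  show "\<exists>q\<in>carrier C. q \<oplus>\<^bsub>C\<^esub> p = \<zero>\<^bsub>C\<^esub>"
    using p by (intro bexI[of _ "(\<ominus>\<^bsub>H\<^esub> x, \<ominus>\<^bsub>H\<^esub> y)"]) (auto simp: C_carrier C_add C_zero M.l_neg)
qed (auto simp: C_carrier C_add C_zero M.a_ac)

lemma C_module: "Module.module (scalar_field UNIV) C"
proof (rule Module.moduleI)
  show "cring (scalar_field UNIV)" by (rule cring_scalar_field) simp
  show "abelian_group C" by (rule C_abelian)
qed (auto simp: C_carrier C_smult C_add ip_add_left algebra_simps intro!: eq_by_ip)

lemma C_inner: "inner_product_space UNIV C"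
proof (intro inner_product_space.intro inner_product_space_axioms.intro C_module)
  fix p q assume "p \<in> carrier C" "q \<in> carrier C"
  then obtain x y x' y' where pq: "p = (x, y)" "x \<in> carrier H" "y \<in> carrier H"
    "q = (x', y')" "x' \<in> carrier H" "y' \<in> carrier H" by (auto simp: C_carrier)
  show "ip C q p = cnj (ip C p q)"
    using pq ip_commute[of x x'] ip_commute[of y y'] ip_commute[of x y'] ip_commute[of y x']
    by (simp add: C_ip complex_eq_iff)
  show "ip C (a \<odot>\<^bsub>C\<^esub> p) q = a * ip C p q" for a
    using pq by (simp add: C_ip C_smult ip_add_left complex_eq_iff algebra_simps)
  fix r assume "r \<in> carrier C"
  then show "ip C (p \<oplus>\<^bsub>C\<^esub> q) r = ip C p r + ip C q r"
    using pq by (auto simp: C_carrier C_ip C_add ip_add_left algebra_simps)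
next
  fix p assume p: "p \<in> carrier C" "p \<noteq> \<zero>\<^bsub>C\<^esub>"
  then obtain x y where xy: "p = (x, y)" "x \<in> carrier H" "y \<in> carrier H" by (auto simp: C_carrier)
  then have "x \<noteq> \<zero>\<^bsub>H\<^esub> \<or> y \<noteq> \<zero>\<^bsub>H\<^esub>" using p by (simp add: C_zero)
  then show "0 < Re (ip C p p)"
    using xy ip_pos[of x] ip_pos[of y] ip_nonneg[of x] ip_nonneg[of y] by (auto simp: C_ip)
qed auto

sublocale C: inner_product_space UNIV C by (rule C_inner)

lemma C_minus: "\<lbrakk>x \<in> carrier H; y \<in> carrier H\<rbrakk> \<Longrightarrow> \<ominus>\<^bsub>C\<^esub> (x, y) = (\<ominus>\<^bsub>H\<^esub> x, \<ominus>\<^bsub>H\<^esub> y)"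
  by (intro C.M.minus_equality) (auto simp: C_carrier C_zero C_add M.l_neg)

lemma C_hdist:
  assumes "x \<in> carrier H" "y \<in> carrier H" "x' \<in> carrier H" "y' \<in> carrier H"
  shows "hdist C (x, y) (x', y') = sqrt ((hdist H x x')\<^sup>2 + (hdist H y y')\<^sup>2)"
proof -
  have "(x, y) \<ominus>\<^bsub>C\<^esub> (x', y') = (x \<ominus>\<^bsub>H\<^esub> x', y \<ominus>\<^bsub>H\<^esub> y')"
    using assms by (simp add: a_minus_def C_minus C_add)
  then show ?thesis
    using assms by (simp add: hdist_def C_carrier hnorm_sq) (simp add: hnorm_def C_ip)
qed

lemma C_hdist_le:
  assumes "x \<in> carrier H" "y \<in> carrier H" "x' \<in> carrier H" "y' \<in> carrier H"
  shows "hdist C (x, y) (x', y') \<le> hdist H x x' + hdist H y y'"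
    "hdist H x x' \<le> hdist C (x, y) (x', y')" "hdist H y y' \<le> hdist C (x, y) (x', y')"
  unfolding C_hdist[OF assms] by (auto intro: real_le_rsqrt sqrt_sum_squares_le_sum)

lemma C_complete: "Metric_space.mcomplete (carrier C) (hdist C)"
  unfolding C.Metric.mcomplete_def
proof (intro allI impI)
  fix s assume c: "C.Metric.MCauchy s"
  define u where "u = (\<lambda>n. fst (s n))"
  define v where "v = (\<lambda>n. snd (s n))"
  have sC: "s n \<in> carrier C" for n using c unfolding C.Metric.MCauchy_def by blast
  then have H: "u n \<in> carrier H" "v n \<in> carrier H" for n
    by (metis C_carrier mem_Times_iff u_def, metis C_carrier mem_Times_iff v_def)
  have s: "s n = (u n, v n)" for n by (simp add: u_def v_def)
  have *: "\<exists>N. \<forall>n n'. N \<le> n \<longrightarrow> N \<le> n' \<longrightarrow> hdist C (u n, v n) (u n', v n') < \<epsilon>" if "\<epsilon> > 0" for \<epsilon>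
    using c that unfolding C.Metric.MCauchy_def s by blast
  have "Metric.MCauchy u" "Metric.MCauchy v"
    unfolding Metric.MCauchy_def using H
    by (auto, meson * C_hdist_le(2) H order.strict_trans1, meson * C_hdist_le(3) H order.strict_trans1)
  then obtain x y where x: "limitin Metric.mtopology u x sequentially" and y: "limitin Metric.mtopology v y sequentially"
    using complete unfolding Metric.mcomplete_def by blast
  have xy: "x \<in> carrier H" "y \<in> carrier H" using x y by (auto simp: Metric.limit_metric_sequentially)
  have "limitin C.Metric.mtopology s (x, y) sequentially"
    unfolding C.Metric.limit_metric_sequentially
  proof (intro conjI allI impI)
    show "(x, y) \<in> carrier C" using xy by (simp add: C_carrier)
    fix \<epsilon> :: real assume e: "\<epsilon> > 0"
    obtain N where N: "\<And>n. N \<le> n \<Longrightarrow> hdist H (u n) x < \<epsilon> / 2"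
      using x half_gt_zero[OF e] unfolding Metric.limit_metric_sequentially by blast
    obtain M where M: "\<And>n. M \<le> n \<Longrightarrow> hdist H (v n) y < \<epsilon> / 2"
      using y half_gt_zero[OF e] unfolding Metric.limit_metric_sequentially by blast
    have "s n \<in> carrier C \<and> hdist C (s n) (x, y) < \<epsilon>" if "max N M \<le> n" for n
      using C_hdist_le(1)[OF H xy, of n n] N[of n] M[of n] that sC[of n] by (simp add: s)
    then show "\<exists>N. \<forall>n\<ge>N. s n \<in> carrier C \<and> hdist C (s n) (x, y) < \<epsilon>" by blast
  qed
  then show "\<exists>x. limitin C.Metric.mtopology s x sequentially" ..
qed

lemma C_continuous:
  assumes f: "continuous_map Y (htop H) f" and g: "continuous_map Y (htop H) g"
  shows "continuous_map Y (htop C) (\<lambda>x. (f x, g x))"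
  unfolding C.continuous_map_htop
proof (intro conjI ballI allI impI)
  have fH: "f x \<in> carrier H" and gH: "g x \<in> carrier H" if "x \<in> topspace Y" for x
    using continuous_map_htop_closed[OF f that] continuous_map_htop_closed[OF g that] by auto
  then show "(f x, g x) \<in> carrier C" if "x \<in> topspace Y" for x using that by (simp add: C_carrier)
  fix x and \<epsilon> :: real assume x: "x \<in> topspace Y" and e: "\<epsilon> > 0"
  obtain U where U: "openin Y U" "x \<in> U" "\<forall>y\<in>U. hdist H (f x) (f y) < \<epsilon>/2"
    using f x half_gt_zero[OF e] unfolding continuous_map_htop by meson
  obtain V where V: "openin Y V" "x \<in> V" "\<forall>y\<in>V. hdist H (g x) (g y) < \<epsilon>/2"
    using g x half_gt_zero[OF e] unfolding continuous_map_htop by meson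
  have "hdist C (f x, g x) (f y, g y) < \<epsilon>" if y: "y \<in> U \<inter> V" for y
  proof -
    have "y \<in> topspace Y" using y U(1) openin_subset by blast
    then have "hdist C (f x, g x) (f y, g y) \<le> hdist H (f x) (f y) + hdist H (g x) (g y)"
      using fH gH x by (intro C_hdist_le(1)) auto
    then show ?thesis using U(3) V(3) y by fastforce
  qed
  then show "\<exists>U. openin Y U \<and> x \<in> U \<and> (\<forall>y\<in>U. hdist C (f x, g x) (f y, g y) < \<epsilon>)"
    using U V by (meson openin_Int IntI)
qed

end

text \<open>
  Property \<open>H\<^sub>F\<^sub>D\<close> speaks of unitary representations only. The representation acts on both components of a pair,
  and the cocycle \<open>(b, 0)\<close> has the same norms as \<open>b\<close>.
\<close>

theorem complexified_cocycle:
  fixes G :: "('g, 'm) monoid_scheme" (structure) and H :: "'v inner_module"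
  assumes T: "topspace T = carrier G" and rep: "orthogonal_rep G T H \<pi>" and b: "b \<in> cocycles G T H \<pi>"
  shows "\<exists>\<pi>' b'. unitary_rep G T (complexify H) \<pi>' \<and> b' \<in> cocycles G T (complexify H) \<pi>' \<and>
    (\<forall>g\<in>carrier G. hnorm (complexify H) (b' g) = hnorm H (b g))"
proof -
  interpret hilbert_rep G T \<real> H \<pi> by (rule rep)
  interpret real_hilbert H by (intro real_hilbert.intro hilbert_space_axioms)
  interpret G: group G by (rule groupG)
  define \<rho> where "\<rho> = (\<lambda>g. \<lambda>p\<in>carrier C. (\<pi> g (fst p), \<pi> g (snd p)))"
  have \<rho>: "\<rho> g (x, y) = (\<pi> g x, \<pi> g y)" if "x \<in> carrier H" "y \<in> carrier H" for g x y
    using that by (simp add: \<rho>_def C_carrier)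
  have one: "\<pi> \<one> x = x" if "x \<in> carrier H" for x
    using id_eq_one that by (metis restrict_apply')
  have act: "group_action G (carrier C) \<rho>"
    unfolding \<rho>_def by (rule G.group_action_restrictI) (auto simp: C_carrier rep_closed composition_rule one)
  have rep': "unitary_rep G T C \<rho>"
  proof (intro hilbert_rep.intro hilbert_rep_axioms.intro act hilbert_space.intro hilbert_space_axioms.intro C_inner C_complete)
    show "continuous_map T (htop C) (\<lambda>g. \<rho> g p)" if p: "p \<in> carrier C" for p
    proof -
      obtain x y where "p = (x, y)" "x \<in> carrier H" "y \<in> carrier H" using p by (auto simp: C_carrier)
      then show ?thesis using C_continuous[OF rep_continuous rep_continuous] by (simp add: \<rho>)
    qed
  qed (auto simp: C_carrier C_add C_smult C_ip \<rho> rep_closed rep_add rep_smult rep_ip)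
  interpret C': hilbert_rep G T UNIV C \<rho> by (rule rep')
  let ?b = "\<lambda>g\<in>carrier G. (b g, \<zero>\<^bsub>H\<^esub>)"
  have "?b \<in> cocycles G T C \<rho>"
  proof (rule C'.cocyclesI[OF T])
    show "continuous_map T (htop C) (\<lambda>g. (b g, \<zero>\<^bsub>H\<^esub>))"
      by (rule C_continuous[OF cocycle_continuous[OF b]]) (simp add: htop_eq)
    show "(b (g \<otimes> h), \<zero>\<^bsub>H\<^esub>) = \<rho> g (b h, \<zero>\<^bsub>H\<^esub>) \<oplus>\<^bsub>C\<^esub> (b g, \<zero>\<^bsub>H\<^esub>)" if "g \<in> carrier G" "h \<in> carrier G" for g h
      using that cocycle_closed[OF b] by (simp add: \<rho> C_add cocycle_mult[OF b] rep_zero)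
  qed
  moreover have "hnorm C (?b g) = hnorm H (b g)" if "g \<in> carrier G" for g
    using that cocycle_closed[OF b that] ip_commute[of "b g" "\<zero>\<^bsub>H\<^esub>"] by (simp add: hnorm_def C_ip)
  ultimately show ?thesis using rep' by blast
qed

section \<open>Finitely supported sequences\<close>

text \<open>
  A real inner product space of infinite dimension contains copies of all Euclidean spaces, so that a dimension
  that is not known in advance can be treated with type classes.
\<close>

typedef finseq = "{f :: nat \<Rightarrow> complex. finite {i. f i \<noteq> 0}}"
  morphisms entry Abs_finseq
  by (rule exI[of _ "\<lambda>_. 0"]) simp

setup_lifting type_definition_finseq

lemma finite_support: "finite {i. entry x i \<noteq> 0}"
  using entry[of x] by simp

lemma finseq_eqI: "(\<And>i. entry x i = entry y i) \<Longrightarrow> x = y"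
  by (metis entry_inject ext)

instantiation finseq :: real_vector
begin

lift_definition zero_finseq :: finseq is "\<lambda>_. 0" by simp
lift_definition plus_finseq :: "finseq \<Rightarrow> finseq \<Rightarrow> finseq" is "\<lambda>f g i. f i + g i"
  subgoal for f g by (rule finite_subset[of _ "{i. f i \<noteq> 0} \<union> {i. g i \<noteq> 0}"]) auto
  done
lift_definition uminus_finseq :: "finseq \<Rightarrow> finseq" is "\<lambda>f i. - f i" by simp
lift_definition minus_finseq :: "finseq \<Rightarrow> finseq \<Rightarrow> finseq" is "\<lambda>f g i. f i - g i"
  subgoal for f g by (rule finite_subset[of _ "{i. f i \<noteq> 0} \<union> {i. g i \<noteq> 0}"]) auto
  done
lift_definition scaleR_finseq :: "real \<Rightarrow> finseq \<Rightarrow> finseq" is "\<lambda>r f i. r *\<^sub>R f i"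
  subgoal for r f by (rule finite_subset[of _ "{i. f i \<noteq> 0}"]) auto
  done

instance
  by standard (transfer; simp add: fun_eq_iff algebra_simps)+

end

lemmas entry_simps [simp] = zero_finseq.rep_eq plus_finseq.rep_eq minus_finseq.rep_eq
  uminus_finseq.rep_eq scaleR_finseq.rep_eq

instantiation finseq :: real_inner
begin

definition inner_finseq :: "finseq \<Rightarrow> finseq \<Rightarrow> real" where
  "inner_finseq x y = (\<Sum>i | entry x i \<noteq> 0. entry x i \<bullet> entry y i)"
definition norm_finseq :: "finseq \<Rightarrow> real" where
  "norm_finseq x = sqrt (x \<bullet> x)"
definition dist_finseq :: "finseq \<Rightarrow> finseq \<Rightarrow> real" where
  "dist_finseq x y = norm (x - y)"
definition sgn_finseq :: "finseq \<Rightarrow> finseq" where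
  "sgn_finseq x = x /\<^sub>R norm x"
definition uniformity_finseq :: "(finseq \<times> finseq) filter" where
  "uniformity_finseq = (INF e\<in>{0<..}. principal {(x, y). dist x y < e})"
definition open_finseq :: "finseq set \<Rightarrow> bool" where
  "open_finseq U \<longleftrightarrow> (\<forall>x\<in>U. eventually (\<lambda>(x', y). x' = x \<longrightarrow> y \<in> U) uniformity)"

lemma inner_finseq_superset:
  assumes "finite A" "\<And>i. i \<notin> A \<Longrightarrow> entry x i = 0 \<or> entry y i = 0"
  shows "x \<bullet> y = (\<Sum>i\<in>A. entry x i \<bullet> entry y i)"
proof -
  have "x \<bullet> y = (\<Sum>i\<in>{i. entry x i \<noteq> 0} \<union> A. entry x i \<bullet> entry y i)"
    unfolding inner_finseq_def by (rule sum.mono_neutral_left) (use assms(1) finite_support in auto)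
  also have "\<dots> = (\<Sum>i\<in>A. entry x i \<bullet> entry y i)"
  proof (rule sum.mono_neutral_right)
    show "\<forall>i\<in>{i. entry x i \<noteq> 0} \<union> A - A. entry x i \<bullet> entry y i = 0" using assms(2) by fastforce
  qed (use assms(1) finite_support in auto)
  finally show ?thesis .
qed

instance
proof
  fix x y z :: finseq and r s :: real
  let ?A = "{i. entry x i \<noteq> 0} \<union> {i. entry y i \<noteq> 0} \<union> {i. entry z i \<noteq> 0}"
  have A: "finite ?A" using finite_support by simp
  show "x \<bullet> y = y \<bullet> x"
    using inner_finseq_superset[of ?A x y] inner_finseq_superset[of ?A y x] A by (auto simp: inner_commute)
  show "(x + y) \<bullet> z = x \<bullet> z + y \<bullet> z"
    using inner_finseq_superset[of ?A "x + y" z] inner_finseq_superset[of ?A x z] inner_finseq_superset[of ?A y z] A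
    by (auto simp: inner_add_left sum.distrib)
  show "(r *\<^sub>R x) \<bullet> y = r * (x \<bullet> y)"
    using inner_finseq_superset[of ?A "r *\<^sub>R x" y] inner_finseq_superset[of ?A x y] A
    by (auto simp: sum_distrib_left)
  show "0 \<le> x \<bullet> x" by (auto simp: inner_finseq_def intro: sum_nonneg)
  show "x \<bullet> x = 0 \<longleftrightarrow> x = 0"
  proof
    assume "x \<bullet> x = 0"
    then have "\<forall>i\<in>{i. entry x i \<noteq> 0}. entry x i \<bullet> entry x i = 0"
      unfolding inner_finseq_def using finite_support by (subst (asm) sum_nonneg_eq_0_iff) auto
    then have "entry x i = 0" for i by auto
    then show "x = 0" by (intro finseq_eqI) (simp add: zero_finseq.rep_eq)
  qed (simp add: inner_finseq_def zero_finseq.rep_eq)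
  show "norm x = sqrt (x \<bullet> x)" by (rule norm_finseq_def)
  show "dist x y = norm (x - y)" by (rule dist_finseq_def)
  show "sgn x = x /\<^sub>R norm x" by (rule sgn_finseq_def)
  show "uniformity = (INF e\<in>{0<..}. principal {(x :: finseq, y). dist x y < e})" by (rule uniformity_finseq_def)
  show "open U \<longleftrightarrow> (\<forall>x\<in>U. eventually (\<lambda>(x', y). x' = x \<longrightarrow> y \<in> U) uniformity)" for U :: "finseq set"
    by (rule open_finseq_def)
qed

end

lemma entry_sum: "entry (\<Sum>x\<in>A. f x) i = (\<Sum>x\<in>A. entry (f x) i)"
  by (induction A rule: infinite_finite_induct) auto

lift_definition trunc :: "nat \<Rightarrow> (nat \<Rightarrow> complex) \<Rightarrow> finseq" is "\<lambda>n f i. if i < n then f i else 0"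
  by simp

lemma finite_dim_trunc: "\<exists>C. finite C \<and> range (trunc n) \<subseteq> span C"
proof (intro exI conjI subsetI)
  let ?d = "\<lambda>i z. trunc n (\<lambda>j. if j = i then z else 0)"
  let ?C = "(\<lambda>(i, z). ?d i z) ` ({..<n} \<times> {1, \<i>})"
  show "finite ?C" by simp
  fix x assume "x \<in> range (trunc n)"
  then obtain f where x: "x = trunc n f" by blast
  have "x = (\<Sum>i<n. Re (f i) *\<^sub>R ?d i 1 + Im (f i) *\<^sub>R ?d i \<i>)"
  proof (rule finseq_eqI)
    fix j
    have "entry (\<Sum>i<n. Re (f i) *\<^sub>R ?d i 1 + Im (f i) *\<^sub>R ?d i \<i>) j
        = (\<Sum>i<n. if i = j then f j else 0)"
      unfolding entry_sum by (intro sum.cong refl) (auto simp: trunc.rep_eq complex_eq_iff)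
    then show "entry x j = entry (\<Sum>i<n. Re (f i) *\<^sub>R ?d i 1 + Im (f i) *\<^sub>R ?d i \<i>) j"
      by (simp add: x trunc.rep_eq)
  qed
  also have "\<dots> \<in> span ?C"
    by (intro span_sum span_add span_scale span_base) force+
  finally show "x \<in> span ?C" .
qed

section \<open>Continuity and properness with values in a normed space\<close>

definition continuous_into_metric :: "'g topology \<Rightarrow> ('g \<Rightarrow> 'a::metric_space) \<Rightarrow> bool" where
  "continuous_into_metric T f \<longleftrightarrow>
     (\<forall>x\<in>topspace T. \<forall>\<epsilon>>0. \<exists>U. openin T U \<and> x \<in> U \<and> (\<forall>y\<in>U. dist (f x) (f y) < \<epsilon>))"

definition proper_into_normed :: "'g topology \<Rightarrow> ('g \<Rightarrow> 'a::real_normed_vector) \<Rightarrow> bool" where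
  "proper_into_normed T f \<longleftrightarrow> (\<forall>R. \<exists>Q. compactin T Q \<and> {x \<in> topspace T. norm (f x) \<le> R} \<subseteq> Q)"

section \<open>A copy of the finite-dimensional cocycle in a sequence space\<close>

context unitary_cocycle
begin

text \<open>
  Coordinates with respect to an orthonormal basis \<open>e\<close> of a finite-dimensional subrepresentation \<open>W\<close> embed \<open>W\<close>
  isometrically in \<open>finseq\<close>; the representation is extended by the identity on the orthogonal complement, so
  that it acts by isometries of the whole space.
\<close>

theorem finite_dimensional_model:
  assumes HFD: "property_HFD G T" and growth: "linear_growth G T (\<lambda>g. hnorm H (b g))"
  shows "\<exists>(\<sigma> :: 'g \<Rightarrow> finseq \<Rightarrow> finseq) V a. finite_dimensional_cocycle G \<sigma> V a \<and>
    continuous_into_metric T a \<and> (\<forall>x. continuous_into_metric T (\<lambda>g. \<sigma> g x)) \<and> proper_into_normed T a"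
proof -
  obtain B where B: "B \<in> fd_spans"
    and proper: "\<And>R. \<exists>Q. compactin T Q \<and> {g \<in> carrier G. hnorm H (hproj (hspan B) (b g)) \<le> R} \<subseteq> Q"
    using finite_dimensional_proper_cocycle[OF assms] by blast
  note DB = fd_spansD[OF B]
  define W where "W = hspan B"
  have W: "linear_subspace W" and PW: "projectable W" and invW: "\<And>g x. g \<in> carrier G \<Longrightarrow> x \<in> W \<Longrightarrow> \<pi> g x \<in> W"
    using DB by (auto simp: W_def invariant_def)
  note D = linear_subspaceD[OF W]
  obtain n e where e: "orthonormal_basis n e W"
    using orthonormal_basis_exists[OF DB(1,2)] unfolding W_def by blast
  have eH: "e i \<in> carrier H" "e i \<in> W" if "i < n" for i
    using e D(3) that by (auto simp: orthonormal_basis_def)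
  \<comment> \<open>On \<open>W\<close> the maps \<open>\<iota>\<close> and \<open>\<kappa>\<close> are inverse to each other; on all of \<open>finseq\<close>, \<open>\<kappa>\<close> is the adjoint of \<open>\<iota>\<close>,
    so that \<open>\<iota> \<circ> \<kappa>\<close> is the orthogonal projection.\<close>
  define \<kappa> where "\<kappa> = (\<lambda>x. lincomb e (entry x) n)"
  define \<iota> where "\<iota> = (\<lambda>v. trunc n (\<lambda>i. ip H v (e i)))"
  have \<kappa>W: "\<kappa> x \<in> W" for x unfolding \<kappa>_def by (rule lincomb_in[OF W eH(2)])
  then have \<kappa>H [simp]: "\<kappa> x \<in> carrier H" for x using D(3) by blast
  have ip_\<kappa>: "ip H (\<kappa> x) z = (\<Sum>i<n. entry x i * ip H (e i) z)" if "z \<in> carrier H" for x z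
    unfolding \<kappa>_def by (rule ip_lincomb[OF that eH(1)])
  have \<kappa>_add: "\<kappa> (x + y) = \<kappa> x \<oplus>\<^bsub>H\<^esub> \<kappa> y" and \<kappa>_diff: "\<kappa> (x - y) = \<kappa> x \<ominus>\<^bsub>H\<^esub> \<kappa> y"
    and \<kappa>_scale: "\<kappa> (r *\<^sub>R x) = of_real r \<odot>\<^bsub>H\<^esub> \<kappa> x" for x y r
    by (intro eq_by_ip; simp add: ip_\<kappa> ip_simps algebra_simps sum.distrib sum_subtractf sum_distrib_left scaleR_conv_of_real)+
  have \<iota>_add: "\<iota> (u \<oplus>\<^bsub>H\<^esub> v) = \<iota> u + \<iota> v" and \<iota>_diff: "\<iota> (u \<ominus>\<^bsub>H\<^esub> v) = \<iota> u - \<iota> v"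
    if "u \<in> carrier H" "v \<in> carrier H" for u v
    using that eH(1) by (auto intro!: finseq_eqI simp: \<iota>_def trunc.rep_eq ip_simps)
  have \<iota>_scale: "\<iota> (of_real r \<odot>\<^bsub>H\<^esub> u) = r *\<^sub>R \<iota> u" if "u \<in> carrier H" for u r
    using that eH(1) by (auto intro!: finseq_eqI simp: \<iota>_def trunc.rep_eq ip_simps scaleR_conv_of_real)
  have \<kappa>\<iota>: "\<kappa> (\<iota> v) = v" if v: "v \<in> W" for v
  proof -
    have "lincomb e (entry (\<iota> v)) m = lincomb e (\<lambda>i. ip H v (e i)) m" if "m \<le> n" for m
      using that by (induction m) (auto simp: \<iota>_def trunc.rep_eq)
    then show ?thesis using lincomb_basis(2)[OF W e v] by (simp add: \<kappa>_def)
  qed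
  have inner_\<iota>: "x \<bullet> \<iota> v = Re (ip H (\<kappa> x) v)" if v: "v \<in> carrier H" for x v
  proof -
    have "x \<bullet> \<iota> v = (\<Sum>i<n. entry x i \<bullet> entry (\<iota> v) i)"
      by (rule inner_finseq_superset) (auto simp: \<iota>_def trunc.rep_eq)
    also have "\<dots> = (\<Sum>i<n. Re (entry x i * ip H (e i) v))"
    proof (rule sum.cong[OF refl])
      fix i assume "i \<in> {..<n}"
      then have i: "i < n" by simp
      then show "entry x i \<bullet> entry (\<iota> v) i = Re (entry x i * ip H (e i) v)"
        using ip_commute[OF v eH(1)[OF i]] by (simp add: \<iota>_def trunc.rep_eq inner_complex_def)
    qed
    also have "\<dots> = Re (ip H (\<kappa> x) v)" using v by (simp add: ip_\<kappa>)
    finally show ?thesis .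
  qed
  have norm_\<iota>: "norm (\<iota> v) = hnorm H v" if "v \<in> W" for v
    using inner_\<iota>[of v "\<iota> v"] \<kappa>\<iota>[OF that] D(3)[OF that] by (simp add: norm_eq_sqrt_inner hnorm_def)
  have \<iota>_cont: "continuous_into_metric T (\<lambda>g. \<iota> (f g))"
    if f: "continuous_map T (htop H) f" "\<And>g. g \<in> carrier G \<Longrightarrow> f g \<in> W" for f
    unfolding continuous_into_metric_def topspace_eq
  proof (intro ballI allI impI)
    fix x and \<epsilon> :: real assume x: "x \<in> carrier G" and "\<epsilon> > 0"
    then obtain U where U: "openin T U" "x \<in> U" "\<forall>y\<in>U. hdist H (f x) (f y) < \<epsilon>"
      using f(1) unfolding continuous_map_htop topspace_eq by meson
    have "dist (\<iota> (f x)) (\<iota> (f y)) < \<epsilon>" if y: "y \<in> U" for y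
    proof -
      have yG: "y \<in> carrier G" using y U(1) openin_subset topspace_eq by blast
      have W2: "f x \<in> W" "f y \<in> W" using f(2) x yG by auto
      then have "f x \<ominus>\<^bsub>H\<^esub> f y \<in> W" by (rule linear_subspace_diff[OF W])
      then have "dist (\<iota> (f x)) (\<iota> (f y)) = hdist H (f x) (f y)"
        using norm_\<iota>[of "f x \<ominus>\<^bsub>H\<^esub> f y"] \<iota>_diff[of "f x" "f y"] D(3) W2 by (simp add: dist_norm hdist_eq)
      then show ?thesis using U(3) y by simp
    qed
    then show "\<exists>U. openin T U \<and> x \<in> U \<and> (\<forall>y\<in>U. dist (\<iota> (f x)) (\<iota> (f y)) < \<epsilon>)" using U by blast
  qed
  define \<sigma> where "\<sigma> = (\<lambda>g x. \<iota> (\<pi> g (\<kappa> x)) + (x - \<iota> (\<kappa> x)))"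
  define V where "V = range (\<lambda>x. \<iota> (\<kappa> x))"
  have \<iota>V: "\<iota> v \<in> V" if "v \<in> W" for v using \<kappa>\<iota>[OF that] unfolding V_def by (metis rangeI)
  define a where "a = (\<lambda>g. \<iota> (hproj W (b g)))"
  have pW: "hproj W (b g) \<in> W" if "g \<in> carrier G" for g using hproj(1)[OF PW] that by simp
  have \<kappa>\<sigma>: "\<kappa> (\<sigma> g x) = \<pi> g (\<kappa> x)" if g: "g \<in> carrier G" for g x
  proof -
    have "\<kappa> (\<sigma> g x) = \<pi> g (\<kappa> x) \<oplus>\<^bsub>H\<^esub> (\<kappa> x \<ominus>\<^bsub>H\<^esub> \<kappa> x)"
      using g by (simp add: \<sigma>_def \<kappa>_add \<kappa>_diff \<kappa>\<iota> \<kappa>W invW)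
    also have "\<dots> = \<pi> g (\<kappa> x)" using g by (intro eq_by_ip) (auto simp: ip_simps)
    finally show ?thesis .
  qed
  have \<sigma>\<iota>: "\<sigma> g (\<iota> v) = \<iota> (\<pi> g v)" if "g \<in> carrier G" "v \<in> W" for g v
    using that by (simp add: \<sigma>_def \<kappa>\<iota>)
  have lin_\<iota>\<kappa>: "linear (\<lambda>x. \<iota> (\<kappa> x))"
    by (rule linearI) (simp_all add: \<kappa>_add \<kappa>_scale \<iota>_add \<iota>_scale)
  have "finite_dimensional_cocycle G \<sigma> V a"
  proof (intro finite_dimensional_cocycle.intro linear_isometric_rep.intro linear_isometric_rep_axioms.intro
      finite_dimensional_cocycle_axioms.intro is_group)
    fix g assume g: "g \<in> carrier G"
    show "linear (\<sigma> g)"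
      using g by (intro linearI) (simp_all add: \<sigma>_def \<kappa>_add \<kappa>_scale rep_add rep_smult \<iota>_add \<iota>_scale algebra_simps)
    show "\<sigma> g x \<bullet> \<sigma> g y = x \<bullet> y" for x y
    proof -
      have orth: "(x - \<iota> (\<kappa> x)) \<bullet> \<iota> v = 0" if "v \<in> W" for x v
        using that D(3)[OF that] by (simp add: inner_\<iota> \<kappa>_diff \<kappa>\<iota> \<kappa>W ip_simps)
      have "\<sigma> g x \<bullet> \<sigma> g y = \<iota> (\<pi> g (\<kappa> x)) \<bullet> \<iota> (\<pi> g (\<kappa> y)) + (x - \<iota> (\<kappa> x)) \<bullet> (y - \<iota> (\<kappa> y))"
        using orth[OF invW[OF g \<kappa>W], of x y] orth[OF invW[OF g \<kappa>W], of y x]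
        by (simp add: \<sigma>_def inner_add_left inner_add_right inner_commute)
      also have "\<iota> (\<pi> g (\<kappa> x)) \<bullet> \<iota> (\<pi> g (\<kappa> y)) = Re (ip H (\<kappa> x) (\<kappa> y))"
        using g by (simp add: inner_\<iota> \<kappa>\<iota> \<kappa>W invW rep_ip)
      also have "(x - \<iota> (\<kappa> x)) \<bullet> (y - \<iota> (\<kappa> y)) = (x - \<iota> (\<kappa> x)) \<bullet> y"
        using orth[OF \<kappa>W, of x y] by (simp add: inner_diff_right)
      also have "\<dots> = x \<bullet> y - Re (ip H (\<kappa> y) (\<kappa> x))"
        using inner_\<iota>[of "\<kappa> x" y] inner_commute[of y "\<iota> (\<kappa> x)"] by (simp add: inner_diff_left)
      finally show ?thesis using ip_commute[of "\<kappa> x" "\<kappa> y"] by simp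
    qed
    show "\<sigma> (g \<otimes> h) x = \<sigma> g (\<sigma> h x)" if h: "h \<in> carrier G" for h x
      using g h \<kappa>\<sigma>[OF h, of x] composition_rule[of "\<kappa> x" g h] by (simp add: \<sigma>_def)
    show "\<sigma> g x \<in> V" if x: "x \<in> V" for x
    proof -
      obtain y where "x = \<iota> (\<kappa> y)" using x unfolding V_def by auto
      then show ?thesis using \<sigma>\<iota>[OF g \<kappa>W] \<iota>V[OF invW[OF g \<kappa>W]] by simp
    qed
    show "a g \<in> V" using \<iota>V[OF pW[OF g]] by (simp add: a_def)
    show "a (g \<otimes> h) = \<sigma> g (a h) + a g" if h: "h \<in> carrier G" for h
      using g h D(3) pW invW hproj_carrier[OF PW]
      by (simp add: a_def \<sigma>\<iota> cocycle_mult[OF b] hproj_add[OF PW] hproj_rep[OF PW] \<iota>_add invariant_def)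
  next
    show "subspace V" unfolding V_def by (rule linear_subspace_image[OF lin_\<iota>\<kappa> subspace_UNIV])
    have "V \<subseteq> range (trunc n)" by (auto simp: V_def \<iota>_def)
    then show "\<exists>C. finite C \<and> V \<subseteq> span C" using finite_dim_trunc[of n] by (meson order_trans)
  qed
  moreover have "continuous_into_metric T a"
  proof -
    have "(\<lambda>g\<in>carrier G. hproj W (b g)) \<in> cocycles G T H \<pi>"
      using cocycle_hproj[OF PW _ b] invW by (simp add: invariant_def)
    from cocycle_continuous[OF this] have "continuous_map T (htop H) (\<lambda>g. hproj W (b g))"
      by (rule continuous_map_eq) (simp add: topspace_eq)
    then show ?thesis unfolding a_def by (rule \<iota>_cont) (rule pW)
  qed
  moreover have "continuous_into_metric T (\<lambda>g. \<sigma> g x)" for x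
  proof -
    have "continuous_into_metric T (\<lambda>g. \<iota> (\<pi> g (\<kappa> x)))"
      by (rule \<iota>_cont) (use rep_continuous invW \<kappa>W in auto)
    then show ?thesis by (simp add: continuous_into_metric_def \<sigma>_def dist_norm)
  qed
  moreover have "proper_into_normed T a"
    using proper pW norm_\<iota> unfolding proper_into_normed_def topspace_eq a_def W_def[symmetric]
    by (simp cong: conj_cong)
  ultimately show ?thesis by blast
qed

end

section \<open>A finite-dimensional subspace as a Euclidean space\<close>

text \<open>
  The real inner product space \<open>V\<close> as a Hilbert space structure, transported along \<open>j\<close>, which is meant to be
  injective on \<open>V\<close>.
\<close>

definition subspace_model :: "('a::real_inner \<Rightarrow> 'w) \<Rightarrow> 'a set \<Rightarrow> 'w inner_module" where
  "subspace_model j V =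
     \<lparr>carrier = j ` V, mult = undefined, one = undefined, ring.zero = j 0,
      add = (\<lambda>p q. j (inv_into V j p + inv_into V j q)),
      smult = (\<lambda>a p. j (Re a *\<^sub>R inv_into V j p)),
      ip = (\<lambda>p q. of_real (inv_into V j p \<bullet> inv_into V j q))\<rparr>"

locale subspace_copy =
  fixes V :: "'a::real_inner set" and j :: "'a \<Rightarrow> 'w"
  assumes V: "subspace V" and fin: "\<exists>C. finite C \<and> V \<subseteq> span C" and inj: "inj_on j V"
begin

abbreviation "E \<equiv> subspace_model j V"

lemmas sub = subspace_0[OF V] subspace_add[OF V] subspace_diff[OF V] subspace_scale[OF V] subspace_neg[OF V]

lemma inv_j [simp]: "x \<in> V \<Longrightarrow> inv_into V j (j x) = x"
  using inj by simp

lemma E_carrier: "carrier E = j ` V"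
  and E_zero: "\<zero>\<^bsub>E\<^esub> = j 0"
  and E_add: "\<lbrakk>x \<in> V; y \<in> V\<rbrakk> \<Longrightarrow> j x \<oplus>\<^bsub>E\<^esub> j y = j (x + y)"
  and E_smult: "x \<in> V \<Longrightarrow> a \<odot>\<^bsub>E\<^esub> j x = j (Re a *\<^sub>R x)"
  and E_ip: "\<lbrakk>x \<in> V; y \<in> V\<rbrakk> \<Longrightarrow> ip E (j x) (j y) = of_real (x \<bullet> y)"
  by (simp_all add: subspace_model_def)

lemma E_abelian: "abelian_group E"
proof (rule abelian_groupI)
  fix p assume "p \<in> carrier E"
  then obtain x where x: "x \<in> V" "p = j x" by (auto simp: E_carrier)
  show "\<exists>q\<in>carrier E. q \<oplus>\<^bsub>E\<^esub> p = \<zero>\<^bsub>E\<^esub>"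
    using x sub by (intro bexI[of _ "j (- x)"]) (auto simp: E_carrier E_add E_zero)
qed (auto simp: E_carrier E_zero E_add sub algebra_simps)

lemma E_inner: "inner_product_space \<real> E"
proof (intro inner_product_space.intro inner_product_space_axioms.intro Module.moduleI E_abelian)
  show "cring (scalar_field \<real>)" by (rule cring_scalar_field) simp
next
  fix p assume "p \<in> carrier E" "p \<noteq> \<zero>\<^bsub>E\<^esub>"
  then obtain x where "x \<in> V" "p = j x" "x \<noteq> 0" by (auto simp: E_carrier E_zero)
  then show "0 < Re (ip E p p)" by (simp add: E_ip)
qed (auto simp: E_carrier E_add E_smult E_ip sub inner_commute inner_add_left inner_add_right scaleR_add_left scaleR_add_right complex_is_Real_iff
    intro!: complex_eqI)

sublocale E: inner_product_space \<real> E by (rule E_inner)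

lemma E_hdist: "\<lbrakk>x \<in> V; y \<in> V\<rbrakk> \<Longrightarrow> hdist E (j x) (j y) = dist x y"
proof -
  assume x: "x \<in> V" and y: "y \<in> V"
  have "\<ominus>\<^bsub>E\<^esub> j y = j (- y)"
    using y by (intro E.M.minus_equality) (auto simp: E_carrier E_zero E_add sub)
  then have "j x \<ominus>\<^bsub>E\<^esub> j y = j (x - y)" using x y by (simp add: a_minus_def E_add sub)
  then show ?thesis using x y by (simp add: hdist_def E_carrier hnorm_def E_ip sub dist_norm norm_eq_sqrt_inner)
qed

lemma E_topspace: "topspace (htop E) = j ` V"
  unfolding E.htop_eq E.Metric.topspace_mtopology by (rule E_carrier)

lemma E_mball: "x \<in> V \<Longrightarrow> q \<in> E.Metric.mball (j x) r \<longleftrightarrow> (\<exists>y\<in>V. q = j y \<and> dist x y < r)"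
  unfolding E.Metric.in_mball by (auto simp: E_carrier E_hdist)

lemma compact_ball: "compact (V \<inter> cball 0 R)"
  using fin compact_subspace_cball V by blast

lemma E_complete: "Metric_space.mcomplete (carrier E) (hdist E)"
  unfolding E.Metric.mcomplete_def
proof (intro allI impI)
  fix s assume c: "E.Metric.MCauchy s"
  have sE: "s n \<in> j ` V" for n using c E_carrier unfolding E.Metric.MCauchy_def by blast
  define t where "t = (\<lambda>n. inv_into V j (s n))"
  have tV: "t n \<in> V" and s: "s n = j (t n)" for n
    using sE[of n] by (simp_all add: t_def inv_into_into f_inv_into_f)
  have "Cauchy t"
    unfolding Cauchy_def using c tV unfolding E.Metric.MCauchy_def s by (auto simp: E_hdist)
  then obtain R where R: "\<And>n. norm (t n) \<le> R"
    using cauchy_imp_bounded[of t] unfolding bounded_iff by auto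
  have "complete (V \<inter> cball 0 R)" by (intro compact_imp_complete compact_ball)
  then obtain l where l: "l \<in> V" "t \<longlonglongrightarrow> l"
    using \<open>Cauchy t\<close> tV R unfolding complete_def by (metis IntD1 IntI mem_cball_0)
  have "limitin E.Metric.mtopology s (j l) sequentially"
    unfolding E.Metric.limit_metric_sequentially s
    using l tV unfolding LIMSEQ_def by (simp add: E_carrier E_hdist)
  then show "\<exists>x. limitin E.Metric.mtopology s x sequentially" ..
qed

lemma E_finsum: "finite A \<Longrightarrow> (\<And>x. x \<in> A \<Longrightarrow> f x \<in> V) \<Longrightarrow> (\<Oplus>\<^bsub>E\<^esub>x\<in>A. j (f x)) = j (\<Sum>x\<in>A. f x)"
proof (induction A rule: finite_induct)
  case empty
  then show ?case by (simp add: E_zero)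
next
  case (insert x A)
  then show ?case
    by (subst E.M.finsum_insert) (auto simp: E_carrier E_add subspace_sum[OF V])
qed

lemma E_euclidean: "euclidean_space_on E"
  unfolding euclidean_space_on_def
proof (intro conjI hilbert_space.intro hilbert_space_axioms.intro E_inner E_complete)
  obtain B where oB: "orthonormal_set B" and B: "span B = V"
    using fin orthonormal_basis_of_subspace[OF V] by blast
  interpret B: orthonormal_set B by (rule oB)
  have BV: "B \<subseteq> V" using B span_base by blast
  then have injB: "inj_on j B" using inj inj_on_subset by blast
  show "finite_dimensional \<real> E (carrier E)"
    unfolding finite_dimensional_def
  proof (intro exI[of _ "j ` B"] conjI ballI)
    show "finite (j ` B)" using B.finite_B by simp
    show "j ` B \<subseteq> carrier E" using BV by (auto simp: E_carrier)
    fix w assume "w \<in> carrier E"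
    then obtain x where x: "x \<in> V" "w = j x" by (auto simp: E_carrier)
    let ?c = "\<lambda>p. complex_of_real (x \<bullet> inv_into V j p)"
    have "(\<Oplus>\<^bsub>E\<^esub>p\<in>j ` B. ?c p \<odot>\<^bsub>E\<^esub> p) = (\<Oplus>\<^bsub>E\<^esub>e\<in>B. ?c (j e) \<odot>\<^bsub>E\<^esub> j e)"
      using injB BV by (intro E.M.finsum_reindex) (auto simp: E_carrier E_smult sub subset_iff)
    also have "\<dots> = (\<Oplus>\<^bsub>E\<^esub>e\<in>B. j ((x \<bullet> e) *\<^sub>R e))"
      using BV by (intro E.M.finsum_cong') (auto simp: E_carrier E_smult sub subset_iff)
    also have "\<dots> = j (\<Sum>e\<in>B. (x \<bullet> e) *\<^sub>R e)" using BV sub B.finite_B by (intro E_finsum) auto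
    also have "\<dots> = w" using B.proj_span[of x] x B by (simp add: orthonormal_proj_def)
    finally show "\<exists>c\<in>j ` B \<rightarrow> \<real>. w = (\<Oplus>\<^bsub>E\<^esub>p\<in>j ` B. c p \<odot>\<^bsub>E\<^esub> p)"
      by (intro bexI[of _ ?c]) auto
  qed
qed

lemma compactin_cball: "compactin (htop E) (j ` (V \<inter> cball 0 R))"
proof (rule image_compactin)
  show "compactin (top_of_set V) (V \<inter> cball 0 R)"
    using compact_ball by (simp add: compactin_subtopology)
  show "continuous_map (top_of_set V) (htop E) j"
    unfolding E.continuous_map_htop
  proof (intro conjI ballI allI impI)
    fix x and \<epsilon> :: real assume x: "x \<in> topspace (top_of_set V)" and e: "\<epsilon> > 0"
    have "openin (top_of_set V) (V \<inter> ball x \<epsilon>)" by (simp add: openin_open_Int)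
    moreover have "\<forall>y\<in>V \<inter> ball x \<epsilon>. hdist E (j x) (j y) < \<epsilon>" using x by (auto simp: E_hdist)
    ultimately show "\<exists>U. openin (top_of_set V) U \<and> x \<in> U \<and> (\<forall>y\<in>U. hdist E (j x) (j y) < \<epsilon>)"
      using x e by (intro exI[of _ "V \<inter> ball x \<epsilon>"]) auto
  qed (auto simp: E_carrier)
qed

lemma compactin_bounded:
  assumes "compactin (htop E) L"
  shows "\<exists>R. \<forall>p\<in>L. \<exists>x\<in>V. p = j x \<and> norm x \<le> R"
proof -
  have "E.Metric.mbounded L" using assms E.Metric.compactin_imp_mbounded by (simp add: E.htop_eq)
  then obtain c B where L: "L \<subseteq> E.Metric.mcball c B" unfolding E.Metric.mbounded_def by blast
  have "\<exists>x\<in>V. p = j x \<and> norm x \<le> norm (inv_into V j c) + B" if p: "p \<in> L" for p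
  proof -
    have "c \<in> carrier E" "p \<in> carrier E" "hdist E c p \<le> B" using L p by auto
    then obtain u x where u: "u \<in> V" "c = j u" and x: "x \<in> V" "p = j x" and d: "dist u x \<le> B"
      by (auto simp: E_carrier E_hdist)
    have "norm x \<le> norm u + B" using d norm_triangle_sub[of x u] by (simp add: dist_norm norm_minus_commute)
    then show ?thesis using u x by auto
  qed
  then show ?thesis by blast
qed

end

section \<open>Actions on Euclidean spaces from cocycles\<close>

text \<open>
  The group acts by \<open>x \<mapsto> \<sigma> g x + b g\<close>. If \<open>g\<close> moves a point of norm at most \<open>R\<close> to such a point, then
  \<open>|b g| \<le> 2 R\<close>, so properness of \<open>b\<close> gives properness of the action. If \<open>b\<close> is \<open>R\<close>-cobounded, then the translates
  of the ball of radius \<open>R\<close> cover the space.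
\<close>

theorem euclidean_action_of_cocycle:
  fixes G :: "('g, 'm) monoid_scheme" (structure) and \<sigma> :: "'g \<Rightarrow> 'a::real_inner \<Rightarrow> 'a" and j :: "'a \<Rightarrow> 'w"
  assumes lc: "locally_compact_group G T"
    and coc: "finite_dimensional_cocycle G \<sigma> V b"
    and cob: "finite_dimensional_cocycle.cobounded G V b"
    and cont_b: "continuous_into_metric T b" and cont_\<sigma>: "\<And>x. continuous_into_metric T (\<lambda>g. \<sigma> g x)"
    and proper: "proper_into_normed T b" and inj: "inj j"
  shows "\<exists>(E :: 'w inner_module) \<alpha>. euclidean_space_on E \<and> isometric_action G T E \<alpha> \<and>
             proper_action G T E \<alpha> \<and> cocompact_action G E \<alpha>"
proof -
  interpret locally_compact_group G T by (rule lc)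
  interpret finite_dimensional_cocycle G \<sigma> V b by (rule coc)
  interpret S: subspace_copy V j
    using subspace finite_dim inj by unfold_locales (auto intro: inj_on_subset)
  let ?E = "subspace_model j V"
  define \<alpha> where "\<alpha> = (\<lambda>g. \<lambda>p\<in>carrier ?E. j (\<sigma> g (inv_into V j p) + b g))"
  have \<alpha>: "\<alpha> g (j x) = j (\<sigma> g x + b g)" if "x \<in> V" for g x
    using that by (simp add: \<alpha>_def S.E_carrier)
  have AV: "\<sigma> g x + b g \<in> V" if "g \<in> carrier G" "x \<in> V" for g x
    using that by (intro subspace_add subspace invariant closed)
  have act: "group_action G (carrier ?E) \<alpha>"
    unfolding \<alpha>_def S.E_carrier
    by (rule group_action_restrictI) (auto simp: AV mult cocycle add add.assoc one cocycle_one)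
  have "isometric_action G T ?E \<alpha>"
  proof (intro isometric_action.intro isometric_action_axioms.intro act)
    show "hdist ?E (\<alpha> g p) (\<alpha> g q) = hdist ?E p q" if "g \<in> carrier G" "p \<in> carrier ?E" "q \<in> carrier ?E" for g p q
      using that by (auto simp: S.E_carrier \<alpha> S.E_hdist AV dist_norm isometry simp flip: diff)
    show "continuous_map (prod_topology T (htop ?E)) (htop ?E) (\<lambda>(g, p). \<alpha> g p)"
      unfolding S.E.continuous_map_htop
    proof (intro conjI ballI allI impI)
      fix z and \<epsilon> :: real assume "z \<in> topspace (prod_topology T (htop ?E))" and e: "\<epsilon> > 0"
      then obtain g x where z: "z = (g, j x)" "g \<in> carrier G" "x \<in> V"
        by (auto simp: topspace_eq S.E_topspace)
      have e3: "\<epsilon> / 3 > 0" using e by simp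
      obtain U1 where U1: "openin T U1" "g \<in> U1" "\<forall>h\<in>U1. dist (\<sigma> g x) (\<sigma> h x) < \<epsilon> / 3"
        using cont_\<sigma>[of x] z(2) e3 unfolding continuous_into_metric_def topspace_eq by blast
      obtain U2 where U2: "openin T U2" "g \<in> U2" "\<forall>h\<in>U2. dist (b g) (b h) < \<epsilon> / 3"
        using cont_b z(2) e3 unfolding continuous_into_metric_def topspace_eq by blast
      let ?W = "(U1 \<inter> U2) \<times> S.E.Metric.mball (j x) (\<epsilon> / 3)"
      have "openin (prod_topology T (htop ?E)) ?W"
        using U1 U2 by (simp add: openin_prod_Times_iff openin_Int S.E.htop_eq)
      moreover have "z \<in> ?W" using z U1 U2 e3 S.E_mball[OF z(3), of "j x" "\<epsilon> / 3"] by auto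
      moreover have "hdist ?E (\<alpha> g (j x)) (\<alpha> h q) < \<epsilon>" if hq: "(h, q) \<in> ?W" for h q
      proof -
        obtain y where y: "y \<in> V" "q = j y" and d: "dist x y < \<epsilon> / 3"
          using hq S.E_mball[OF z(3), of q "\<epsilon> / 3"] by blast
        have h: "h \<in> carrier G" using hq U1(1) openin_subset topspace_eq by blast
        have "(\<sigma> g x + b g) - (\<sigma> h y + b h) = (\<sigma> g x - \<sigma> h x) + \<sigma> h (x - y) + (b g - b h)"
          using h by (simp add: diff)
        then have "norm ((\<sigma> g x + b g) - (\<sigma> h y + b h)) \<le> norm (\<sigma> g x - \<sigma> h x) + norm (\<sigma> h (x - y)) + norm (b g - b h)"
          by (metis norm_triangle_ineq norm_triangle_mono order_refl)
        also have "\<dots> < \<epsilon>" using hq U1(3) U2(3) d h by (auto simp: isometry dist_norm) fastforce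
        finally show ?thesis using y z h by (simp add: \<alpha> S.E_hdist AV dist_norm)
      qed
      ultimately show "\<exists>U. openin (prod_topology T (htop ?E)) U \<and> z \<in> U \<and>
          (\<forall>y\<in>U. hdist ?E (case z of (g, p) \<Rightarrow> \<alpha> g p) (case y of (g, p) \<Rightarrow> \<alpha> g p) < \<epsilon>)"
        unfolding z(1) by (intro exI[of _ ?W]) auto
    qed (auto simp: topspace_eq S.E_topspace S.E_carrier \<alpha> AV)
  qed
  moreover have "proper_action G T ?E \<alpha>"
    unfolding proper_action_def
  proof (intro allI impI)
    fix L assume "compactin (htop ?E) L"
    then obtain R where R: "\<And>p. p \<in> L \<Longrightarrow> \<exists>x\<in>V. p = j x \<and> norm x \<le> R" using S.compactin_bounded by blast
    obtain Q where Q: "compactin T Q" "{g \<in> carrier G. norm (b g) \<le> 2 * R} \<subseteq> Q"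
      using proper unfolding proper_into_normed_def topspace_eq by blast
    have "{g \<in> carrier G. \<alpha> g ` L \<inter> L \<noteq> {}} \<subseteq> Q"
    proof
      fix g assume "g \<in> {g \<in> carrier G. \<alpha> g ` L \<inter> L \<noteq> {}}"
      then obtain p where g: "g \<in> carrier G" and p: "p \<in> L" "\<alpha> g p \<in> L" by blast
      obtain x where x: "x \<in> V" "p = j x" "norm x \<le> R" using R[OF p(1)] by blast
      obtain y where y: "y \<in> V" "\<alpha> g p = j y" "norm y \<le> R" using R[OF p(2)] by blast
      have "j (\<sigma> g x + b g) = j y" using x y by (simp add: \<alpha>)
      then have "b g = y - \<sigma> g x" using inj by (auto dest: injD)
      then have "norm (b g) \<le> 2 * R"
        using norm_triangle_ineq4[of y "\<sigma> g x"] x(3) y(3) g by (simp add: isometry)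
      then show "g \<in> Q" using Q(2) g by blast
    qed
    then have "T closure_of {g \<in> carrier G. \<alpha> g ` L \<inter> L \<noteq> {}} \<subseteq> Q"
      by (rule closure_of_minimal) (use compactin_imp_closedin[OF hausdorff Q(1)] in simp)
    then show "compactin T (T closure_of {g \<in> carrier G. \<alpha> g ` L \<inter> L \<noteq> {}})"
      by (intro closed_compactin[OF Q(1)]) auto
  qed
  moreover have "cocompact_action G ?E \<alpha>"
  proof -
    obtain R where R: "\<And>x. x \<in> V \<Longrightarrow> \<exists>g\<in>carrier G. norm (x - b g) \<le> R"
      using cob unfolding cobounded_def by blast
    let ?L = "j ` (V \<inter> cball 0 R)"
    have "(\<Union>g\<in>carrier G. \<alpha> g ` ?L) = carrier ?E"
    proof
      show "(\<Union>g\<in>carrier G. \<alpha> g ` ?L) \<subseteq> carrier ?E" by (auto simp: S.E_carrier \<alpha> AV)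
      show "carrier ?E \<subseteq> (\<Union>g\<in>carrier G. \<alpha> g ` ?L)"
      proof
        fix p assume "p \<in> carrier ?E"
        then obtain y where y: "y \<in> V" "p = j y" by (auto simp: S.E_carrier)
        obtain g where g: "g \<in> carrier G" "norm (y - b g) \<le> R" using R[OF y(1)] by blast
        let ?x = "\<sigma> (inv g) (y - b g)"
        have x: "?x \<in> V" using g y subspace by (intro invariant subspace_diff closed) auto
        have "norm ?x \<le> R" using g by (simp add: isometry)
        then have "j ?x \<in> ?L" using x by simp
        moreover have "\<alpha> g (j ?x) = p" using x y g by (simp add: \<alpha> inv_right)
        ultimately show "p \<in> (\<Union>g\<in>carrier G. \<alpha> g ` ?L)" using g by (metis UN_I image_eqI)
      qed
    qed
    then show ?thesis unfolding cocompact_action_def using S.compactin_cball by blast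
  qed
  ultimately show ?thesis using S.E_euclidean by blast
qed

definition real_coords :: "finseq \<Rightarrow> nat \<Rightarrow> real" where
  "real_coords x k = (if even k then Re (entry x (k div 2)) else Im (entry x (k div 2)))"

lemma inj_real_coords: "inj real_coords"
proof (rule injI, rule finseq_eqI)
  fix x y i assume "real_coords x = real_coords y"
  then have "real_coords x (2 * i) = real_coords y (2 * i)" "real_coords x (2 * i + 1) = real_coords y (2 * i + 1)"
    by simp_all
  then show "entry x i = entry y i" by (simp add: real_coords_def complex_eq_iff)
qed

lemma unitary_linear_growth:
  fixes G :: "('g, 'm) monoid_scheme" and H :: "'v inner_module"
  assumes lc: "locally_compact_group G T" and HFD: "property_HFD G T"
    and rep: "unitary_rep G T H \<pi>" and b: "b \<in> cocycles G T H \<pi>"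
    and growth: "linear_growth G T (\<lambda>g. hnorm H (b g))"
  shows "(\<exists>(E :: (nat \<Rightarrow> real) inner_module) \<alpha>.
             euclidean_space_on E \<and> isometric_action G T E \<alpha> \<and>
             proper_action G T E \<alpha> \<and> cocompact_action G E \<alpha>)
         \<and> (T = discrete_topology (carrier G) \<longrightarrow> virtually_abelian G)"
proof -
  interpret hilbert_rep G T UNIV H \<pi> by (rule rep)
  interpret unitary_cocycle G T H \<pi> b
    by (intro unitary_cocycle.intro unitary_cocycle_axioms.intro complex_hilbert.intro rep lc b hilbert_space_axioms)
  obtain \<sigma> :: "'g \<Rightarrow> finseq \<Rightarrow> finseq" and V a where a: "finite_dimensional_cocycle G \<sigma> V a"
    and cont_a: "continuous_into_metric T a" and cont_\<sigma>: "\<And>x. continuous_into_metric T (\<lambda>g. \<sigma> g x)"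
    and prop_a: "proper_into_normed T a"
    using finite_dimensional_model[OF HFD growth] by blast
  obtain V' P K where a': "finite_dimensional_cocycle G \<sigma> V' (\<lambda>g. P (a g))"
    and cob: "finite_dimensional_cocycle.cobounded G V' (\<lambda>g. P (a g))"
    and P: "linear P" "\<And>x. norm (P x) \<le> norm x" and K: "\<And>g. g \<in> carrier G \<Longrightarrow> norm (a g - P (a g)) \<le> K"
    using cobounded_projection[OF a] by blast
  have cont: "continuous_into_metric T (\<lambda>g. P (a g))"
    unfolding continuous_into_metric_def
  proof (intro ballI allI impI)
    fix x and \<epsilon> :: real assume "x \<in> topspace T" "\<epsilon> > 0"
    then obtain U where U: "openin T U" "x \<in> U" "\<forall>y\<in>U. dist (a x) (a y) < \<epsilon>"
      using cont_a unfolding continuous_into_metric_def by blast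
    have "dist (P (a x)) (P (a y)) \<le> dist (a x) (a y)" for y
      using P(2)[of "a x - a y"] by (simp add: dist_norm linear_diff[OF P(1)])
    then show "\<exists>U. openin T U \<and> x \<in> U \<and> (\<forall>y\<in>U. dist (P (a x)) (P (a y)) < \<epsilon>)"
      using U by (meson order_le_less_trans)
  qed
  have proper: "proper_into_normed T (\<lambda>g. P (a g))"
    unfolding proper_into_normed_def topspace_eq
  proof
    fix R
    have "norm (a g) \<le> R + K" if "g \<in> carrier G" "norm (P (a g)) \<le> R" for g
      using K[OF that(1)] that(2) norm_triangle_sub[of "a g" "P (a g)"] by linarith
    then have "{g \<in> carrier G. norm (P (a g)) \<le> R} \<subseteq> {g \<in> carrier G. norm (a g) \<le> R + K}" by blast
    then show "\<exists>Q. compactin T Q \<and> {g \<in> carrier G. norm (P (a g)) \<le> R} \<subseteq> Q"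
      using prop_a unfolding proper_into_normed_def topspace_eq by (meson order_trans)
  qed
  have "virtually_abelian G" if disc: "T = discrete_topology (carrier G)"
  proof -
    interpret D: discrete_cobounded_cocycle G \<sigma> V' "\<lambda>g. P (a g)"
    proof (intro discrete_cobounded_cocycle.intro discrete_cobounded_cocycle_axioms.intro a' cob)
      fix R
      obtain Q where "compactin T Q" "{g \<in> carrier G. norm (P (a g)) \<le> R} \<subseteq> Q"
        using proper unfolding proper_into_normed_def topspace_eq by blast
      then show "finite {g \<in> carrier G. norm (P (a g)) \<le> R}"
        unfolding disc compactin_discrete_topology using finite_subset by blast
    qed
    obtain S where "compactin T S" "generate G S = carrier G"
      using growth unfolding linear_growth_def compact_generating_set_def by blast
    then show ?thesis using D.virtually_abelian[of S] unfolding disc compactin_discrete_topology by blast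
  qed
  then show ?thesis
    using euclidean_action_of_cocycle[OF lc a' cob cont cont_\<sigma> proper inj_real_coords] by blast
qed

theorem theorem1p3:
  fixes G :: "('g, 'm) monoid_scheme" and T :: "'g topology"
    and H :: "'v inner_module" and l :: "'g \<Rightarrow> real"
  assumes "locally_compact_group G T"
    and "compactly_generated G T"
    and "property_HFD G T"
    and "hilbert_length_function G T H l"
    and "linear_growth G T l"
  shows "(\<exists>(E :: (nat \<Rightarrow> real) inner_module) \<alpha>.
             euclidean_space_on E \<and> isometric_action G T E \<alpha> \<and>
             proper_action G T E \<alpha> \<and> cocompact_action G E \<alpha>)
         \<and> (T = discrete_topology (carrier G) \<longrightarrow> virtually_abelian G)"
proof -
  interpret locally_compact_group G T by (rule assms(1))
  obtain \<pi> b where rep: "unitary_rep G T H \<pi> \<or> orthogonal_rep G T H \<pi>" and b: "b \<in> cocycles G T H \<pi>"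
    and l: "\<And>g. g \<in> carrier G \<Longrightarrow> l g = hnorm H (b g)"
    using assms(4) unfolding hilbert_length_function_def by blast
  have growth: "linear_growth G T f" if "\<And>g. g \<in> carrier G \<Longrightarrow> f g = l g" for f
    using assms(5) that unfolding linear_growth_def by simp
  from rep show ?thesis
  proof
    assume "unitary_rep G T H \<pi>"
    then show ?thesis using l by (intro unitary_linear_growth[OF assms(1,3) _ b] growth) auto
  next
    assume "orthogonal_rep G T H \<pi>"
    then obtain \<pi>' b' where rep': "unitary_rep G T (complexify H) \<pi>'"
      and b': "b' \<in> cocycles G T (complexify H) \<pi>'"
      and n: "\<And>g. g \<in> carrier G \<Longrightarrow> hnorm (complexify H) (b' g) = hnorm H (b g)"
      using complexified_cocycle[OF topspace_eq _ b] by blast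
    show ?thesis using l n by (intro unitary_linear_growth[OF assms(1,3) rep' b'] growth) auto
  qed
qed

end
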